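(* Let $S_{g,n}$, $\mathcal{T}=(V,E,F)$ be as in the context. Let $\hat k,\hat k^*\in\mathbb{R}_{>0}^{|V^{\partial}|}$, $\hat T\in\mathfrak{T}$, and let $P$ and $P^*$ be the generalized circle packings on $S_{g,n}$ that realize $(\hat k,\hat T)$ and $(\hat k^*,\hat T)$ respectively, with geodesic curvatures $k(P(v))$ and $k(P^*(v))$ at $v\in V$. Let $\operatorname{Area}(\Omega_f)$, $l_v^f$, $d_{ij}$ be the areas, arc lengths and distances for $P$ defined in the context, and $\operatorname{Area}(\Omega_f^* )$, $l_v^{f*}$, $d_{ij}^*$ the corresponding quantities for $P^*$. If the inequality $k(P^*(v))\le k(P(v))$ is true for each boundary vertex $v$, then: (a) $\operatorname{Area}(\Omega_f^* )\ge\operatorname{Area}(\Omega_f)$ for every face $f$; (b) $l_v^{f*}\ge l_v^f$ for every face $f$ and every vertex $v$ of $f$; (c) $d_{ij}^*\ge d_{ij}$ for any two tangent points $i,j$ of $P$ and the corresponding tangent points $i^*,j^*$ of $P^*$.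
   Context: **Generalized circles.** In the hyperbolic plane $\mathbb{H}^2$ (curvature $-1$) a generalized circle is a circle, a horocycle or a hypercycle (a curve at constant distance from a geodesic, its axis). Its shape is determined by its constant geodesic curvature $k>0$: if $k>1$ it is a circle of radius $\operatorname{arccoth}k$; if $k=1$ a horocycle; if $0<k<1$ a hypercycle at distance $\operatorname{arctanh}k$ from its axis. The center is the usual center, the limiting ideal point, or the axis, respectively. Externally tangent means tangent with the convex sides (disk, horodisk, side containing the axis) having disjoint interiors. **Packing of one triangle.** For a triangle $f$ with vertices $v_1,v_2,v_3$ and $(k_1,k_2,k_3)\in\mathbb{R}_{>0}^3$, it is known that there is a configuration $P(f)$, determined by $(k_1,k_2,k_3)$ up to isometry, of three mutually externally tangent generalized circles $C_1,C_2,C_3$ in $\mathbb{H}^2$ with geodesic curvatures $k_1,k_2,k_3$, together with a hyperbolic circle $C_f$ (the dual circle) perpendicular to each $C_i$ and passing through all the tangent points. Let $l_i^f$ (also written $l_{v_i}^f$) be the length of the sub-arc $C_i^f$ of $C_i$ contained in (inside) $C_f$, and $T_i^f=k_i\,l_i^f$ its total geodesic curvature. $\Omega_f$ is the region enclosed by the three sub-arcs $C_1^f,C_2^f,C_3^f$, and $\operatorname{Area}(\Omega_f)$ is its hyperbolic area. Joining the centers by shortest geodesics gives the (generalized) hyperbolic triangle $\hat f$. **Surface and triangulation.** $S_{g,n}$ is obtained by removing $n\ge 1$ topological open disks from an oriented compact surface of genus $g\ge 0$. $\mathcal{T}=(V,E,F)$ is a triangulation; $V_f$ is the set of three vertices of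 $f\in F$. $V^{\partial}$ and $V^{\circ}$ are the sets of boundary and interior vertices, $V=V^{\circ}\cup V^{\partial}$, each enumerated $1,2,\dots$. It is assumed that there are at least two boundary vertices and that each face has at most two boundary vertices. **Packing on the surface.** Curvatures in $\mathbb{R}_{>0}^{|V|}$ determine a packing $P(f)$ for each face; gluing the triangles $\hat f$ along edges gives a surface with hyperbolic conical metric, and the resulting pattern is a generalized circle packing $P$ on $S_{g,n}$. The total geodesic curvature at $v\in V^{\circ}$ is $T_v=\sum_{f\in F,\,v\in V_f}T_v^f$. $P$ realizes $(\hat k,\hat T)$ if its geodesic curvature equals $\hat k$ on $V^{\partial}$ and its total geodesic curvature equals $\hat T$ on $V^{\circ}$. For $\hat T\in\mathfrak{T}$ such a packing exists and is unique up to isometry. **Distances.** Each edge of $\mathcal{T}$ carries exactly one tangent point of $P$ (where the generalized circles at its two endpoints touch); tangent points of $P$ and $P^*$ correspond when they lie on the same edge. In the surface formed by the union of the closed regions $\Omega_f$, $f\in F$, joined at tangent points, $d_{ij}$ is the shortest distance between the tangent points $i$ and $j$; such a shortest path consists of sub-arcs, so that $d_{ij}$ is the minimum, over all chains of sub-arcs $C_v^f$ joining $i$ to $j$ (each $C_v^f$ joins the two tangent points on the edges of $f$ incident to $v$), of the sum of their lengths $l_v^f$. For $I\subset V^{\circ}$, $F_I=\{f\in F\mid \exists v\in I,\ v\in V_f\}$, and $\mathfrak{T}=\{(T_1,\ldots,T_{|V^{\circ}|})\in\mathbb{R}^{|V^{\circ}|}_{>0}\mid \sum_{v\in I}T_v<\pi|F_I|\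 \forall\,\emptyset\ne I\subset V^{\circ}\}$. *)

theory Defs
  imports "HOL-Analysis.Analysis"
begin

section \<open>The hyperbolic plane (Poincare disk model, curvature -1)\<close>

definition hplane :: "complex set" where
  "hplane = ball 0 1"

definition hdist :: "complex \<Rightarrow> complex \<Rightarrow> real" where
  "hdist z w = arcosh (1 + 2 * (norm (z - w))\<^sup>2 / ((1 - (norm z)\<^sup>2) * (1 - (norm w)\<^sup>2)))"

definition hlength :: "(real \<Rightarrow> complex) \<Rightarrow> real" where
  "hlength \<gamma> = integral {0..1}
     (\<lambda>t. 2 * norm (vector_derivative \<gamma> (at t)) / (1 - (norm (\<gamma> t))\<^sup>2))"

text \<open>The length of a set that is a smooth arc; it does not depend on the regular
  parametrization.\<close>

definition harc_length :: "complex set \<Rightarrow> real" where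
  "harc_length A = (THE L. \<exists>\<gamma>. arc \<gamma> \<and> \<gamma> C1_differentiable_on {0..1} \<and>
     (\<forall>t\<in>{0..1}. vector_derivative \<gamma> (at t) \<noteq> 0) \<and> path_image \<gamma> = A \<and> L = hlength \<gamma>)"

definition harea :: "complex set \<Rightarrow> real" where
  "harea A = (LINT z:A|lborel. 4 / (1 - (norm z)\<^sup>2)\<^sup>2)"

definition hball :: "complex \<Rightarrow> real \<Rightarrow> complex set" where
  "hball c r = {z \<in> hplane. hdist c z < r}"

definition hcball :: "complex \<Rightarrow> real \<Rightarrow> complex set" where
  "hcball c r = {z \<in> hplane. hdist c z \<le> r}"

definition hcircle :: "complex \<Rightarrow> real \<Rightarrow> complex set" where
  "hcircle c r = {z \<in> hplane. hdist c z = r}"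

text \<open>Geodesics are the intersections of the disk with the Euclidean lines through \<open>0\<close>
  (\<open>a = 0\<close>) and the Euclidean circles orthogonal to the unit circle (centre \<open>b / a\<close>,
  squared radius \<open>(norm b / a)\<^sup>2 - 1\<close>), hence \<open>\<bar>a\<bar> < norm b\<close> below.
  Negating \<open>(a, b)\<close> exchanges the two sides.\<close>

definition geodesic :: "real \<Rightarrow> complex \<Rightarrow> complex set" where
  "geodesic a b = {z \<in> hplane. 2 * (b \<bullet> z) = a * (1 + (norm z)\<^sup>2)}"

definition half_plane :: "real \<Rightarrow> complex \<Rightarrow> complex set" where
  "half_plane a b = {z \<in> hplane. 2 * (b \<bullet> z) < a * (1 + (norm z)\<^sup>2)}"


section \<open>Generalized circles\<close>

text \<open>A generalized circle is represented by its open convex side \<open>D\<close>; the curve itself is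
  \<open>hbdry D\<close>. The predicate \<open>gen_disk k D\<close> says that the boundary curve has
  geodesic curvature \<open>k\<close>. For \<open>k > 1\<close> the radius is \<open>arccoth k = artanh (1/k)\<close>; horodisks are
  the Euclidean disks internally tangent to the unit circle at the ideal centre \<open>\<omega>\<close>;
  for \<open>k < 1\<close> the convex side consists of one side of the axis together with the
  points at distance less than \<open>artanh k\<close> from the axis.\<close>

definition gen_disk :: "real \<Rightarrow> complex set \<Rightarrow> bool" where
  "gen_disk k D \<longleftrightarrow>
     (k > 1 \<and> (\<exists>c\<in>hplane. D = hball c (artanh (1 / k)))) \<or>
     (k = 1 \<and> (\<exists>\<omega> \<rho>. norm \<omega> = 1 \<and> 0 < \<rho> \<and> \<rho> < 1 \<and> D = ball (of_real (1 - \<rho>) * \<omega>) \<rho>)) \<or>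
     (0 < k \<and> k < 1 \<and> (\<exists>a b. \<bar>a\<bar> < norm b \<and>
        D = half_plane a b \<union> {z \<in> hplane. \<exists>w\<in>geodesic a b. hdist z w < artanh k}))"

definition hbdry :: "complex set \<Rightarrow> complex set" where
  "hbdry D = frontier D \<inter> hplane"

definition tangent_vectors :: "complex set \<Rightarrow> complex \<Rightarrow> complex set" where
  "tangent_vectors C p = {v. \<exists>\<gamma>::real \<Rightarrow> complex. \<gamma> 0 = p \<and>
     (\<gamma> has_vector_derivative v) (at 0) \<and> (\<forall>\<^sub>F t in nhds 0. \<gamma> t \<in> C)}"

definition tangent_at :: "complex set \<Rightarrow> complex set \<Rightarrow> complex \<Rightarrow> bool" where
  "tangent_at C C' p \<longleftrightarrow> p \<in> C \<and> p \<in> C' \<and>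
     (\<exists>v. v \<noteq> 0 \<and> v \<in> tangent_vectors C p \<and> v \<in> tangent_vectors C' p)"

text \<open>The model is conformal, so angles are Euclidean angles.\<close>

definition perpendicular :: "complex set \<Rightarrow> complex set \<Rightarrow> bool" where
  "perpendicular C C' \<longleftrightarrow> C \<inter> C' \<noteq> {} \<and>
     (\<forall>p \<in> C \<inter> C'. \<forall>v \<in> tangent_vectors C p. \<forall>w \<in> tangent_vectors C' p. v \<bullet> w = 0)"

definition externally_tangent :: "complex set \<Rightarrow> complex set \<Rightarrow> bool" where
  "externally_tangent D D' \<longleftrightarrow> D \<inter> D' = {} \<and> (\<exists>p. tangent_at (hbdry D) (hbdry D') p)"

text \<open>The configuration of one triangle with vertex set \<open>W\<close>: convex sides \<open>D v\<close> with curvatures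
  \<open>k v\<close>, and the dual circle with centre \<open>c\<close> and radius \<open>r\<close>.\<close>

definition triangle_packing ::
  "'v set \<Rightarrow> ('v \<Rightarrow> real) \<Rightarrow> ('v \<Rightarrow> complex set) \<Rightarrow> complex \<Rightarrow> real \<Rightarrow> bool" where
  "triangle_packing W k D c r \<longleftrightarrow>
     (\<forall>v\<in>W. gen_disk (k v) (D v)) \<and>
     (\<forall>u\<in>W. \<forall>v\<in>W. u \<noteq> v \<longrightarrow> externally_tangent (D u) (D v)) \<and>
     c \<in> hplane \<and> 0 < r \<and>
     (\<forall>v\<in>W. perpendicular (hcircle c r) (hbdry (D v))) \<and>
     (\<forall>u\<in>W. \<forall>v\<in>W. \<forall>p. u \<noteq> v \<and> tangent_at (hbdry (D u)) (hbdry (D v)) p \<longrightarrow> p \<in> hcircle c r)"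


section \<open>Triangulated surfaces\<close>

text \<open>Edges and faces are abstract, so that distinct edges may have the same end points; each face
  has three different vertices.\<close>

record ('v, 'e, 'f) triangulation =
  verts :: "'v set"
  edges :: "'e set"
  faces :: "'f set"
  ends :: "'e \<Rightarrow> 'v set"
  face_verts :: "'f \<Rightarrow> 'v set"
  face_edges :: "'f \<Rightarrow> 'e set"

definition adjacency :: "('v, 'e, 'f) triangulation \<Rightarrow> 'e set \<Rightarrow> ('v \<times> 'v) set" where
  "adjacency T A = {(u, v). \<exists>e\<in>A. ends T e = {u, v}}"

definition faces_at_edge :: "('v, 'e, 'f) triangulation \<Rightarrow> 'e \<Rightarrow> 'f set" where
  "faces_at_edge T e = {f \<in> faces T. e \<in> face_edges T f}"

definition boundary_edges :: "('v, 'e, 'f) triangulation \<Rightarrow> 'e set" where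
  "boundary_edges T = {e \<in> edges T. card (faces_at_edge T e) = 1}"

definition boundary_verts :: "('v, 'e, 'f) triangulation \<Rightarrow> 'v set" where
  "boundary_verts T = (\<Union>e\<in>boundary_edges T. ends T e)"

definition interior_verts :: "('v, 'e, 'f) triangulation \<Rightarrow> 'v set" where
  "interior_verts T = verts T - boundary_verts T"

definition boundary_components :: "('v, 'e, 'f) triangulation \<Rightarrow> 'v set set" where
  "boundary_components T =
     (\<lambda>v. (adjacency T (boundary_edges T))\<^sup>* `` {v}) ` boundary_verts T"

text \<open>Orientability: cyclic orders \<open>s f\<close> of the vertices of the faces such that two
  faces with a common edge induce opposite directions on it.\<close>

definition orientable :: "('v, 'e, 'f) triangulation \<Rightarrow> bool" where
  "orientable T \<longleftrightarrow> (\<exists>s :: 'f \<Rightarrow> 'v \<Rightarrow> 'v.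
     (\<forall>f\<in>faces T. \<exists>a b c. face_verts T f = {a, b, c} \<and> s f a = b \<and> s f b = c \<and> s f c = a) \<and>
     (\<forall>f\<in>faces T. \<forall>g\<in>faces T. \<forall>e\<in>face_edges T f \<inter> face_edges T g. \<forall>u v.
        f \<noteq> g \<and> ends T e = {u, v} \<and> s f u = v \<longrightarrow> s g v = u))"

text \<open>\<open>T\<close> is a triangulation of the surface obtained from the closed connected oriented surface of
  genus \<open>g\<close> by removing \<open>n\<close> disks. Since an edge lies in at most two faces, the condition that
  the faces at a vertex are connected through edges at that vertex says that its link is a
  circle or a segment. The last two conditions fix the topological type.\<close>

definition triangulates ::
  "('v, 'e, 'f) triangulation \<Rightarrow> nat \<Rightarrow> nat \<Rightarrow> bool" where
  "triangulates T g n \<longleftrightarrow>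
     finite (verts T) \<and> finite (edges T) \<and> finite (faces T) \<and> verts T \<noteq> {} \<and>
     (\<forall>f\<in>faces T. face_verts T f \<subseteq> verts T \<and> card (face_verts T f) = 3 \<and>
        face_edges T f \<subseteq> edges T \<and>
        bij_betw (ends T) (face_edges T f) {W. W \<subseteq> face_verts T f \<and> card W = 2}) \<and>
     (\<forall>v\<in>verts T. \<exists>f\<in>faces T. v \<in> face_verts T f) \<and>
     (\<forall>e\<in>edges T. card (faces_at_edge T e) \<in> {1, 2}) \<and>
     (\<forall>v\<in>verts T. \<forall>f\<in>faces T. \<forall>h\<in>faces T. v \<in> face_verts T f \<and> v \<in> face_verts T h \<longrightarrow>
        (f, h) \<in> {(f, h). f \<in> faces T \<and> h \<in> faces T \<and>
                   (\<exists>e \<in> face_edges T f \<inter> face_edges T h. v \<in> ends T e)}\<^sup>*) \<and>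
     (\<forall>u\<in>verts T. \<forall>v\<in>verts T. (u, v) \<in> (adjacency T (edges T))\<^sup>*) \<and>
     orientable T \<and>
     card (boundary_components T) = n \<and>
     int (card (verts T)) - int (card (edges T)) + int (card (faces T)) = 2 - 2 * int g - int n"

definition faces_meeting :: "('v, 'e, 'f) triangulation \<Rightarrow> 'v set \<Rightarrow> 'f set" where
  "faces_meeting T I = {f \<in> faces T. \<exists>v\<in>I. v \<in> face_verts T f}"

text \<open>The set of vectors \<open>\<TT>\<close>; a vector indexed by the interior vertices is a function
  of which only the values at interior vertices matter.\<close>

definition admissible_curvatures :: "('v, 'e, 'f) triangulation \<Rightarrow> ('v \<Rightarrow> real) set" where
  "admissible_curvatures T = {t. (\<forall>v\<in>interior_verts T. 0 < t v) \<and>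
     (\<forall>I. I \<noteq> {} \<and> I \<subseteq> interior_verts T \<longrightarrow>
        (\<Sum>v\<in>I. t v) < pi * real (card (faces_meeting T I)))}"


section \<open>Packings on surfaces\<close>

text \<open>The configuration of each face is placed in its own copy of the hyperbolic plane. The
  distance from the centre of a generalized circle to a tangent point depends only on its
  curvature, so the triangles of the centres fit together along the common edges, and the tangent
  points on a common edge are identified.\<close>

record ('v, 'f) packing =
  curv :: "'v \<Rightarrow> real"
  disk :: "'f \<Rightarrow> 'v \<Rightarrow> complex set"
  dual_center :: "'f \<Rightarrow> complex"
  dual_radius :: "'f \<Rightarrow> real"

definition is_packing :: "('v, 'e, 'f) triangulation \<Rightarrow> ('v, 'f) packing \<Rightarrow> bool" where
  "is_packing T P \<longleftrightarrow> (\<forall>v\<in>verts T. 0 < curv P v) \<and>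
     (\<forall>f\<in>faces T. triangle_packing (face_verts T f) (curv P) (disk P f)
        (dual_center P f) (dual_radius P f))"

definition sub_arc :: "('v, 'f) packing \<Rightarrow> 'f \<Rightarrow> 'v \<Rightarrow> complex set" where
  "sub_arc P f v = hbdry (disk P f v) \<inter> hcball (dual_center P f) (dual_radius P f)"

definition arc_len :: "('v, 'f) packing \<Rightarrow> 'f \<Rightarrow> 'v \<Rightarrow> real" where
  "arc_len P f v = harc_length (sub_arc P f v)"

definition Omega :: "('v, 'e, 'f) triangulation \<Rightarrow> ('v, 'f) packing \<Rightarrow> 'f \<Rightarrow> complex set" where
  "Omega T P f = inside (\<Union>v\<in>face_verts T f. sub_arc P f v)"

definition total_curv :: "('v, 'e, 'f) triangulation \<Rightarrow> ('v, 'f) packing \<Rightarrow> 'v \<Rightarrow> real" where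
  "total_curv T P v = (\<Sum>f | f \<in> faces T \<and> v \<in> face_verts T f. curv P v * arc_len P f v)"

definition realizes :: "('v, 'e, 'f) triangulation \<Rightarrow> ('v, 'f) packing \<Rightarrow>
    ('v \<Rightarrow> real) \<Rightarrow> ('v \<Rightarrow> real) \<Rightarrow> bool" where
  "realizes T P khat That \<longleftrightarrow> is_packing T P \<and>
     (\<forall>v\<in>boundary_verts T. curv P v = khat v) \<and>
     (\<forall>v\<in>interior_verts T. total_curv T P v = That v)"

text \<open>Tangent points are named by the edges carrying them. \<open>arc_chain T P i j L\<close>: some chain of
  sub-arcs of total length \<open>L\<close> joins the tangent points \<open>i\<close> and \<open>j\<close>.\<close>

inductive arc_chain ::
  "('v, 'e, 'f) triangulation \<Rightarrow> ('v, 'f) packing \<Rightarrow> 'e \<Rightarrow> 'e \<Rightarrow> real \<Rightarrow> bool"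
  for T P i where
  empty: "i \<in> edges T \<Longrightarrow> arc_chain T P i i 0"
| step: "arc_chain T P i j L \<Longrightarrow> f \<in> faces T \<Longrightarrow> j \<in> face_edges T f \<Longrightarrow> j' \<in> face_edges T f \<Longrightarrow>
    j \<noteq> j' \<Longrightarrow> v \<in> ends T j \<Longrightarrow> v \<in> ends T j' \<Longrightarrow> arc_chain T P i j' (L + arc_len P f v)"

text \<open>The surface is connected, so there are chains, and the infimum is a minimum because there
  are only finitely many sub-arcs.\<close>

definition tangent_dist ::
  "('v, 'e, 'f) triangulation \<Rightarrow> ('v, 'f) packing \<Rightarrow> 'e \<Rightarrow> 'e \<Rightarrow> real" where
  "tangent_dist T P i j = Inf {L. arc_chain T P i j L}"

end

theory Submission
  imports Defs
begin

text \<open>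
  Write \<open>k\<close> for the curvatures of one face, \<open>r\<close> for the radius of its dual circle
  and \<open>s = sinh r\<close>. Seen from the centre of the dual circle, the disk of curvature \<open>k\<^sub>i\<close> covers an
  angle \<open>2 \<alpha>\<^sub>i\<close> with \<open>cot \<alpha>\<^sub>i = k\<^sub>i s\<close>, and the three angles fill a full turn. Hence
  \<open>\<alpha>\<^sub>1 + \<alpha>\<^sub>2 + \<alpha>\<^sub>3 = \<pi>\<close>, which for the cotangents means
  \<open>s\<^sup>2 (k\<^sub>1 k\<^sub>2 + k\<^sub>2 k\<^sub>3 + k\<^sub>1 k\<^sub>3) = 1\<close>: the face is determined by its curvatures, and \<open>s\<close> grows
  when curvatures decrease.

  The sub-arc of a circle of curvature \<open>k\<close> has length
  \<open>ell k s = \<integral>\<^sub>0\<^sup>s 2 du / ((1 + k\<^sup>2 u\<^sup>2) sqrt (1 + u\<^sup>2))\<close>. This is visibly decreasing in \<open>k\<close> and increasing in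
  \<open>s\<close>. Substituting \<open>w = k u\<close> in \<open>k ell k s\<close> shows the second key property: if all curvatures
  of a face are multiplied by \<open>l > 1\<close>, so that every \<open>k\<^sub>i s\<close> is unchanged, all total curvatures of its arcs
  strictly increase (\<open>total_curvature_scaling\<close>).

  The global step is a maximum principle (\<open>curvature_maximum_principle\<close>). Let \<open>l\<close> be the largest
  ratio of the curvatures of the two packings, attained at \<open>x\<close>. If \<open>l > 1\<close>, then \<open>x\<close> is interior.
  Around \<open>x\<close> the second packing has curvature exactly \<open>l\<close> times the first at \<open>x\<close> and at most
  \<open>l\<close> times the first at the other vertices; lowering those only increases \<open>s\<close>. So in every face
  at \<open>x\<close> the total curvature is strictly larger than in the first packing, contradicting
  the equality of the prescribed total curvatures. Therefore all curvatures of the second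
  packing are at most those of the first, and the statement reduces to single faces.

  Arc lengths then compare by monotonicity of \<open>ell\<close>, and distances because a chain of arcs in one
  packing is a chain in the other. For areas, cut the region of a face by the
  radii of the dual circle to the tangent points. The three sectors have area
  \<open>2 arctan (k\<^sub>i s) - k\<^sub>i ell k\<^sub>i s\<close> (Gauss-Bonnet). Integrating by parts, and using that the angles
  \<open>arctan (k\<^sub>i s)\<close> add up to \<open>\<pi>/2\<close>, their sum becomes
  \<open>\<integral>\<^sub>0\<^sup>s (\<pi> - 2 (arctan (k\<^sub>1 u) + arctan (k\<^sub>2 u) + arctan (k\<^sub>3 u))) u (1 + u\<^sup>2)\<^sup>-\<^sup>3\<^sup>/\<^sup>2 du\<close>. The integrand
  is nonnegative and decreasing in each \<open>k\<^sub>i\<close>, while the upper limit \<open>s\<close> is decreasing in each \<open>k\<^sub>i\<close>,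
  so the area is monotone (\<open>tri_area_mono\<close>).

  The bulk of the text brings an abstract configuration into a form where these formulas can
  be computed. In the hyperboloid model all three kinds of generalized disks are cut out
  by one affine inequality, and perpendicularity equates a Lorentz product with the product of the
  curvatures. A
  Moebius transformation that moves the centre of the dual circle to \<open>0\<close> then leaves explicit
  Euclidean disks (\<open>triangle_normal_form\<close>).
\<close>

section \<open>Generalized disks in the hyperboloid model\<close>

text \<open>The point \<open>z\<close> of the disk corresponds to the point \<open>(hyp0 z, hypv z)\<close> of the hyperboloid
  \<open>x\<^sub>0\<^sup>2 - \<bar>x\<bar>\<^sup>2 = 1\<close>. There \<open>cosh\<close> of the distance is the Lorentz product, so circles, horocycles and
  hypercycles are all plane sections.\<close>

definition hyp0 :: "complex \<Rightarrow> real" where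
  "hyp0 z = (1 + (norm z)\<^sup>2) / (1 - (norm z)\<^sup>2)"

definition hypv :: "complex \<Rightarrow> complex" where
  "hypv z = (2 / (1 - (norm z)\<^sup>2)) *\<^sub>R z"

text \<open>The side of the plane section with Lorentz normal \<open>(p, b)\<close>. Under the normalization
  \<open>p\<^sup>2 - \<bar>b\<bar>\<^sup>2 = k\<^sup>2 - 1\<close> the parameter \<open>k\<close> is the geodesic curvature of the boundary:
  the normal is timelike for circles, lightlike for horocycles, and spacelike for hypercycles.\<close>

definition cap :: "real \<Rightarrow> real \<Rightarrow> complex \<Rightarrow> complex set" where
  "cap k p b = {z \<in> hplane. p * hyp0 z - b \<bullet> hypv z < k}"

definition cap_rim :: "real \<Rightarrow> real \<Rightarrow> complex \<Rightarrow> complex set" where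
  "cap_rim k p b = {z \<in> hplane. p * hyp0 z - b \<bullet> hypv z = k}"

lemma hplane_iff: "z \<in> hplane \<longleftrightarrow> (norm z)\<^sup>2 < 1"
  by (auto simp: hplane_def power_less_one_iff abs_square_less_1)

lemma hyp_pairing_eq:
  "p * hyp0 z - b \<bullet> hypv z = (p * (1 + (norm z)\<^sup>2) - 2 * (b \<bullet> z)) / (1 - (norm z)\<^sup>2)"
  by (simp add: hyp0_def hypv_def diff_divide_distrib)

text \<open>In the disk a cap is cut out by a Euclidean circle (or line). Its quadratic form has leading
  coefficient \<open>p + k\<close> and, under the normalization above, \<open>\<bar>b\<bar>\<^sup>2 - (p + k) (p - k) = 1\<close>.\<close>

lemma hyp_pairing_less_iff:
  assumes "z \<in> hplane"
  shows "p * hyp0 z - b \<bullet> hypv z < k \<longleftrightarrow>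
    (p + k) * (norm z)\<^sup>2 - 2 * (b \<bullet> z) + (p - k) < 0"
    "p * hyp0 z - b \<bullet> hypv z = k \<longleftrightarrow>
    (p + k) * (norm z)\<^sup>2 - 2 * (b \<bullet> z) + (p - k) = 0"
  using assms unfolding hyp_pairing_eq hplane_iff
  by (auto simp: pos_divide_less_eq divide_eq_eq algebra_simps)

lemma hyp_norm: "z \<in> hplane \<Longrightarrow> (hyp0 z)\<^sup>2 = 1 + (norm (hypv z))\<^sup>2"
  unfolding hplane_iff hyp0_def hypv_def
  by (simp add: power_mult_distrib power_divide add_divide_eq_iff divide_eq_eq) (simp add: power2_eq_square algebra_simps)

lemma hyp0_pos: "z \<in> hplane \<Longrightarrow> 0 < hyp0 z"
  unfolding hplane_iff hyp0_def by (auto intro!: divide_pos_pos simp: add_pos_nonneg)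

lemma norm_hypv_less: "z \<in> hplane \<Longrightarrow> norm (hypv z) < hyp0 z"
  using hyp_norm[of z] hyp0_pos[of z] by (intro power2_less_imp_less[of "norm (hypv z)" "hyp0 z"]) auto

lemma cosh_hdist:
  assumes z: "z \<in> hplane" and w: "w \<in> hplane"
  shows "cosh (hdist z w) = hyp0 z * hyp0 w - hypv z \<bullet> hypv w"
proof -
  have [simp]: "1 - (norm z)\<^sup>2 \<noteq> 0" "1 - (norm w)\<^sup>2 \<noteq> 0" "(norm z)\<^sup>2 \<noteq> 1" "(norm w)\<^sup>2 \<noteq> 1"
    using z w by (auto simp: hplane_iff)
  have "cosh (hdist z w) = 1 + 2 * (norm (z - w))\<^sup>2 / ((1 - (norm z)\<^sup>2) * (1 - (norm w)\<^sup>2))"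
    using z w unfolding hdist_def hplane_iff by (intro cosh_arcosh_real) simp
  also have "\<dots> = ((1 - (norm z)\<^sup>2) * (1 - (norm w)\<^sup>2) + 2 * (norm (z - w))\<^sup>2) /
      ((1 - (norm z)\<^sup>2) * (1 - (norm w)\<^sup>2))"
    by (simp add: add_divide_distrib)
  also have "(1 - (norm z)\<^sup>2) * (1 - (norm w)\<^sup>2) + 2 * (norm (z - w))\<^sup>2
     = (1 + (norm z)\<^sup>2) * (1 + (norm w)\<^sup>2) - 4 * (z \<bullet> w)"
    unfolding cmod_power2 inner_complex_def by (simp add: algebra_simps power2_eq_square)
  also have "\<dots> / ((1 - (norm z)\<^sup>2) * (1 - (norm w)\<^sup>2)) = hyp0 z * hyp0 w - hypv z \<bullet> hypv w"
    by (simp add: hyp0_def hypv_def diff_divide_distrib)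
  finally show ?thesis .
qed

lemma hdist_nonneg: "z \<in> hplane \<Longrightarrow> w \<in> hplane \<Longrightarrow> 0 \<le> hdist z w"
  unfolding hdist_def hplane_iff by (intro arcosh_nonneg_real) simp

lemma hdist_less_iff:
  "z \<in> hplane \<Longrightarrow> w \<in> hplane \<Longrightarrow> 0 \<le> r \<Longrightarrow> hdist z w < r \<longleftrightarrow> cosh (hdist z w) < cosh r"
  by (simp add: cosh_real_nonneg_less_iff hdist_nonneg)

lemma hdist_eq_iff:
  "z \<in> hplane \<Longrightarrow> w \<in> hplane \<Longrightarrow> 0 \<le> r \<Longrightarrow> hdist z w = r \<longleftrightarrow> cosh (hdist z w) = cosh r"
  by (metis arcosh_cosh_real hdist_nonneg)

lemma artanh_pos_real: "0 < (x::real) \<Longrightarrow> x < 1 \<Longrightarrow> 0 < artanh x"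
  by (simp add: artanh_def)

lemma cosh_artanh:
  fixes x :: real assumes "0 < x" "x < 1" shows "cosh (artanh x) = 1 / sqrt (1 - x\<^sup>2)"
proof -
  define y where "y = artanh x"
  have "exp (2*y) = (1+x)/(1-x)" using assms by (simp add: y_def artanh_def)
  then have e: "(exp y)^2 = (1+x)/(1-x)" by (simp add: exp_double)
  have "(cosh y)^2 = ((exp y)^2 + 2 + 1/(exp y)^2)/4"
    by (simp add: cosh_def exp_minus field_simps power2_eq_square)
  also have "\<dots> = ((1+x)/(1-x) + 2 + (1-x)/(1+x))/4" using e by simp
  also have "(1+x)/(1-x) + 2 + (1-x)/(1+x) = 4 * (1/(1-x^2))"
  proof -
    have "1 - x^2 = (1-x)*(1+x)" by (simp add: power2_eq_square algebra_simps)
    then show ?thesis using assms by (simp add: divide_simps) (simp add: algebra_simps)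
  qed
  finally have "(cosh y)^2 = 1/(1-x^2)" by (simp only: nonzero_mult_div_cancel_left)
  then have "sqrt ((cosh y)^2) = sqrt (1/(1-x^2))" by simp
  then show ?thesis by (simp add: real_sqrt_divide y_def)
qed

lemma cap_scale: "0 < t \<Longrightarrow> cap (t * k) (t * p) (t *\<^sub>R b) = cap k p b"
  unfolding cap_def by (simp add: mult.assoc flip: right_diff_distrib)

lemma hball_eq_cap:
  assumes "c \<in> hplane" "0 \<le> r"
  shows "hball c r = cap (cosh r) (hyp0 c) (hypv c)"
  using assms by (auto simp: hball_def cap_def hdist_less_iff cosh_hdist)

lemma hcircle_eq_cap_rim:
  assumes "c \<in> hplane" "0 \<le> r"
  shows "hcircle c r = cap_rim (cosh r) (hyp0 c) (hypv c)"
  using assms by (auto simp: hcircle_def cap_rim_def hdist_eq_iff cosh_hdist)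

lemma horodisk_eq_cap:
  assumes \<omega>: "norm \<omega> = 1" and \<rho>: "0 < \<rho>" "\<rho> < 1"
  shows "ball (of_real (1 - \<rho>) * \<omega>) \<rho> = cap 1 ((1 - \<rho>) / \<rho>) (((1 - \<rho>) / \<rho>) *\<^sub>R \<omega>)"
proof -
  have "z \<in> ball (of_real (1 - \<rho>) * \<omega>) \<rho> \<longleftrightarrow> z \<in> cap 1 ((1 - \<rho>) / \<rho>) (((1 - \<rho>) / \<rho>) *\<^sub>R \<omega>)" for z
  proof -
    have w: "(Re \<omega>)\<^sup>2 + (Im \<omega>)\<^sup>2 = 1" using \<omega> cmod_power2[of \<omega>] by simp
    have "z \<in> ball (of_real (1 - \<rho>) * \<omega>) \<rho> \<longleftrightarrow> (norm (of_real (1 - \<rho>) * \<omega> - z))\<^sup>2 < \<rho>\<^sup>2"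
      unfolding mem_ball dist_norm using \<rho> abs_le_square_iff[of \<rho> "norm (of_real (1 - \<rho>) * \<omega> - z)"]
      by (metis abs_norm_cancel abs_of_pos not_le)
    also have "(norm (of_real (1 - \<rho>) * \<omega> - z))\<^sup>2
        = (1-\<rho>)^2 * ((Re \<omega>)\<^sup>2 + (Im \<omega>)\<^sup>2) + (norm z)\<^sup>2 - 2 * (1-\<rho>) * (\<omega> \<bullet> z)"
      unfolding cmod_power2 inner_complex_def by (simp add: power2_eq_square algebra_simps)
    also have "\<dots> < \<rho>\<^sup>2 \<longleftrightarrow> ((1 - \<rho>)/\<rho> + 1) * (norm z)\<^sup>2 - 2 * ((((1 - \<rho>) / \<rho>) *\<^sub>R \<omega>) \<bullet> z) + ((1 - \<rho>)/\<rho> - 1) < 0"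
    proof -
      have "((1 - \<rho>)/\<rho> + 1) * (norm z)\<^sup>2 - 2 * ((((1 - \<rho>) / \<rho>) *\<^sub>R \<omega>) \<bullet> z) + ((1 - \<rho>)/\<rho> - 1)
         = ((norm z)\<^sup>2 - 2 * (1-\<rho>) * (\<omega> \<bullet> z) + (1 - 2*\<rho>)) / \<rho>"
        using \<rho> by (simp add: field_simps)
      then show ?thesis using \<rho> w by (simp add: divide_less_0_iff power2_eq_square algebra_simps)
    qed
    finally have 1: "z \<in> ball (of_real (1 - \<rho>) * \<omega>) \<rho> \<longleftrightarrow> ((1 - \<rho>)/\<rho> + 1) * (norm z)\<^sup>2 - 2 * ((((1 - \<rho>) / \<rho>) *\<^sub>R \<omega>) \<bullet> z) + ((1 - \<rho>)/\<rho> - 1) < 0" .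
    have 2: "z \<in> ball (of_real (1 - \<rho>) * \<omega>) \<rho> \<Longrightarrow> z \<in> hplane"
    proof -
      assume "z \<in> ball (of_real (1 - \<rho>) * \<omega>) \<rho>"
      then have "norm (z - of_real (1 - \<rho>) * \<omega>) < \<rho>" by (simp add: dist_norm norm_minus_commute)
      moreover have "norm (of_real (1 - \<rho>) * \<omega>) = 1 - \<rho>" using \<omega> \<rho> by (simp only: norm_mult norm_of_real) simp
      moreover have "norm z \<le> norm (z - of_real (1 - \<rho>) * \<omega>) + norm (of_real (1 - \<rho>) * \<omega>)"
        using norm_triangle_sub[of z "of_real (1 - \<rho>) * \<omega>"] by simp
      ultimately have "norm z < 1" by linarith
      then show ?thesis by (simp add: hplane_def)
    qed
    show ?thesis using 1 2 hyp_pairing_less_iff(1)[of z "(1-\<rho>)/\<rho>" "((1 - \<rho>) / \<rho>) *\<^sub>R \<omega>" 1]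
      unfolding cap_def by blast
  qed
  then show ?thesis by blast
qed

text \<open>Turns the Lorentz coordinates of the foot of a perpendicular into a point of the disk.\<close>

lemma hyperboloid_point:
  fixes y :: complex
  assumes y0: "0 < y0" and y: "y0\<^sup>2 = 1 + (norm y)\<^sup>2"
  obtains w where "w \<in> hplane" "hyp0 w = y0" "hypv w = y"
proof -
  define w where "w = (1 / (1 + y0)) *\<^sub>R y"
  have n: "(norm w)\<^sup>2 = (y0 - 1) / (y0 + 1)"
  proof -
    have "(norm w)\<^sup>2 = (norm y)\<^sup>2 / (1+y0)\<^sup>2" by (simp add: w_def power_divide)
    also have "(norm y)\<^sup>2 = (y0 - 1) * (1 + y0)" using y by (simp add: power2_eq_square algebra_simps)
    finally show ?thesis using y0 by (simp add: power2_eq_square add.commute)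
  qed
  have d: "1 - (norm w)\<^sup>2 = 2 / (y0+1)" "1 + (norm w)\<^sup>2 = 2 * y0 / (y0+1)"
    unfolding n using y0 by (simp_all add: field_simps)
  show thesis
  proof
    have "0 < 1 - (norm w)\<^sup>2" unfolding d using y0 by simp
    then show "w \<in> hplane" by (simp add: hplane_iff)
    show "hyp0 w = y0" unfolding hyp0_def d using y0 by simp
    have "2 / (1 - (norm w)\<^sup>2) = 1 + y0" unfolding d using y0 by simp
    then show "hypv w = y" unfolding hypv_def using y0 by (simp add: w_def)
  qed
qed

lemma half_plane_iff:
  assumes "z \<in> hplane"
  shows "z \<in> half_plane a b \<longleftrightarrow> b \<bullet> hypv z < a * hyp0 z"
    "z \<in> geodesic a b \<longleftrightarrow> b \<bullet> hypv z = a * hyp0 z"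
proof -
  define e where "e = 1 - (norm z)\<^sup>2"
  have e: "0 < e" using assms by (simp add: e_def hplane_iff)
  have "b \<bullet> hypv z = 2 * (b \<bullet> z) / e" "a * hyp0 z = a * (1 + (norm z)\<^sup>2) / e"
    by (simp_all add: hypv_def hyp0_def e_def)
  then show "z \<in> half_plane a b \<longleftrightarrow> b \<bullet> hypv z < a * hyp0 z"
      "z \<in> geodesic a b \<longleftrightarrow> b \<bullet> hypv z = a * hyp0 z"
    using assms e by (simp_all add: half_plane_def geodesic_def divide_less_cancel)
qed

text \<open>The normalized Lorentz product \<open>S z\<close> with the normal of the geodesic is \<open>sinh\<close> of the signed distance
  from it. Splitting the point \<open>z\<close> into its component along the normal and the component
  \<open>(u0, u)\<close> in the plane of the geodesic gives \<open>cosh\<^sup>2 d \<ge> 1 + S\<^sup>2\<close> for points of the geodesic by the reversed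
  Cauchy-Schwarz inequality, with equality at the foot, which is the multiple of \<open>(u0, u)\<close> on the
  hyperboloid.\<close>

lemma hypercycle_side_eq_cap:
  assumes ab: "\<bar>a\<bar> < norm b" and k: "0 < k" "k < 1"
  defines "t \<equiv> sqrt (1 - k\<^sup>2) / sqrt ((norm b)\<^sup>2 - a\<^sup>2)"
  shows "half_plane a b \<union> {z \<in> hplane. \<exists>w\<in>geodesic a b. hdist z w < artanh k}
    = cap k (- (t * a)) ((- t) *\<^sub>R b)"
proof -
  define N where "N = sqrt ((norm b)\<^sup>2 - a\<^sup>2)"
  define C where "C = 1 / sqrt (1 - k\<^sup>2)"
  have "a\<^sup>2 < (norm b)\<^sup>2" using ab by (metis abs_ge_zero power2_abs power_strict_mono zero_less_numeral)
  then have N: "0 < N" "N\<^sup>2 = (norm b)\<^sup>2 - a\<^sup>2" by (auto simp: N_def)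
  have k2: "k\<^sup>2 < 1" using k by (simp add: power_less_one_iff)
  have s: "0 < sqrt (1 - k\<^sup>2)" "(sqrt (1 - k\<^sup>2))\<^sup>2 = 1 - k\<^sup>2" using k2 by auto
  have C: "0 < C" "C\<^sup>2 = 1 / (1 - k\<^sup>2)" "cosh (artanh k) = C"
    using s k by (auto simp: C_def power_divide cosh_artanh)
  have kC: "(k * C)\<^sup>2 = C\<^sup>2 - 1" unfolding power_mult_distrib C(2) using k2 by (simp add: field_simps)
  have art: "0 < artanh k" using k by (rule artanh_pos_real)
  define S where "S = (\<lambda>z. (b \<bullet> hypv z - a * hyp0 z) / N)"
  have NS: "b \<bullet> hypv z = a * hyp0 z + N * S z" for z using N by (simp add: S_def)
  have cap: "z \<in> cap k (- (t * a)) ((- t) *\<^sub>R b) \<longleftrightarrow> S z < k * C" if "z \<in> hplane" for z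
  proof -
    have "- (t * a) * hyp0 z - ((- t) *\<^sub>R b) \<bullet> hypv z = S z / C"
      using N s unfolding S_def t_def C_def N_def[symmetric] by (simp add: field_simps)
    then show ?thesis using that C by (simp add: cap_def pos_divide_less_eq)
  qed
  have near: "(\<exists>w\<in>geodesic a b. hdist z w < artanh k) \<longleftrightarrow> 1 + (S z)\<^sup>2 < C\<^sup>2" if z: "z \<in> hplane" for z
  proof -
    define u0 u where "u0 = hyp0 z - S z / N * a" and "u = hypv z - (S z / N) *\<^sub>R b"
    have Xz: "(hyp0 z)\<^sup>2 = 1 + (norm (hypv z))\<^sup>2" using z by (rule hyp_norm)
    have bu: "b \<bullet> u = a * u0"
    proof -
      have "b \<bullet> u - a * u0 = N * S z - S z / N * N\<^sup>2"
        unfolding u_def u0_def N(2) by (simp add: inner_diff_right NS algebra_simps power2_norm_eq_inner power2_eq_square[of a])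
      then show ?thesis using N by (simp add: power2_eq_square)
    qed
    have z_u: "hyp0 z = u0 + S z / N * a" "hypv z = u + (S z / N) *\<^sub>R b" by (simp_all add: u0_def u_def)
    have Xu: "hyp0 z * u0 - hypv z \<bullet> u = u0\<^sup>2 - (norm u)\<^sup>2"
      unfolding z_u by (simp add: inner_add_left bu algebra_simps power2_eq_square power2_norm_eq_inner[unfolded power2_eq_square])
    have "(hyp0 z)\<^sup>2 - (norm (hypv z))\<^sup>2 = u0\<^sup>2 - (norm u)\<^sup>2 - (S z / N)\<^sup>2 * N\<^sup>2"
      unfolding z_u N(2) power2_norm_eq_inner
      by (simp add: inner_add_left inner_add_right bu inner_commute[of u b] algebra_simps power2_eq_square diff_divide_distrib)
    moreover have "(S z / N)\<^sup>2 * N\<^sup>2 = (S z)\<^sup>2" using N(1) by (simp add: power_divide)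
    ultimately have uu: "u0\<^sup>2 - (norm u)\<^sup>2 = 1 + (S z)\<^sup>2" using Xz by linarith
    have "(norm u)\<^sup>2 < \<bar>u0\<bar>\<^sup>2" using uu zero_le_power2[of "S z"] unfolding power2_abs by linarith
    then have nu: "norm u < \<bar>u0\<bar>" by (rule power2_less_imp_less) simp
    \<comment> \<open>the projection stays on the upper sheet, because its product with \<open>z\<close> is positive\<close>
    have u0: "0 < u0"
    proof (rule ccontr)
      assume "\<not> 0 < u0"
      have "- (hypv z \<bullet> u) \<le> norm (hypv z) * norm u" by (metis norm_cauchy_schwarz norm_minus_cancel inner_minus_left)
      also have "\<dots> \<le> hyp0 z * \<bar>u0\<bar>" using nu norm_hypv_less[OF z] hyp0_pos[OF z] by (intro mult_mono) auto
      also have "\<dots> = - (hyp0 z * u0)" using \<open>\<not> 0 < u0\<close> by simp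
      finally have "hyp0 z * u0 - hypv z \<bullet> u \<le> 0" by simp
      then show False using Xu uu by (smt (verit) zero_le_power2)
    qed
    have pos: "0 < 1 + (S z)\<^sup>2" by (simp add: add_pos_nonneg)
    show ?thesis
    proof
      assume "\<exists>w\<in>geodesic a b. hdist z w < artanh k"
      then obtain w where w: "w \<in> geodesic a b" and d: "hdist z w < artanh k" by blast
      have wh: "w \<in> hplane" using w by (simp add: geodesic_def)
      have bw: "b \<bullet> hypv w = a * hyp0 w" using w half_plane_iff(2)[OF wh] by simp
      have lt: "cosh (hdist z w) < C" using hdist_less_iff[OF z wh] d art C by simp
      have "cosh (hdist z w) = u0 * hyp0 w - u \<bullet> hypv w"
        unfolding cosh_hdist[OF z wh] z_u by (simp add: inner_add_left bw algebra_simps)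
      moreover have "u \<bullet> hypv w \<le> norm u * norm (hypv w)" by (rule norm_cauchy_schwarz)
      ultimately have lt2: "u0 * hyp0 w - norm u * norm (hypv w) < C" using lt by simp
      have "norm u * norm (hypv w) \<le> u0 * hyp0 w" using nu u0 norm_hypv_less[OF wh] hyp0_pos[OF wh] by (intro mult_mono) auto
      then have "(u0 * hyp0 w - norm u * norm (hypv w))\<^sup>2 < C\<^sup>2" using lt2 by (intro power_strict_mono) auto
      moreover have "(u0 * hyp0 w - norm u * norm (hypv w))\<^sup>2 =
          (u0\<^sup>2 - (norm u)\<^sup>2) * ((hyp0 w)\<^sup>2 - (norm (hypv w))\<^sup>2) + (u0 * norm (hypv w) - norm u * hyp0 w)\<^sup>2"
        by (simp add: power2_eq_square algebra_simps)
      ultimately show "1 + (S z)\<^sup>2 < C\<^sup>2"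
      proof -
        have "(u0\<^sup>2 - (norm u)\<^sup>2) * ((hyp0 w)\<^sup>2 - (norm (hypv w))\<^sup>2) = 1 + (S z)\<^sup>2"
          using uu hyp_norm[OF wh] by simp
        with \<open>(u0 * hyp0 w - norm u * norm (hypv w))\<^sup>2 < C\<^sup>2\<close> \<open>(u0 * hyp0 w - norm u * norm (hypv w))\<^sup>2 = _\<close> show ?thesis
          using zero_le_power2[of "u0 * norm (hypv w) - norm u * hyp0 w"] by linarith
      qed
    next
      assume lt: "1 + (S z)\<^sup>2 < C\<^sup>2"
      define q where "q = sqrt (1 + (S z)\<^sup>2)"
      have q: "0 < q" "q\<^sup>2 = 1 + (S z)\<^sup>2" using pos by (auto simp: q_def)
      have "(u0 / q)\<^sup>2 = 1 + (norm ((1/q) *\<^sub>R u))\<^sup>2"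
      proof -
        have "u0\<^sup>2 = q\<^sup>2 + (norm u)\<^sup>2" using uu q by linarith
        then show ?thesis using q(1) by (simp add: power_divide add_divide_distrib)
      qed
      with divide_pos_pos[OF u0 q(1)] obtain w where w: "w \<in> hplane" "hyp0 w = u0 / q" "hypv w = (1/q) *\<^sub>R u"
        by (rule hyperboloid_point)
      have "w \<in> geodesic a b" using half_plane_iff(2)[OF w(1)] bu q by (simp add: w)
      moreover have "cosh (hdist z w) = q"
      proof -
        have "cosh (hdist z w) = (hyp0 z * u0 - hypv z \<bullet> u) / q"
          unfolding cosh_hdist[OF z w(1)] w by (simp add: diff_divide_distrib)
        also have "\<dots> = q" unfolding Xu uu q(2)[symmetric] using q(1) by (simp add: power2_eq_square)
        finally show ?thesis .
      qed
      moreover have "q < C" using lt q C by (intro power2_less_imp_less[of q C]) auto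
      ultimately show "\<exists>w\<in>geodesic a b. hdist z w < artanh k"
        using hdist_less_iff[OF z w(1), of "artanh k"] art C(3) by (metis less_imp_le)
    qed
  qed
  have hp: "z \<in> half_plane a b \<longleftrightarrow> S z < 0" if "z \<in> hplane" for z
    using half_plane_iff(1)[OF that] N by (simp add: S_def divide_less_0_iff)
  have kCpos: "0 < k * C" using k C by simp
  have sq: "1 + (S z)\<^sup>2 < C\<^sup>2 \<longleftrightarrow> \<bar>S z\<bar> < k * C" for z
  proof -
    have "1 + (S z)\<^sup>2 < C\<^sup>2 \<longleftrightarrow> (S z)\<^sup>2 < (k*C)\<^sup>2" using kC by auto
    also have "\<dots> \<longleftrightarrow> \<bar>S z\<bar> < \<bar>k*C\<bar>" by (simp add: abs_le_square_iff flip: not_le)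
    finally show ?thesis using kCpos by simp
  qed
  have "z \<in> half_plane a b \<union> {z \<in> hplane. \<exists>w\<in>geodesic a b. hdist z w < artanh k}
    \<longleftrightarrow> z \<in> cap k (- (t * a)) ((- t) *\<^sub>R b)" for z
  proof (cases "z \<in> hplane")
    case True
    then show ?thesis using cap[OF True] near[OF True] hp[OF True] sq[of z] kCpos by auto
  next
    case False
    then show ?thesis by (auto simp: half_plane_def cap_def)
  qed
  then show ?thesis by blast
qed

lemma gen_disk_imp_cap:
  assumes "gen_disk k D"
  obtains p b where "D = cap k p b" "p\<^sup>2 + 1 = (norm b)\<^sup>2 + k\<^sup>2"
proof -
  consider (c) c where "k > 1" "c \<in> hplane" "D = hball c (artanh (1 / k))"
    | (h) \<omega> \<rho> where "k = 1" "norm \<omega> = 1" "0 < \<rho>" "\<rho> < 1" "D = ball (of_real (1 - \<rho>) * \<omega>) \<rho>"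
    | (y) a b where "0 < k" "k < 1" "\<bar>a\<bar> < norm b"
        "D = half_plane a b \<union> {z \<in> hplane. \<exists>w\<in>geodesic a b. hdist z w < artanh k}"
    using assms unfolding gen_disk_def by blast
  then show thesis
  proof cases
    case c
    define t where "t = sqrt (k\<^sup>2 - 1)"
    have t: "0 < t" "t\<^sup>2 = k\<^sup>2 - 1" using c by (auto simp: t_def power2_eq_square less_1_mult less_imp_le)
    have "cosh (artanh (1/k)) = k / t"
    proof -
      have "1 - (1/k)\<^sup>2 = (t / k)\<^sup>2" using c t by (simp add: power_divide field_simps)
      then have "sqrt (1 - (1/k)\<^sup>2) = t / k" using c t(1) by simp
      then show ?thesis using c t(1) cosh_artanh[of "1/k"] by simp
    qed
    then have "D = cap (k / t) (hyp0 c) (hypv c)"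
      using c hball_eq_cap[of c "artanh (1/k)"] artanh_pos_real[of "1/k"] by simp
    also have "\<dots> = cap k (t * hyp0 c) (t *\<^sub>R hypv c)" using cap_scale[OF t(1), of "k/t"] t by simp
    finally have "D = cap k (t * hyp0 c) (t *\<^sub>R hypv c)" .
    moreover have "(t * hyp0 c)\<^sup>2 + 1 = (norm (t *\<^sub>R hypv c))\<^sup>2 + k\<^sup>2"
      using hyp_norm[OF c(2)] t by (simp add: power_mult_distrib algebra_simps)
    ultimately show thesis by (rule that)
  next
    case h
    have "D = cap k ((1 - \<rho>) / \<rho>) (((1 - \<rho>) / \<rho>) *\<^sub>R \<omega>)"
      using horodisk_eq_cap[OF h(2-4)] h(1,5) by simp
    moreover have "((1 - \<rho>) / \<rho>)\<^sup>2 + 1 = (norm (((1 - \<rho>) / \<rho>) *\<^sub>R \<omega>))\<^sup>2 + k\<^sup>2"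
      unfolding norm_scaleR h(1,2) by (simp add: power_divide)
    ultimately show thesis by (rule that)
  next
    case y
    have "a\<^sup>2 < (norm b)\<^sup>2" using y(3) by (metis abs_ge_zero power2_abs power_strict_mono zero_less_numeral)
    define t where "t = sqrt (1 - k\<^sup>2) / sqrt ((norm b)\<^sup>2 - a\<^sup>2)"
    have "k\<^sup>2 < 1" using y(1,2) by (simp add: power_less_one_iff)
    then have "t\<^sup>2 * ((norm b)\<^sup>2 - a\<^sup>2) = 1 - k\<^sup>2"
      using \<open>a\<^sup>2 < (norm b)\<^sup>2\<close> by (simp add: t_def power_divide)
    moreover have "(norm ((- t) *\<^sub>R b))\<^sup>2 = t\<^sup>2 * (norm b)\<^sup>2" "(- (t * a))\<^sup>2 = t\<^sup>2 * a\<^sup>2"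
      by (simp_all add: power_mult_distrib)
    ultimately have "(- (t * a))\<^sup>2 + 1 = (norm ((- t) *\<^sub>R b))\<^sup>2 + k\<^sup>2"
      by (simp only: right_diff_distrib)
    then show thesis
      using that[of "- (t * a)" "(- t) *\<^sub>R b"] y(4) hypercycle_side_eq_cap[OF y(3,1,2)] unfolding t_def by blast
  qed
qed

section \<open>Boundaries, tangent directions and Moebius transformations\<close>

lemma open_hplane: "open hplane" by (simp add: hplane_def)

lemma form_shift:
  fixes z v b :: complex and A C :: real
  shows "A * (norm (z + v))\<^sup>2 - 2 * (b \<bullet> (z + v)) + C
     = (A * (norm z)\<^sup>2 - 2 * (b \<bullet> z) + C) + A * (norm v)\<^sup>2 + 2 * ((A *\<^sub>R z - b) \<bullet> v)"
  by (simp add: power2_norm_eq_inner inner_add_left inner_add_right inner_diff_left inner_commute[of v z] algebra_simps)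

lemma cap_iff: "z \<in> cap k p b \<longleftrightarrow> z \<in> hplane \<and> (p + k) * (norm z)\<^sup>2 - 2 * (b \<bullet> z) + (p - k) < 0"
  unfolding cap_def using hyp_pairing_less_iff(1) by blast

lemma cap_rim_iff: "z \<in> cap_rim k p b \<longleftrightarrow> z \<in> hplane \<and> (p + k) * (norm z)\<^sup>2 - 2 * (b \<bullet> z) + (p - k) = 0"
  unfolding cap_rim_def using hyp_pairing_less_iff(2) by blast

text \<open>On the boundary curve the vector \<open>(p + k) z - b\<close> is half the gradient of the defining form. The
  Euclidean product of two such normals at a common point is the Lorentz product of the data, which is
  why angles between generalized circles do not depend on the intersection point.\<close>

lemma cap_rim_normals:
  assumes "z \<in> cap_rim k p b" "z \<in> cap_rim k' p' b'"
  shows "((p + k) *\<^sub>R z - b) \<bullet> ((p' + k') *\<^sub>R z - b') = b \<bullet> b' - p * p' + k * k'"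
proof -
  have 1: "2 * (b \<bullet> z) = (p + k) * (norm z)\<^sup>2 + (p - k)"
    and 2: "2 * (b' \<bullet> z) = (p' + k') * (norm z)\<^sup>2 + (p' - k')"
    using assms unfolding cap_rim_iff by auto
  have "((p + k) *\<^sub>R z - b) \<bullet> ((p' + k') *\<^sub>R z - b') =
      (p + k) * (p' + k') * (norm z)\<^sup>2 - (p + k) * (b' \<bullet> z) - (p' + k') * (b \<bullet> z) + b \<bullet> b'"
    by (simp add: power2_norm_eq_inner inner_diff_left inner_diff_right inner_commute[of z b'] algebra_simps)
  also have "(p + k) * (b' \<bullet> z) = (p + k) * ((p' + k') * (norm z)\<^sup>2 + (p' - k')) / 2"
    using 2 by simp
  also have "(p' + k') * (b \<bullet> z) = (p' + k') * ((p + k) * (norm z)\<^sup>2 + (p - k)) / 2"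
    using 1 by simp
  finally show ?thesis by (simp add: field_simps)
qed

lemma cap_rim_normal_unit:
  assumes "z \<in> cap_rim k p b" "p\<^sup>2 + 1 = (norm b)\<^sup>2 + k\<^sup>2"
  shows "norm ((p + k) *\<^sub>R z - b) = 1"
proof -
  have "((p + k) *\<^sub>R z - b) \<bullet> ((p + k) *\<^sub>R z - b) = 1"
    using cap_rim_normals[OF assms(1,1)] assms(2)
    unfolding power2_norm_eq_inner power2_eq_square[of p] power2_eq_square[of k] by linarith
  then show ?thesis by (simp add: norm_eq_1)
qed

text \<open>Moving from a boundary point against the normal leads into the disk. This shows that boundary points are
  in the closure, and later that two disks with the same normal at a common point overlap.\<close>

lemma eventually_cap:
  assumes z: "z \<in> cap_rim k p b" and n: "p\<^sup>2 + 1 = (norm b)\<^sup>2 + k\<^sup>2"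
  shows "\<forall>\<^sub>F t in at_right 0. z - t *\<^sub>R ((p + k) *\<^sub>R z - b) \<in> cap k p b"
proof -
  define N where "N = (p + k) *\<^sub>R z - b"
  have N: "N \<bullet> N = 1" using cap_rim_normal_unit[OF z n] by (simp add: N_def norm_eq_1)
  have z0: "z \<in> hplane" "(p + k) * (norm z)\<^sup>2 - 2 * (b \<bullet> z) + (p - k) = 0" using z cap_rim_iff by auto
  have "((\<lambda>t. z - t *\<^sub>R N) \<longlongrightarrow> z - 0 *\<^sub>R N) (at_right 0)" by (intro tendsto_intros)
  then have 1: "\<forall>\<^sub>F t in at_right 0. z - t *\<^sub>R N \<in> hplane"
    using z0(1) open_hplane by (simp add: tendsto_def)
  have "((\<lambda>t. (p + k) * t) \<longlongrightarrow> (p + k) * 0) (at_right 0)" by (intro tendsto_intros)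
  then have 2: "\<forall>\<^sub>F t in at_right 0. (p + k) * t < 2" by (rule order_tendstoD) simp
  show ?thesis using 1 2 eventually_at_right_less[of 0]
  proof eventually_elim
    case (elim t)
    have "(norm (- t *\<^sub>R N))\<^sup>2 = t\<^sup>2" unfolding power2_norm_eq_inner by (simp add: N power2_eq_square)
    then have "(p + k) * (norm (z + (- t *\<^sub>R N)))\<^sup>2 - 2 * (b \<bullet> (z + (- t *\<^sub>R N))) + (p - k)
      = (p + k) * t\<^sup>2 - 2 * t"
      unfolding form_shift z0(2) N_def[symmetric]
      by (simp add: N)
    also have "\<dots> = t * ((p + k) * t - 2)" by (simp add: power2_eq_square algebra_simps)
    also have "\<dots> < 0" using elim by (simp add: mult_pos_neg)
    finally show ?case using elim unfolding cap_iff N_def by simp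
  qed
qed

lemma hbdry_cap:
  assumes n: "p\<^sup>2 + 1 = (norm b)\<^sup>2 + k\<^sup>2"
  shows "hbdry (cap k p b) = cap_rim k p b"
proof -
  define h where "h = (\<lambda>z. (p + k) * (norm z)\<^sup>2 - 2 * (b \<bullet> z) + (p - k))"
  have cont: "continuous_on UNIV h" unfolding h_def by (intro continuous_intros)
  have cap: "cap k p b = hplane \<inter> {z. h z < 0}" by (auto simp: cap_iff h_def)
  have op: "open (cap k p b)" unfolding cap
    by (intro open_Int open_hplane open_Collect_less cont continuous_intros)
  have "closed {z. h z \<le> 0}" by (intro closed_Collect_le cont continuous_intros)
  then have cl: "closure (cap k p b) \<subseteq> {z. h z \<le> 0}" by (intro closure_minimal) (auto simp: cap)
  have fr: "frontier (cap k p b) = closure (cap k p b) - cap k p b"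
    using op by (simp add: frontier_def interior_open)
  show ?thesis
  proof
    show "hbdry (cap k p b) \<subseteq> cap_rim k p b"
      using cl unfolding hbdry_def fr by (auto simp: cap cap_rim_iff h_def)
    show "cap_rim k p b \<subseteq> hbdry (cap k p b)"
    proof
      fix z assume z: "z \<in> cap_rim k p b"
      have "((\<lambda>t. z - t *\<^sub>R ((p + k) *\<^sub>R z - b)) \<longlongrightarrow> z - 0 *\<^sub>R ((p + k) *\<^sub>R z - b)) (at_right (0::real))"
        by (intro tendsto_intros)
      moreover have "\<forall>\<^sub>F t in at_right 0. z - t *\<^sub>R ((p + k) *\<^sub>R z - b) \<in> closure (cap k p b)"
        using eventually_cap[OF z n] by (rule eventually_mono) (rule closure_subset[THEN subsetD])
      ultimately have "z - 0 *\<^sub>R ((p + k) *\<^sub>R z - b) \<in> closure (cap k p b)"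
        by (intro Lim_in_closed_set[OF closed_closure _ trivial_limit_at_right_real])
      then have "z \<in> closure (cap k p b)" by simp
      then show "z \<in> hbdry (cap k p b)"
        using z unfolding hbdry_def fr by (auto simp: cap_iff cap_rim_iff)
    qed
  qed
qed

text \<open>The curve \<open>z + t \<i> N / (1 - \<i> (p + k) t / 2)\<close> is a rational parametrization that works for
  circles and lines alike; below it is written with separated real coefficients.\<close>

lemma cap_rim_tangent_vector:
  assumes z: "z \<in> cap_rim k p b" and n: "p\<^sup>2 + 1 = (norm b)\<^sup>2 + k\<^sup>2"
  shows "\<i> * ((p + k) *\<^sub>R z - b) \<in> tangent_vectors (cap_rim k p b) z"
proof -
  define N where "N = (p + k) *\<^sub>R z - b"
  have N: "N \<bullet> N = 1" using cap_rim_normal_unit[OF z n] by (simp add: N_def norm_eq_1)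
  have iN: "N \<bullet> (\<i> * N) = 0" "(\<i> * N) \<bullet> N = 0" "(\<i> * N) \<bullet> (\<i> * N) = 1"
    using N by (simp_all add: inner_complex_def)
  define s where "s = (\<lambda>t::real. t / (1 + ((p + k) * t / 2)\<^sup>2))"
  define \<gamma> where "\<gamma> = (\<lambda>t. z + (s t *\<^sub>R (\<i> * N) - (s t * ((p + k) * t / 2)) *\<^sub>R N))"
  have pos: "0 < 1 + ((p + k) * t / 2)\<^sup>2" for t :: real by (simp add: add_pos_nonneg)
  have sd: "(s has_vector_derivative 1) (at 0)"
    unfolding s_def by (auto intro!: derivative_eq_intros simp flip: has_real_derivative_iff_has_vector_derivative)
  have sd2: "((\<lambda>t. s t * ((p + k) * t / 2)) has_vector_derivative 0) (at 0)"
    unfolding s_def by (auto intro!: derivative_eq_intros simp flip: has_real_derivative_iff_has_vector_derivative)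
  have d: "(\<gamma> has_vector_derivative \<i> * N) (at 0)"
  proof -
    note 1 = bounded_linear.has_vector_derivative[OF bounded_linear_scaleR_left[of "\<i> * N"] sd]
    note 2 = bounded_linear.has_vector_derivative[OF bounded_linear_scaleR_left[of N] sd2]
    show ?thesis unfolding \<gamma>_def
      using has_vector_derivative_add[OF has_vector_derivative_const has_vector_derivative_diff[OF 1 2]] by simp
  qed
  have z0: "z \<in> hplane" "(p + k) * (norm z)\<^sup>2 - 2 * (b \<bullet> z) + (p - k) = 0" using z cap_rim_iff by auto
  have on: "(p + k) * (norm (\<gamma> t))\<^sup>2 - 2 * (b \<bullet> \<gamma> t) + (p - k) = 0" for t
  proof -
    define v where "v = s t *\<^sub>R (\<i> * N) - (s t * ((p + k) * t / 2)) *\<^sub>R N"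
    have "v \<bullet> v = (s t)\<^sup>2 * (1 + ((p + k) * t / 2)\<^sup>2)"
      unfolding v_def by (simp add: inner_diff_left inner_diff_right N iN power2_eq_square algebra_simps)
    also have "\<dots> = s t * t" unfolding s_def using pos[of t] by (simp add: power2_eq_square)
    finally have "(norm v)\<^sup>2 = s t * t" by (simp add: power2_norm_eq_inner)
    moreover have "N \<bullet> v = - (s t * ((p + k) * t / 2))"
      unfolding v_def by (simp add: inner_diff_right N iN)
    ultimately show ?thesis
      unfolding \<gamma>_def v_def[symmetric] form_shift z0(2) N_def[symmetric] by simp
  qed
  have "isCont \<gamma> 0" using has_vector_derivative_continuous[OF d] .
  then have "\<forall>\<^sub>F t in nhds 0. \<gamma> t \<in> hplane"
    using open_hplane z0(1) unfolding isCont_def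
    by (simp add: tendsto_def eventually_nhds_conv_at s_def \<gamma>_def)
  then have "\<forall>\<^sub>F t in nhds 0. \<gamma> t \<in> cap_rim k p b" by eventually_elim (simp add: cap_rim_iff on)
  then show ?thesis unfolding tangent_vectors_def N_def[symmetric]
    using d by (intro CollectI exI[of _ \<gamma>]) (simp add: \<gamma>_def s_def)
qed

lemma perpendicular_cap_rims:
  assumes "perpendicular (cap_rim k p b) (cap_rim k' p' b')"
    and "p\<^sup>2 + 1 = (norm b)\<^sup>2 + k\<^sup>2" "p'\<^sup>2 + 1 = (norm b')\<^sup>2 + k'\<^sup>2"
  shows "p * p' - b \<bullet> b' = k * k'"
proof -
  obtain z where z: "z \<in> cap_rim k p b" "z \<in> cap_rim k' p' b'"
    using assms(1) by (auto simp: perpendicular_def)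
  have "(\<i> * ((p + k) *\<^sub>R z - b)) \<bullet> (\<i> * ((p' + k') *\<^sub>R z - b')) = 0"
    using assms(1) z cap_rim_tangent_vector[OF z(1) assms(2)] cap_rim_tangent_vector[OF z(2) assms(3)]
    unfolding perpendicular_def by blast
  moreover have "(\<i> * x) \<bullet> (\<i> * y) = x \<bullet> y" for x y by (simp add: inner_complex_def)
  ultimately show ?thesis using cap_rim_normals[OF z] by simp
qed

text \<open>The isometries of the disk: a rotation by the unit \<open>e\<close> followed by the translation taking \<open>0\<close> to \<open>c\<close>.\<close>

definition mob :: "complex \<Rightarrow> complex \<Rightarrow> complex \<Rightarrow> complex" where
  "mob e c w = (e * w + c) / (1 + cnj c * e * w)"

lemma unit_cnj: "norm e = 1 \<Longrightarrow> cnj e * e = 1" "norm e = 1 \<Longrightarrow> e * cnj e = 1"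
  using complex_norm_square[of e] by (simp_all add: mult.commute)

lemma mob_denom:
  assumes "c \<in> hplane" "norm e = 1" "norm w \<le> 1"
  shows "1 + cnj c * e * w \<noteq> 0"
proof
  assume "1 + cnj c * e * w = 0"
  then have "cnj c * e * w = - 1" by (simp add: add_eq_0_iff)
  then have "norm (cnj c * e * w) = 1" by simp
  then have "norm c * norm w = 1" using assms by (simp add: norm_mult)
  moreover have "norm c * norm w \<le> norm c * 1" using assms by (intro mult_left_mono) auto
  ultimately show False using assms(1) by (simp add: hplane_def)
qed

lemma mob_norm:
  assumes "c \<in> hplane" "norm e = 1" "norm w \<le> 1"
  shows "1 - (norm (mob e c w))\<^sup>2 = (1 - (norm c)\<^sup>2) * (1 - (norm w)\<^sup>2) / (norm (1 + cnj c * e * w))\<^sup>2"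
proof -
  have "(norm (1 + cnj c * v))\<^sup>2 - (norm (v + c))\<^sup>2 = (1 - (norm c)\<^sup>2) * (1 - (norm v)\<^sup>2)" for v
    unfolding cmod_power2 by (simp add: power2_eq_square algebra_simps)
  from this[of "e * w"] have "(norm (1 + cnj c * e * w))\<^sup>2 - (norm (e * w + c))\<^sup>2 = (1 - (norm c)\<^sup>2) * (1 - (norm w)\<^sup>2)"
    using assms(2) by (simp add: norm_mult mult.assoc)
  moreover have "(norm (1 + cnj c * e * w))\<^sup>2 \<noteq> 0" using mob_denom[OF assms] by simp
  ultimately show ?thesis
    unfolding mob_def norm_divide power_divide by (metis diff_divide_distrib divide_self)
qed

lemma mob_in_hplane:
  assumes "c \<in> hplane" "norm e = 1" "w \<in> hplane"
  shows "mob e c w \<in> hplane"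
proof -
  have "norm w \<le> 1" using assms(3) by (simp add: hplane_def)
  have "0 < 1 - (norm (mob e c w))\<^sup>2" unfolding mob_norm[OF assms(1,2) \<open>norm w \<le> 1\<close>]
    using assms mob_denom[OF assms(1,2) \<open>norm w \<le> 1\<close>] by (simp add: hplane_iff)
  then show ?thesis by (simp add: hplane_iff)
qed

definition mob_inv :: "complex \<Rightarrow> complex \<Rightarrow> complex \<Rightarrow> complex" where
  "mob_inv e c = mob (cnj e) (- (cnj e * c))"

lemma mob_inv_params:
  "c \<in> hplane \<Longrightarrow> norm e = 1 \<Longrightarrow> - (cnj e * c) \<in> hplane" "norm e = 1 \<Longrightarrow> norm (cnj e) = 1"
  by (simp_all add: hplane_def norm_mult)

lemma mob_inverse:
  assumes "c \<in> hplane" "norm e = 1" "norm w \<le> 1"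
  shows "mob_inv e c (mob e c w) = w"
proof -
  note e = unit_cnj[OF assms(2)]
  define D where "D = 1 + cnj c * e * w"
  have D: "D \<noteq> 0" using mob_denom[OF assms] by (simp add: D_def)
  have c1: "1 - c * cnj c \<noteq> 0"
  proof -
    have "1 - c * cnj c = complex_of_real (1 - (norm c)\<^sup>2)"
      by (simp only: of_real_diff complex_norm_square of_real_1)
    then show ?thesis using assms(1) by (simp only: of_real_eq_0_iff) (simp add: hplane_iff)
  qed
  have "mob_inv e c (mob e c w) = (cnj e * ((e * w + c) / D) - cnj e * c) / (1 - e * cnj c * cnj e * ((e * w + c) / D))"
    by (simp add: mob_inv_def mob_def D_def)
  also have "cnj e * ((e * w + c) / D) - cnj e * c = (cnj e * (e * w + c) - cnj e * c * D) / D"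
    using D by (simp add: field_simps)
  also have "cnj e * (e * w + c) - cnj e * c * D = w * (1 - c * cnj c)"
  proof -
    have "cnj e * (e * w + c) - cnj e * c * D = (cnj e * e) * (w * (1 - c * cnj c))" by (simp add: D_def algebra_simps)
    then show ?thesis by (simp only: e mult_1)
  qed
  also have "1 - e * cnj c * cnj e * ((e * w + c) / D) = (D - cnj c * (e * w + c)) / D"
  proof -
    have "1 - e * cnj c * cnj e * ((e * w + c) / D) = 1 - (e * cnj e) * (cnj c * ((e * w + c) / D))" by (simp add: ac_simps)
    also have "\<dots> = 1 - cnj c * ((e * w + c) / D)" by (simp only: e mult_1)
    finally show ?thesis using D by (simp add: diff_divide_distrib)
  qed
  also have "D - cnj c * (e * w + c) = 1 - c * cnj c" by (simp add: D_def algebra_simps)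
  finally show ?thesis using D c1 by simp
qed

lemma mob_mob_inv:
  assumes "c \<in> hplane" "norm e = 1" "norm w \<le> 1"
  shows "mob e c (mob_inv e c w) = w"
proof -
  have e: "e * (cnj e * c) = c"
    using unit_cnj(2)[OF assms(2)] by (metis mult.assoc mult_1)
  have "mob e c = mob_inv (cnj e) (- (cnj e * c))" by (simp add: mob_inv_def e)
  then show ?thesis using mob_inverse[of "- (cnj e * c)" "cnj e" w] mob_inv_params assms
    by (simp add: mob_inv_def)
qed

lemma mob_inv_in_hplane:
  "c \<in> hplane \<Longrightarrow> norm e = 1 \<Longrightarrow> w \<in> hplane \<Longrightarrow> mob_inv e c w \<in> hplane"
  unfolding mob_inv_def by (intro mob_in_hplane mob_inv_params)

lemma bij_mob:
  assumes "c \<in> hplane" "norm e = 1"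
  shows "bij_betw (mob e c) hplane hplane"
proof (rule bij_betw_byWitness[where f' = "mob_inv e c"])
  have "w \<in> hplane \<Longrightarrow> norm w \<le> 1" for w by (simp add: hplane_def)
  then show "\<forall>w\<in>hplane. mob_inv e c (mob e c w) = w" "\<forall>w\<in>hplane. mob e c (mob_inv e c w) = w"
    using mob_inverse[OF assms] mob_mob_inv[OF assms] by blast+
  show "mob e c ` hplane \<subseteq> hplane" "mob_inv e c ` hplane \<subseteq> hplane"
    using mob_in_hplane[OF assms] mob_inv_in_hplane[OF assms] by blast+
qed

lemma mob_pairing_identity:
  fixes b c v :: complex and p :: real
  shows "p * ((norm (1 + cnj c * v))\<^sup>2 + (norm (v + c))\<^sup>2) - 2 * (b \<bullet> ((v + c) * cnj (1 + cnj c * v))) =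
     (p * (1 + (norm c)\<^sup>2) - 2 * (b \<bullet> c)) * (1 + (norm v)\<^sup>2)
       - 2 * ((b + cnj b * c\<^sup>2 - of_real (2 * p) * c) \<bullet> v)"
proof -
  have "(norm (1 + cnj c * v))\<^sup>2 + (norm (v + c))\<^sup>2 = (1 + (norm c)\<^sup>2) * (1 + (norm v)\<^sup>2) + 4 * (c \<bullet> v)"
    unfolding cmod_power2 inner_complex_def by (simp add: power2_eq_square algebra_simps)
  moreover have "b \<bullet> ((v + c) * cnj (1 + cnj c * v)) = (b \<bullet> c) * (1 + (norm v)\<^sup>2) + (b + cnj b * c\<^sup>2) \<bullet> v"
    unfolding cmod_power2 inner_complex_def by (simp add: power2_eq_square algebra_simps)
  moreover have "(of_real (2 * p) * c) \<bullet> v = 2 * p * (c \<bullet> v)"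
    unfolding inner_complex_def by (simp add: algebra_simps)
  ultimately show ?thesis unfolding inner_diff_left by (simp add: algebra_simps)
qed

text \<open>Moebius transformations act linearly and isometrically on Lorentz space. The new first
  coordinate of a normal is its Lorentz product with the point \<open>c\<close>, the image of the origin.\<close>

lemma mob_pairing:
  assumes c: "c \<in> hplane" and e: "norm e = 1" and w: "w \<in> hplane"
  shows "p * hyp0 (mob e c w) - b \<bullet> hypv (mob e c w) =
    (p * hyp0 c - b \<bullet> hypv c) * hyp0 w
     - (cnj e * ((b + cnj b * c\<^sup>2 - of_real (2 * p) * c) / of_real (1 - (norm c)\<^sup>2))) \<bullet> hypv w"
proof -
  have w1: "norm w \<le> 1" using w by (simp add: hplane_def)
  define v where "v = e * w"
  have nv: "norm v = norm w" using e by (simp add: v_def norm_mult)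
  define D where "D = 1 + cnj c * v"
  have D: "D \<noteq> 0" using mob_denom[OF c e w1] by (simp add: D_def v_def mult.assoc)
  define Q where "Q = (1 - (norm c)\<^sup>2) * (1 - (norm w)\<^sup>2)"
  have Q: "Q \<noteq> 0" using c w by (auto simp: Q_def hplane_iff)
  have m: "mob e c w = (v + c) / D" by (simp add: mob_def v_def D_def mult.assoc)
  have n1: "1 - (norm (mob e c w))\<^sup>2 = Q / (norm D)\<^sup>2"
    using mob_norm[OF c e w1] by (simp add: Q_def D_def v_def mult.assoc)
  have n2: "p * (1 + (norm (mob e c w))\<^sup>2) = p * ((norm D)\<^sup>2 + (norm (v + c))\<^sup>2) / (norm D)\<^sup>2"

  proof -
    have *: "p * (1 + y / d) = p * (d + y) / d" if "d \<noteq> 0" for y d :: real using that by (simp add: field_simps)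
    show ?thesis unfolding m norm_divide power_divide by (rule *) (simp add: D)
  qed
  have n3: "b \<bullet> mob e c w = (b \<bullet> ((v + c) * cnj D)) / (norm D)\<^sup>2"
  proof -
    have "b \<bullet> (Z / of_real r) = (b \<bullet> Z) / r" for Z r by (simp add: inner_complex_def add_divide_distrib)
    then show ?thesis unfolding m complex_div_cnj[of "v + c" D] by (simp only: of_real_power[symmetric])
  qed
  have "p * hyp0 (mob e c w) - b \<bullet> hypv (mob e c w) =
      (p * ((norm D)\<^sup>2 + (norm (v + c))\<^sup>2) - 2 * (b \<bullet> ((v + c) * cnj D))) / Q"
  proof -
    have *: "(a / d - 2 * (x / d)) / (Q / d) = (a - 2 * x) / Q" if "d \<noteq> 0" for a x d :: real
      using that Q by (simp add: field_simps)
    show ?thesis unfolding hyp_pairing_eq n1 n2 n3 by (rule *) (simp add: D)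
  qed
  also have "p * ((norm D)\<^sup>2 + (norm (v + c))\<^sup>2) - 2 * (b \<bullet> ((v + c) * cnj D)) =
     (p * (1 + (norm c)\<^sup>2) - 2 * (b \<bullet> c)) * (1 + (norm v)\<^sup>2)
       - 2 * ((b + cnj b * c\<^sup>2 - of_real (2 * p) * c) \<bullet> v)"
    unfolding D_def by (rule mob_pairing_identity)
  also have "(b + cnj b * c\<^sup>2 - of_real (2 * p) * c) \<bullet> v = (cnj e * (b + cnj b * c\<^sup>2 - of_real (2 * p) * c)) \<bullet> w"
    unfolding v_def inner_complex_def by (simp add: algebra_simps)
  also have "((p * (1 + (norm c)\<^sup>2) - 2 * (b \<bullet> c)) * (1 + (norm v)\<^sup>2)
       - 2 * ((cnj e * (b + cnj b * c\<^sup>2 - of_real (2 * p) * c)) \<bullet> w)) / Q =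
     (p * hyp0 c - b \<bullet> hypv c) * hyp0 w
     - (cnj e * ((b + cnj b * c\<^sup>2 - of_real (2 * p) * c) / of_real (1 - (norm c)\<^sup>2))) \<bullet> hypv w"
  proof -
    have "(cnj e * ((b + cnj b * c\<^sup>2 - of_real (2 * p) * c) / of_real (1 - (norm c)\<^sup>2))) \<bullet> hypv w
      = 2 * ((cnj e * (b + cnj b * c\<^sup>2 - of_real (2 * p) * c)) \<bullet> w) / Q"
    proof -
      have "cnj e * (X / of_real r) = (1 / r) *\<^sub>R (cnj e * X)" for X r
        by (simp add: scaleR_conv_of_real)
      then show ?thesis by (simp only:) (simp add: hypv_def Q_def mult.commute)
    qed
    moreover have "(p * hyp0 c - b \<bullet> hypv c) * hyp0 w = (p * (1 + (norm c)\<^sup>2) - 2 * (b \<bullet> c)) * (1 + (norm v)\<^sup>2) / Q"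
      unfolding hyp_pairing_eq[of p c b] hyp0_def[of w] nv Q_def by (rule times_divide_times_eq)
    ultimately show ?thesis by (simp only: diff_divide_distrib)
  qed
  finally show ?thesis .
qed

lemma mob_norm_identity:
  fixes b c :: complex and p :: real
  shows "(norm (b + cnj b * c\<^sup>2 - of_real (2 * p) * c))\<^sup>2
      = (p * (1 + (norm c)\<^sup>2) - 2 * (b \<bullet> c))\<^sup>2 + ((norm b)\<^sup>2 - p\<^sup>2) * (1 - (norm c)\<^sup>2)\<^sup>2"
proof -
  define n where "n = (norm c)\<^sup>2"
  have 1: "(norm (b + cnj b * c\<^sup>2))\<^sup>2 = (norm b)\<^sup>2 * (1 - n)\<^sup>2 + 4 * (b \<bullet> c)\<^sup>2"
    unfolding n_def cmod_power2 inner_complex_def plus_complex.sel times_complex.sel cnj.sel Re_power2 Im_power2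
    by algebra
  have 2: "(b + cnj b * c\<^sup>2) \<bullet> c = (b \<bullet> c) * (1 + n)"
    unfolding n_def cmod_power2 inner_complex_def by (simp add: power2_eq_square algebra_simps)
  have "of_real (2 * p) * c = (2 * p) *\<^sub>R c" by (simp add: scaleR_conv_of_real)
  moreover have "(norm (b + cnj b * c\<^sup>2 - x))\<^sup>2
      = (norm (b + cnj b * c\<^sup>2))\<^sup>2 - 2 * ((b + cnj b * c\<^sup>2) \<bullet> x) + (norm x)\<^sup>2" for x
    unfolding power2_norm_eq_inner inner_diff_left inner_diff_right inner_commute[of x "b + cnj b * c\<^sup>2"] by simp
  ultimately have "(norm (b + cnj b * c\<^sup>2 - of_real (2 * p) * c))\<^sup>2
      = (norm b)\<^sup>2 * (1 - n)\<^sup>2 + 4 * (b \<bullet> c)\<^sup>2 - 2 * ((2 * p) * ((b \<bullet> c) * (1 + n))) + (2 * p)\<^sup>2 * n"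
    by (simp add: 1 2 power_mult_distrib n_def)
  then show ?thesis unfolding n_def[symmetric] by algebra
qed

lemma cap_mob:
  assumes c: "c \<in> hplane" and e: "norm e = 1" and n: "p\<^sup>2 + 1 = (norm b)\<^sup>2 + k\<^sup>2"
  defines "p' \<equiv> p * hyp0 c - b \<bullet> hypv c"
  obtains b' where "cap k p b = mob e c ` cap k p' b'" "cap_rim k p b = mob e c ` cap_rim k p' b'"
    "p'\<^sup>2 + 1 = (norm b')\<^sup>2 + k\<^sup>2"
proof
  define b' where "b' = cnj e * ((b + cnj b * c\<^sup>2 - of_real (2 * p) * c) / of_real (1 - (norm c)\<^sup>2))"
  have bij: "bij_betw (mob e c) hplane hplane" by (rule bij_mob[OF c e])
  have pair: "p * hyp0 (mob e c w) - b \<bullet> hypv (mob e c w) = p' * hyp0 w - b' \<bullet> hypv w" if "w \<in> hplane" for w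
    unfolding p'_def b'_def by (rule mob_pairing[OF c e that])
  have hp: "hplane = mob e c ` hplane" using bij by (simp add: bij_betw_def)
  have "cap k p b = {z \<in> mob e c ` hplane. p * hyp0 z - b \<bullet> hypv z < k}"
    unfolding cap_def using hp by simp
  then show "cap k p b = mob e c ` cap k p' b'"
    unfolding cap_def using pair by auto
  have "cap_rim k p b = {z \<in> mob e c ` hplane. p * hyp0 z - b \<bullet> hypv z = k}"
    unfolding cap_rim_def using hp by simp
  then show "cap_rim k p b = mob e c ` cap_rim k p' b'"
    unfolding cap_rim_def using pair by auto
  define q where "q = 1 - (norm c)\<^sup>2"
  have q: "0 < q" using c by (simp add: q_def hplane_iff)
  have p': "p' = (p * (1 + (norm c)\<^sup>2) - 2 * (b \<bullet> c)) / q"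
    unfolding p'_def hyp_pairing_eq q_def by simp
  have "(norm b')\<^sup>2 = (norm (b + cnj b * c\<^sup>2 - of_real (2 * p) * c))\<^sup>2 / q\<^sup>2"
    unfolding b'_def using e by (simp add: norm_mult norm_divide power_divide q_def del: of_real_diff of_real_power)
  moreover have "(norm (b + cnj b * c\<^sup>2 - of_real (2 * p) * c))\<^sup>2
      = (p * (1 + (norm c)\<^sup>2) - 2 * (b \<bullet> c))\<^sup>2 + ((norm b)\<^sup>2 - p\<^sup>2) * q\<^sup>2"
    unfolding q_def by (rule mob_norm_identity)
  moreover have "(A + B * q\<^sup>2) / q\<^sup>2 = A / q\<^sup>2 + B" for A B using q by (simp add: add_divide_distrib)
  ultimately have "(norm b')\<^sup>2 = p'\<^sup>2 + ((norm b)\<^sup>2 - p\<^sup>2)"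
    unfolding p' power_divide by (simp only:)
  then show "p'\<^sup>2 + 1 = (norm b')\<^sup>2 + k\<^sup>2" using n by simp
qed

lemma hyp_pairing_centre:
  assumes c: "c \<in> hplane" and e: "norm e = 1" and w: "w \<in> hplane"
  shows "hyp0 c * hyp0 (mob e c w) - hypv c \<bullet> hypv (mob e c w) = hyp0 w"
proof -
  define q where "q = 1 - (norm c)\<^sup>2"
  have q: "q \<noteq> 0" using c by (simp add: q_def hplane_iff)
  define K :: complex where "K = of_real (2 / q)"
  have K: "hypv c = K * c" "of_real (2 * hyp0 c) = K * of_real (1 + (norm c)\<^sup>2)" "cnj K = K"
    by (simp_all add: hypv_def hyp0_def q_def K_def scaleR_conv_of_real)
  have "hypv c + cnj (hypv c) * c\<^sup>2 - of_real (2 * hyp0 c) * c =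
    (K * c) * (1 + cnj c * c - of_real (1 + (norm c)\<^sup>2))"
    unfolding K complex_cnj_mult by (simp add: power2_eq_square algebra_simps)
  also have "of_real (1 + (norm c)\<^sup>2) = 1 + cnj c * c"
    by (simp only: of_real_add of_real_1 complex_norm_square mult.commute)
  also have "(K * c) * (1 + cnj c * c - (1 + cnj c * c)) = 0" by simp
  finally have "hypv c + cnj (hypv c) * c\<^sup>2 - of_real (2 * hyp0 c) * c = 0" .
  moreover have "hyp0 c * hyp0 c - hypv c \<bullet> hypv c = 1"
    using hyp_norm[OF c] unfolding power2_norm_eq_inner power2_eq_square[of "hyp0 c"] by simp
  ultimately show ?thesis using mob_pairing[OF c e w, of "hyp0 c" "hypv c"] by simp
qed

section \<open>The configuration of one face in normal position\<close>

lemma cap_rim_scale: "0 < t \<Longrightarrow> cap_rim (t * k) (t * p) (t *\<^sub>R b) = cap_rim k p b"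
  unfolding cap_rim_def by (simp add: mult.assoc flip: right_diff_distrib)

text \<open>The circle of radius \<open>r\<close> about \<open>c\<close> is the cap with normal \<open>c / sinh r\<close> and curvature \<open>coth r\<close>; perpendicularity
  then fixes the coordinate of the normal in the direction of \<open>c\<close>.\<close>

lemma perpendicular_hcircle:
  assumes c: "c \<in> hplane" and r: "0 < r" and n: "p\<^sup>2 + 1 = (norm b)\<^sup>2 + k\<^sup>2"
    and perp: "perpendicular (hcircle c r) (cap_rim k p b)"
  shows "p * hyp0 c - b \<bullet> hypv c = k * cosh r"
proof -
  define t where "t = 1 / sinh r"
  have s: "0 < sinh r" using r by simp
  have t: "0 < t" using s by (simp add: t_def)
  have "hcircle c r = cap_rim (t * cosh r) (t * hyp0 c) (t *\<^sub>R hypv c)"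
    using hcircle_eq_cap_rim[OF c] r cap_rim_scale[OF t] by simp
  moreover have "(t * hyp0 c)\<^sup>2 + 1 = (norm (t *\<^sub>R hypv c))\<^sup>2 + (t * cosh r)\<^sup>2"
  proof -
    have "t\<^sup>2 * (sinh r)\<^sup>2 = 1" using s by (simp add: t_def power_divide)
    then have "t\<^sup>2 * (cosh r)\<^sup>2 = t\<^sup>2 + 1" by (simp add: cosh_square_eq algebra_simps)
    then show ?thesis using t hyp_norm[OF c] by (simp add: power_mult_distrib algebra_simps)
  qed
  ultimately have "t * hyp0 c * p - (t *\<^sub>R hypv c) \<bullet> b = t * cosh r * k"
    using perpendicular_cap_rims[of "t * cosh r" "t * hyp0 c" "t *\<^sub>R hypv c" k p b] perp n by simp
  then have "t * (p * hyp0 c - b \<bullet> hypv c) = t * (k * cosh r)"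
    by (simp add: inner_commute[of b] algebra_simps)
  then show ?thesis using t by simp
qed

text \<open>\<open>tanh (r / 2)\<close>, the Euclidean radius of a hyperbolic circle of radius \<open>r\<close> about \<open>0\<close>.\<close>

definition dual_rad :: "real \<Rightarrow> real" where
  "dual_rad r = sinh r / (1 + cosh r)"

lemma dual_rad:
  assumes "0 < r"
  shows "0 < dual_rad r" "dual_rad r < 1" "(1 + cosh r) * dual_rad r = sinh r"
    "(1 + cosh r) * (dual_rad r)\<^sup>2 = cosh r - 1"
proof -
  have p: "0 < 1 + cosh r" "sinh r < cosh r" by (simp_all add: add_pos_pos sinh_less_cosh_real)
  show "0 < dual_rad r" "dual_rad r < 1" using assms p by (simp_all add: dual_rad_def)
  show 1: "(1 + cosh r) * dual_rad r = sinh r" using p by (simp add: dual_rad_def)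
  have "(1 + cosh r) * ((1 + cosh r) * (dual_rad r)\<^sup>2) = (sinh r)\<^sup>2" unfolding 1[symmetric] by (simp add: power2_eq_square algebra_simps)
  also have "\<dots> = (1 + cosh r) * (cosh r - 1)" unfolding sinh_square_eq by (simp add: power2_eq_square algebra_simps)
  finally show "(1 + cosh r) * (dual_rad r)\<^sup>2 = cosh r - 1" using p by simp
qed

lemma hyp0_le_cosh_iff:
  assumes "w \<in> hplane" "0 < r"
  shows "hyp0 w \<le> cosh r \<longleftrightarrow> norm w \<le> dual_rad r" "hyp0 w = cosh r \<longleftrightarrow> norm w = dual_rad r"
proof -
  note R = dual_rad[OF assms(2)]
  have p: "0 < 1 + cosh r" by (simp add: add_pos_pos)
  have q: "0 < 1 - (norm w)\<^sup>2" using assms(1) by (simp add: hplane_iff)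
  have "hyp0 w \<le> cosh r \<longleftrightarrow> (1 + cosh r) * (norm w)\<^sup>2 \<le> cosh r - 1"
    using q unfolding hyp0_def by (simp add: pos_divide_le_eq algebra_simps)
  also have "\<dots> \<longleftrightarrow> (norm w)\<^sup>2 \<le> (dual_rad r)\<^sup>2" unfolding R(4)[symmetric] using p by simp
  also have "\<dots> \<longleftrightarrow> norm w \<le> dual_rad r" using R(1) by (simp add: abs_le_square_iff[symmetric])
  finally show "hyp0 w \<le> cosh r \<longleftrightarrow> norm w \<le> dual_rad r" .
  have "hyp0 w = cosh r \<longleftrightarrow> (1 + cosh r) * (norm w)\<^sup>2 = cosh r - 1"
    using q unfolding hyp0_def by (auto simp add: divide_eq_eq algebra_simps)
  also have "\<dots> \<longleftrightarrow> (norm w)\<^sup>2 = (dual_rad r)\<^sup>2" unfolding R(4)[symmetric] using p by simp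
  also have "\<dots> \<longleftrightarrow> norm w = dual_rad r" using R(1) by simp
  finally show "hyp0 w = cosh r \<longleftrightarrow> norm w = dual_rad r" .
qed

lemma hplane_mob_image: "c \<in> hplane \<Longrightarrow> norm e = 1 \<Longrightarrow> z \<in> hplane \<Longrightarrow> \<exists>w\<in>hplane. z = mob e c w"
  by (metis bij_betw_imp_surj_on bij_mob image_iff)

lemma hcball_eq_mob:
  assumes "c \<in> hplane" "norm e = 1" "0 < r"
  shows "hcball c r = mob e c ` cball 0 (dual_rad r)"
proof -
  have "cball 0 (dual_rad r) \<subseteq> hplane" using dual_rad[OF assms(3)] by (auto simp: hplane_def)
  moreover have "mob e c w \<in> hcball c r \<longleftrightarrow> norm w \<le> dual_rad r" if w: "w \<in> hplane" for w
  proof -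
    have m: "mob e c w \<in> hplane" by (rule mob_in_hplane[OF assms(1,2) w])
    have "mob e c w \<in> hcball c r \<longleftrightarrow> \<not> (hdist c (mob e c w) > r)" using m by (auto simp: hcball_def)
    also have "\<dots> \<longleftrightarrow> cosh (hdist c (mob e c w)) \<le> cosh r"
      using hdist_nonneg[OF assms(1) m] assms(3) by (subst cosh_real_nonneg_le_iff) auto
    also have "\<dots> \<longleftrightarrow> hyp0 w \<le> cosh r"
      unfolding cosh_hdist[OF assms(1) m] hyp_pairing_centre[OF assms(1,2) w] ..
    finally show ?thesis using hyp0_le_cosh_iff[OF w assms(3)] by simp
  qed
  moreover have "hcball c r \<subseteq> hplane" by (auto simp: hcball_def)
  ultimately show ?thesis using hplane_mob_image[OF assms(1,2)] by (auto 0 3 simp: subset_iff) (metis image_iff mem_cball_0)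
qed

lemma hcircle_mob_point:
  assumes "c \<in> hplane" "norm e = 1" "0 < r" "z \<in> hcircle c r"
  obtains x where "norm x = 1" "z = mob e c (of_real (dual_rad r) * x)"
proof -
  note R = dual_rad[OF assms(3)]
  have z: "z \<in> hplane" using assms(4) by (simp add: hcircle_def)
  obtain w where w: "w \<in> hplane" "z = mob e c w" using hplane_mob_image[OF assms(1,2) z] by blast
  have "hyp0 w = cosh r"
    using assms(3,4) hcircle_eq_cap_rim[OF assms(1), of r] hyp_pairing_centre[OF assms(1,2) w(1)] w(2)
    by (simp add: cap_rim_def)
  then have n: "norm w = dual_rad r" using hyp0_le_cosh_iff[OF w(1) assms(3)] by simp
  show thesis
    by (rule that[of "w / of_real (dual_rad r)"]) (use n R w(2) in \<open>simp_all add: norm_divide\<close>)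
qed

lemma unit_perp_complex:
  fixes x n :: complex
  assumes "norm x = 1" "norm n = 1" "n \<bullet> x = 0"
  shows "n = \<i> * x \<or> n = - (\<i> * x)"
proof -
  define a where "a = Im n * Re x - Re n * Im x"
  have x: "(Re x)\<^sup>2 + (Im x)\<^sup>2 = 1" "(Re n)\<^sup>2 + (Im n)\<^sup>2 = 1" using assms cmod_power2[of x] cmod_power2[of n] by simp_all
  have p: "Re n * Re x + Im n * Im x = 0" using assms(3) by (simp add: inner_complex_def)
  have re: "Re n = - a * Im x" using x(1) p unfolding a_def by algebra
  have im: "Im n = a * Re x" using x(1) p unfolding a_def by algebra
  have "a\<^sup>2 = 1" using x p unfolding a_def by algebra
  then have "a = 1 \<or> a = -1" by (simp add: power2_eq_1_iff)
  then show ?thesis using re im by (auto simp: complex_eq_iff)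
qed

lemma caps_common_normal_meet:
  assumes "z \<in> cap_rim k p b" "p\<^sup>2 + 1 = (norm b)\<^sup>2 + k\<^sup>2"
    and "z \<in> cap_rim k' p' b'" "p'\<^sup>2 + 1 = (norm b')\<^sup>2 + k'\<^sup>2"
    and "(p + k) *\<^sub>R z - b = (p' + k') *\<^sub>R z - b'"
  shows "cap k p b \<inter> cap k' p' b' \<noteq> {}"
proof -
  have "\<forall>\<^sub>F t in at_right (0::real). z - t *\<^sub>R ((p + k) *\<^sub>R z - b) \<in> cap k p b \<inter> cap k' p' b'"
    using eventually_cap[OF assms(1,2)] eventually_cap[OF assms(3,4)] unfolding assms(5)[symmetric]
    by eventually_elim simp
  then obtain t where "z - t *\<^sub>R ((p + k) *\<^sub>R z - b) \<in> cap k p b \<inter> cap k' p' b'"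
    using eventually_happens'[OF trivial_limit_at_right_real] by blast
  then show ?thesis by blast
qed

text \<open>A disk perpendicular to the dual circle has its normal at a common point tangent to the dual
  circle. So its data are determined by the point up to the sign of a unit vector.\<close>

lemma rim_point_on_dual:
  assumes "0 < r" "norm x = 1" "(k * cosh r)\<^sup>2 + 1 = (norm b)\<^sup>2 + k\<^sup>2"
    and z: "of_real (dual_rad r) * x \<in> cap_rim k (k * cosh r) b"
  defines "n \<equiv> (k * cosh r + k) *\<^sub>R (of_real (dual_rad r) * x) - b"
  shows "norm n = 1" "n \<bullet> x = 0" "b = (k * sinh r) *\<^sub>R x - n"
proof -
  note R = dual_rad[OF assms(1)]
  show "norm n = 1" unfolding n_def by (rule cap_rim_normal_unit[OF z assms(3)])
  have e: "(k * cosh r + k) *\<^sub>R (of_real (dual_rad r) * x) = (k * sinh r) *\<^sub>R x"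
  proof -
    have "(k * cosh r + k) * dual_rad r = k * sinh r" unfolding R(3)[symmetric] by (simp add: algebra_simps)
    moreover have "(k * cosh r + k) *\<^sub>R (of_real (dual_rad r) * x) = ((k * cosh r + k) * dual_rad r) *\<^sub>R x"
      by (simp add: scaleR_conv_of_real)
    ultimately show ?thesis by simp
  qed
  show b: "b = (k * sinh r) *\<^sub>R x - n" unfolding n_def e by simp
  have xx: "x \<bullet> x = 1" using assms(2) by (simp add: norm_eq_1)
  have "(k * cosh r + k) * (norm (of_real (dual_rad r) * x))\<^sup>2 - 2 * (b \<bullet> (of_real (dual_rad r) * x)) + (k * cosh r - k) = 0"
    using z by (simp add: cap_rim_iff)
  moreover have "(norm (of_real (dual_rad r) * x))\<^sup>2 = (dual_rad r)\<^sup>2" using assms(2) R(1) by (simp add: norm_mult)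
  moreover have "b \<bullet> (of_real (dual_rad r) * x) = dual_rad r * (b \<bullet> x)"
    by (simp flip: scaleR_conv_of_real)
  ultimately have "k * ((1 + cosh r) * (dual_rad r)\<^sup>2) + k * (cosh r - 1) = 2 * dual_rad r * (b \<bullet> x)"
    by (simp add: algebra_simps)
  then have "k * ((1 + cosh r) * dual_rad r) * dual_rad r = dual_rad r * (b \<bullet> x)"
    unfolding R(4)[symmetric] by (simp add: power2_eq_square algebra_simps)
  then have "b \<bullet> x = k * sinh r" unfolding R(3) using R(1) by simp
  then show "n \<bullet> x = 0" unfolding n_def e by (simp add: inner_diff_left xx)
qed

text \<open>The third disk is tangent to the first two, which are in the position \<open>(K1, -1)\<close>, \<open>(K2, 1)\<close>. The two
  tangency conditions are linear in its normal \<open>(X, Y)\<close>; the length of the normal then yields the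
  relation between the three curvatures.\<close>

lemma third_normal_solve:
  fixes X Y K1 K2 K3 :: real
  assumes K: "0 < K1" "0 < K2"
    and "K1 * X - Y = K1 * K3 - 1" "K2 * X + Y = K2 * K3 - 1" "X\<^sup>2 + Y\<^sup>2 = 1 + K3\<^sup>2"
  shows "X = K3 - 2 / (K1 + K2)" "Y = (K2 - K1) / (K1 + K2)" "K1 * K2 + K2 * K3 + K1 * K3 = 1"
proof -
  define t where "t = 1 / (K1 + K2)"
  have t: "t * (K1 + K2) = 1" using K by (simp add: t_def)
  have X: "X = K3 - 2 * t" using assms(3,4) t by algebra
  have Y: "Y = (K2 - K1) * t" using assms(3,4) X t by algebra
  show "X = K3 - 2 / (K1 + K2)" "Y = (K2 - K1) / (K1 + K2)" using X Y by (simp_all add: t_def)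
  have "t\<^sup>2 * (K1 * K2 + K2 * K3 + K1 * K3 - 1) = 0" using assms(5) t unfolding X Y by algebra
  moreover have "t \<noteq> 0" using t by auto
  ultimately show "K1 * K2 + K2 * K3 + K1 * K3 = 1" by simp
qed

text \<open>Move the centre of the dual circle to \<open>0\<close> and the tangent point of two of the disks to the positive
  real axis. At a tangent point the normals of the two disks are opposite, since otherwise the disks overlap;
  in terms of the vectors \<open>b\<close> this says \<open>b x \<bullet> b y = K\<^sub>x K\<^sub>y - 1\<close> with \<open>K = k sinh r\<close>, and these
  three products leave only one configuration up to the names of the vertices.\<close>

lemma triangle_normal_form:
  assumes tp: "triangle_packing W k D c r" and W: "card W = 3"
  obtains u v w e b where "W = {u, v, w}" "u \<noteq> v" "v \<noteq> w" "u \<noteq> w"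
    "norm e = 1" "c \<in> hplane" "0 < r" "\<And>x. x \<in> W \<Longrightarrow> 0 < k x"
    "\<And>x. x \<in> W \<Longrightarrow> hbdry (D x) = mob e c ` cap_rim (k x) (k x * cosh r) (b x)"
    "b u = Complex (k u * sinh r) (- 1)" "b v = Complex (k v * sinh r) 1"
    "b w = Complex (k w * sinh r - 2 / (k u * sinh r + k v * sinh r))
       ((k v * sinh r - k u * sinh r) / (k u * sinh r + k v * sinh r))"
    "(k u * sinh r) * (k v * sinh r) + (k v * sinh r) * (k w * sinh r) + (k u * sinh r) * (k w * sinh r) = 1"
proof -
  have c: "c \<in> hplane" and r: "0 < r" and gd: "\<And>x. x \<in> W \<Longrightarrow> gen_disk (k x) (D x)"
    and tan: "\<And>u v. u \<in> W \<Longrightarrow> v \<in> W \<Longrightarrow> u \<noteq> v \<Longrightarrow> externally_tangent (D u) (D v)"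
    and perp: "\<And>x. x \<in> W \<Longrightarrow> perpendicular (hcircle c r) (hbdry (D x))"
    and dual: "\<And>u v p. u \<in> W \<Longrightarrow> v \<in> W \<Longrightarrow> u \<noteq> v \<Longrightarrow> tangent_at (hbdry (D u)) (hbdry (D v)) p \<Longrightarrow> p \<in> hcircle c r"
  proof -
    note tp = tp[unfolded triangle_packing_def]
    show "gen_disk (k x) (D x)" if "x \<in> W" for x using tp[THEN conjunct1] that by blast
    show "externally_tangent (D u) (D v)" if "u \<in> W" "v \<in> W" "u \<noteq> v" for u v
      using tp[THEN conjunct2, THEN conjunct1] that by blast
    note tp = tp[THEN conjunct2, THEN conjunct2]
    show "c \<in> hplane" by (rule tp[THEN conjunct1])
    show "0 < r" by (rule tp[THEN conjunct2, THEN conjunct1])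
    show "perpendicular (hcircle c r) (hbdry (D x))" if "x \<in> W" for x
      using tp[THEN conjunct2, THEN conjunct2, THEN conjunct1] that by blast
    show "p \<in> hcircle c r" if "u \<in> W" "v \<in> W" "u \<noteq> v" "tangent_at (hbdry (D u)) (hbdry (D v)) p" for u v p
      using tp[THEN conjunct2, THEN conjunct2, THEN conjunct2] that by blast
  qed
  have kpos: "0 < k x" if "x \<in> W" for x using gd[OF that] by (auto simp: gen_disk_def)
  define s where "s = sinh r"
  have s: "0 < s" using r by (simp add: s_def)
  note R = dual_rad[OF r]
  have frame: "\<exists>b. D x = mob e c ` cap (k x) (k x * cosh r) b \<and>
      hbdry (D x) = mob e c ` cap_rim (k x) (k x * cosh r) b \<and> (k x * cosh r)\<^sup>2 + 1 = (norm b)\<^sup>2 + (k x)\<^sup>2"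
    if x: "x \<in> W" and e: "norm e = 1" for x e
  proof -
    obtain p b where pb: "D x = cap (k x) p b" "p\<^sup>2 + 1 = (norm b)\<^sup>2 + (k x)\<^sup>2"
      using gen_disk_imp_cap[OF gd[OF x]] .
    have hb: "hbdry (D x) = cap_rim (k x) p b" unfolding pb(1) by (rule hbdry_cap[OF pb(2)])
    have p: "p * hyp0 c - b \<bullet> hypv c = k x * cosh r"
      using perp[OF x] unfolding hb by (rule perpendicular_hcircle[OF c r pb(2)])
    from cap_mob[OF c e pb(2)] obtain b' where "cap (k x) p b = mob e c ` cap (k x) (k x * cosh r) b'"
      "cap_rim (k x) p b = mob e c ` cap_rim (k x) (k x * cosh r) b'"
      "(k x * cosh r)\<^sup>2 + 1 = (norm b')\<^sup>2 + (k x)\<^sup>2" unfolding p by blast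
    then show ?thesis using pb(1) hb by auto
  qed
  have tangency: "\<exists>n. norm n = 1 \<and> n \<bullet> x = 0 \<and> b u = (k u * s) *\<^sub>R x - n \<and> b v = (k v * s) *\<^sub>R x + n"
    if uv: "u \<in> W" "v \<in> W" "u \<noteq> v" and e: "norm e = 1" and x: "norm x = 1"
      and p: "tangent_at (hbdry (D u)) (hbdry (D v)) (mob e c (of_real (dual_rad r) * x))"
      and b: "\<And>y. y \<in> W \<Longrightarrow> D y = mob e c ` cap (k y) (k y * cosh r) (b y) \<and>
         hbdry (D y) = mob e c ` cap_rim (k y) (k y * cosh r) (b y) \<and> (k y * cosh r)\<^sup>2 + 1 = (norm (b y))\<^sup>2 + (k y)\<^sup>2"
    for u v x e b
  proof -
    define q where "q = of_real (dual_rad r) * x"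
    have q: "q \<in> hplane" using R x by (simp add: q_def hplane_def norm_mult)
    have inj: "inj_on (mob e c) hplane" using bij_mob[OF c e] by (simp add: bij_betw_def)
    have rim: "q \<in> cap_rim (k y) (k y * cosh r) (b y)" if "y \<in> W" "mob e c q \<in> hbdry (D y)" for y
    proof -
      have "cap_rim (k y) (k y * cosh r) (b y) \<subseteq> hplane" by (auto simp: cap_rim_def)
      moreover have "hbdry (D y) = mob e c ` cap_rim (k y) (k y * cosh r) (b y)" using b[OF that(1)] by blast
      ultimately show ?thesis using that(2) inj_on_image_mem_iff[OF inj q] by metis
    qed
    have qu: "q \<in> cap_rim (k u) (k u * cosh r) (b u)" and qv: "q \<in> cap_rim (k v) (k v * cosh r) (b v)"
      using p uv rim unfolding tangent_at_def q_def[symmetric] by auto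
    define nu nv where "nu = (k u * cosh r + k u) *\<^sub>R q - b u" and "nv = (k v * cosh r + k v) *\<^sub>R q - b v"
    note nb = b[THEN conjunct2, THEN conjunct2]
    have U': "norm nu = 1" "nu \<bullet> x = 0" "b u = (k u * s) *\<^sub>R x - nu"
      unfolding nu_def s_def q_def by (rule rim_point_on_dual[OF r x nb[OF uv(1)] qu[unfolded q_def]])+
    have V': "norm nv = 1" "nv \<bullet> x = 0" "b v = (k v * s) *\<^sub>R x - nv"
      unfolding nv_def s_def q_def by (rule rim_point_on_dual[OF r x nb[OF uv(2)] qv[unfolded q_def]])+
    have "nu \<noteq> nv"
    proof
      assume "nu = nv"
      then have "cap (k u) (k u * cosh r) (b u) \<inter> cap (k v) (k v * cosh r) (b v) \<noteq> {}"
        using caps_common_normal_meet[OF qu nb[OF uv(1)] qv nb[OF uv(2)]] unfolding nu_def nv_def by blast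
      then have "D u \<inter> D v \<noteq> {}" unfolding b[OF uv(1), THEN conjunct1] b[OF uv(2), THEN conjunct1] by blast
      then show False using tan[OF uv] by (simp add: externally_tangent_def)
    qed
    then have "nv = - nu" using unit_perp_complex[OF x U'(1,2)] unit_perp_complex[OF x V'(1,2)] by auto
    then show ?thesis using U' V' by (intro exI[of _ nu]) simp
  qed
  have ex_tangent: "\<exists>p. tangent_at (hbdry (D u)) (hbdry (D v)) p \<and> p \<in> hcircle c r" if "u \<in> W" "v \<in> W" "u \<noteq> v" for u v
    using tan[OF that] dual[OF that] by (auto simp: externally_tangent_def)
  obtain u0 v0 w where W0: "W = {u0, v0, w}" "u0 \<noteq> v0" "v0 \<noteq> w" "u0 \<noteq> w"
    using W by (auto simp: card_3_iff)
  then obtain p where p: "tangent_at (hbdry (D u0)) (hbdry (D v0)) p" "p \<in> hcircle c r"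
    using ex_tangent[of u0 v0] by auto
  obtain e where e: "norm e = 1" "p = mob 1 c (of_real (dual_rad r) * e)"
    using hcircle_mob_point[OF c _ r p(2), of 1] by auto
  \<comment> \<open>the direction of the tangent point in the first frame is the rotation that moves it to the real axis\<close>
  have pe: "p = mob e c (of_real (dual_rad r) * 1)" unfolding e(2) mob_def by (simp add: mult_ac)
  have "\<exists>b. \<forall>x\<in>W. D x = mob e c ` cap (k x) (k x * cosh r) (b x) \<and>
      hbdry (D x) = mob e c ` cap_rim (k x) (k x * cosh r) (b x) \<and> (k x * cosh r)\<^sup>2 + 1 = (norm (b x))\<^sup>2 + (k x)\<^sup>2"
    using frame[OF _ e(1)] by (intro bchoice ballI) blast
  then obtain b where "\<forall>x\<in>W. D x = mob e c ` cap (k x) (k x * cosh r) (b x) \<and>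
      hbdry (D x) = mob e c ` cap_rim (k x) (k x * cosh r) (b x) \<and> (k x * cosh r)\<^sup>2 + 1 = (norm (b x))\<^sup>2 + (k x)\<^sup>2"
    by (rule exE)
  note b = this[THEN bspec]
  have inner_b: "b x \<bullet> b y = (k x * s) * (k y * s) - 1" if xy: "x \<in> W" "y \<in> W" "x \<noteq> y" for x y
  proof -
    obtain p' where p': "tangent_at (hbdry (D x)) (hbdry (D y)) p'" "p' \<in> hcircle c r" using ex_tangent[OF xy] by blast
    obtain z where z: "norm z = 1" "p' = mob e c (of_real (dual_rad r) * z)" using hcircle_mob_point[OF c e(1) r p'(2)] .
    have "\<exists>n. norm n = 1 \<and> n \<bullet> z = 0 \<and> b x = (k x * s) *\<^sub>R z - n \<and> b y = (k y * s) *\<^sub>R z + n"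
      by (rule tangency[OF xy e(1) z(1) p'(1)[unfolded z(2)]]) (rule b)
    then obtain n where n: "norm n = 1" "n \<bullet> z = 0" "b x = (k x * s) *\<^sub>R z - n" "b y = (k y * s) *\<^sub>R z + n"
      by (elim exE conjE)
    show ?thesis unfolding n(3,4) using n(1,2) z(1)
      by (simp add: inner_diff_left inner_add_right norm_eq_1 inner_commute[of z n])
  qed
  have uvW: "u0 \<in> W" "v0 \<in> W" using W0(1) by auto
  have "\<exists>n. norm n = 1 \<and> n \<bullet> 1 = 0 \<and> b u0 = (k u0 * s) *\<^sub>R 1 - n \<and> b v0 = (k v0 * s) *\<^sub>R 1 + n"
    by (rule tangency[OF uvW W0(2) e(1) norm_one p(1)[unfolded pe]]) (rule b)
  then obtain n where n: "norm n = 1" "n \<bullet> 1 = 0" "b u0 = (k u0 * s) *\<^sub>R 1 - n" "b v0 = (k v0 * s) *\<^sub>R 1 + n"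
    by (elim exE conjE)
  have "n = \<i> \<or> n = - \<i>" using unit_perp_complex[OF _ n(1,2)] by simp
  then obtain u v where uv: "{u, v} = {u0, v0}" "u \<noteq> v" "b u = Complex (k u * s) (- 1)" "b v = Complex (k v * s) 1"
  proof
    assume "n = \<i>"
    then show thesis using that[of u0 v0] n(3,4) W0(2) by (simp add: complex_eq_iff)
  next
    assume "n = - \<i>"
    then show thesis using that[of v0 u0] n(3,4) W0(2) by (simp add: complex_eq_iff insert_commute)
  qed
  have W1: "W = {u, v, w}" "v \<noteq> w" "u \<noteq> w" using uv(1) W0 by (auto simp: doubleton_eq_iff)
  define X Y where "X = Re (b w)" and "Y = Im (b w)"
  have "(k u * s) * X - Y = (k u * s) * (k w * s) - 1" "(k v * s) * X + Y = (k v * s) * (k w * s) - 1"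
    using inner_b[of u w] inner_b[of v w] W1 uv by (auto simp: inner_complex_def X_def Y_def)
  moreover have "X\<^sup>2 + Y\<^sup>2 = 1 + (k w * s)\<^sup>2"
    using b[of w] W1 cmod_power2[of "b w"] unfolding X_def Y_def s_def
    by (simp add: power_mult_distrib cosh_square_eq algebra_simps)
  moreover have "0 < k u * s" "0 < k v * s" using kpos s W1 by auto
  ultimately have XY: "X = k w * s - 2 / (k u * s + k v * s)" "Y = (k v * s - k u * s) / (k u * s + k v * s)"
      "(k u * s) * (k v * s) + (k v * s) * (k w * s) + (k u * s) * (k w * s) = 1"
    using third_normal_solve[of "k u * s" "k v * s" X Y "k w * s"] by blast+
  show thesis
  proof (rule that[OF W1(1) uv(2) W1(2,3) e(1) c r kpos])
    show "hbdry (D x) = mob e c ` cap_rim (k x) (k x * cosh r) (b x)" if "x \<in> W" for x using b[OF that] by blast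
    show "b w = Complex (k w * sinh r - 2 / (k u * sinh r + k v * sinh r))
       ((k v * sinh r - k u * sinh r) / (k u * sinh r + k v * sinh r))"
      using XY unfolding X_def Y_def s_def by (simp add: complex_eq_iff)
  qed (use uv XY in \<open>auto simp: s_def\<close>)
qed

section \<open>Monotonicity of lengths, total curvatures and areas\<close>

text \<open>The length of the sub-arc of a curve of curvature \<open>k\<close> in a face with \<open>s = sinh r\<close>. The variable \<open>u\<close> is
  chosen such that the integrand does not depend on \<open>s\<close> and \<open>arctan (k u)\<close> is an angle.\<close>

definition ell :: "real \<Rightarrow> real \<Rightarrow> real" where
  "ell k s = integral {0..s} (\<lambda>u. 2 / ((1 + (k * u)\<^sup>2) * sqrt (1 + u\<^sup>2)))"

lemma one_plus_square_pos: "0 < 1 + (x::real)\<^sup>2" by (simp add: add_pos_nonneg)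

lemma one_plus_square_neq: "1 + (x::real)\<^sup>2 \<noteq> 0" using one_plus_square_pos[of x] by simp

lemma continuous_on_ell_integrand:
  "continuous_on A (\<lambda>u. 2 / ((1 + (k * u)\<^sup>2) * sqrt (1 + (c * u)\<^sup>2)) :: real)"
  by (intro continuous_intros) (auto simp: one_plus_square_neq)

lemma continuous_on_ell_integrand1:
  "continuous_on A (\<lambda>u. 2 / ((1 + (k * u)\<^sup>2) * sqrt (1 + u\<^sup>2)) :: real)"
  using continuous_on_ell_integrand[of A k 1] by simp

lemma ell_nonneg: "0 \<le> ell k s"
  unfolding ell_def by (intro integral_nonneg integrable_continuous_real continuous_on_ell_integrand1) simp

lemma ell_mono:
  assumes "0 \<le> k'" "k' \<le> k" "s \<le> s'"
  shows "ell k s \<le> ell k' s'"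
proof -
  have "ell k s \<le> ell k' s" unfolding ell_def
  proof (intro integral_le integrable_continuous_real continuous_on_ell_integrand1)
    fix u :: real
    have "(k' * u)\<^sup>2 \<le> (k * u)\<^sup>2" unfolding power_mult_distrib using assms by (intro mult_right_mono power_mono) auto
    then show "2 / ((1 + (k * u)\<^sup>2) * sqrt (1 + u\<^sup>2)) \<le> 2 / ((1 + (k' * u)\<^sup>2) * sqrt (1 + u\<^sup>2))"
      using one_plus_square_pos[of "k' * u"] one_plus_square_pos[of u] by (intro divide_left_mono mult_right_mono mult_pos_pos) auto
  qed
  also have "ell k' s \<le> ell k' s'" unfolding ell_def
    using assms by (intro integral_subset_le integrable_continuous_real continuous_on_ell_integrand1) auto
  finally show ?thesis .
qed

text \<open>Rescaling the variable by \<open>l\<close> turns \<open>k ell k s\<close> into \<open>l k\<close> times the integral up to \<open>s / l\<close> of a function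
  that differs from the integrand for curvature \<open>l k\<close> only in having \<open>l u\<close> for \<open>u\<close> under the square root.\<close>

lemma total_curvature_scaling:
  assumes k: "0 < k" and l: "1 < l" and s: "0 < s" "s / l \<le> s'"
  shows "k * ell k s < (l * k) * ell (l * k) s'"
proof -
  have "k * ell k s = k * integral {0..s / l} (\<lambda>u. l * (2 / ((1 + (k * (l * u))\<^sup>2) * sqrt (1 + (l * u)\<^sup>2))))"
  proof -
    have "((\<lambda>u. l *\<^sub>R (2 / ((1 + (k * (l * u))\<^sup>2) * sqrt (1 + (l * u)\<^sup>2)))) has_integral
      integral {l * 0..l * (s / l)} (\<lambda>u. 2 / ((1 + (k * u)\<^sup>2) * sqrt (1 + u\<^sup>2)))) {0..s / l}"
      using l s by (intro has_integral_substitution[where c = 0 and d = s] continuous_on_ell_integrand1)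
       (auto intro!: derivative_eq_intros simp: field_simps)
    then show ?thesis using l unfolding ell_def by (simp add: has_integral_iff)
  qed
  also have "\<dots> = l * k * integral {0..s / l} (\<lambda>u. 2 / ((1 + (l * k * u)\<^sup>2) * sqrt (1 + (l * u)\<^sup>2)))"
    by (simp only: integral_mult_right) (simp add: mult_ac)
  also have "\<dots> < l * k * integral {0..s / l} (\<lambda>u. 2 / ((1 + (l * k * u)\<^sup>2) * sqrt (1 + u\<^sup>2)))"
  proof (intro mult_strict_left_mono integral_less_real continuous_on_ell_integrand continuous_on_ell_integrand1)
    fix u assume u: "u \<in> {0<..<s / l}"
    have "u < l * u" using u l by simp
    then have "u\<^sup>2 < (l * u)\<^sup>2" using u by (intro power_strict_mono) auto
    then show "2 / ((1 + (l * k * u)\<^sup>2) * sqrt (1 + (l * u)\<^sup>2)) < 2 / ((1 + (l * k * u)\<^sup>2) * sqrt (1 + u\<^sup>2))"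
      using one_plus_square_pos[of "l * k * u"] one_plus_square_pos[of u] one_plus_square_pos[of "l * u"]
      by (intro divide_strict_left_mono mult_strict_left_mono mult_pos_pos) auto
  next
    show "{0<..<s / l} \<noteq> {}" using divide_pos_pos[OF s(1), of l] l by simp
  qed (use k l in auto)
  also have "\<dots> = l * k * ell (l * k) (s / l)" by (simp add: ell_def)
  also have "\<dots> \<le> l * k * ell (l * k) s'" using k l s by (intro mult_left_mono ell_mono) auto
  finally show ?thesis by simp
qed

definition tri_area :: "real \<Rightarrow> real \<Rightarrow> real \<Rightarrow> real \<Rightarrow> real" where
  "tri_area k1 k2 k3 s = (2 * arctan (k1 * s) - k1 * ell k1 s) + (2 * arctan (k2 * s) - k2 * ell k2 s)
     + (2 * arctan (k3 * s) - k3 * ell k3 s)"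

text \<open>Since \<open>k / (1 + k\<^sup>2 u\<^sup>2)\<close> is the derivative of \<open>arctan (k u)\<close>, integration by parts moves the
  dependence on \<open>k\<close> into an arctangent, which is monotone in \<open>k\<close> and whose sum over the three arcs of a face is
  known at the upper limit.\<close>

lemma sector_area_by_parts:
  assumes s: "0 \<le> s"
  shows "2 * arctan (k * s) - k * ell k s =
    2 * arctan (k * s) * (1 - 1 / sqrt (1 + s\<^sup>2))
      - integral {0..s} (\<lambda>u. 2 * arctan (k * u) * (u / sqrt (1 + u\<^sup>2) ^ 3))"
proof -
  have cont: "continuous_on {0..s} (\<lambda>u. 2 * arctan (k * u) * (u / sqrt (1 + u\<^sup>2) ^ 3))"
    by (intro continuous_intros) (auto simp: one_plus_square_neq)
  have "((\<lambda>u. k * (2 / ((1 + (k * u)\<^sup>2) * sqrt (1 + u\<^sup>2))) - 2 * arctan (k * u) * (u / sqrt (1 + u\<^sup>2) ^ 3))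
      has_integral (2 * arctan (k * s) / sqrt (1 + s\<^sup>2) - 2 * arctan (k * 0) / sqrt (1 + 0\<^sup>2))) {0..s}"
  proof (rule fundamental_theorem_of_calculus[OF s])
    fix u assume "u \<in> {0..s}"
    define q where "q = sqrt (1 + u\<^sup>2)"
    have q: "0 < q" using one_plus_square_pos[of u] by (simp add: q_def)
    have "((\<lambda>u. 2 * arctan (k * u) / sqrt (1 + u\<^sup>2)) has_real_derivative
        (k * (2 / ((1 + (k * u)\<^sup>2) * q)) - 2 * arctan (k * u) * (u / q ^ 3))) (at u within {0..s})"
    proof -
      have d1: "((\<lambda>u. 2 * arctan (k * u)) has_real_derivative (2 * (k / (1 + (k*u)\<^sup>2)))) (at u within {0..s})"
        by (auto intro!: derivative_eq_intros simp: divide_inverse)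
      have d2: "((\<lambda>u. sqrt (1 + u\<^sup>2)) has_real_derivative (u / q)) (at u within {0..s})"
        unfolding q_def using one_plus_square_pos[of u] by (auto intro!: derivative_eq_intros simp: field_simps)
      have q0: "sqrt (1 + u\<^sup>2) \<noteq> 0" using q by (simp add: q_def)
      have *: "(2 * (k / P) * q - 2 * A * (u / q)) / (q * q) = k * (2 / (P * q)) - 2 * A * (u / q ^ 3)"
        if "0 < q" "P \<noteq> 0" for P A q :: real
        using that by (simp add: field_simps power3_eq_cube)
      show ?thesis
        by (rule DERIV_cong[OF DERIV_divide[OF d1 d2 q0]])
          (unfold q_def[symmetric], rule *[OF q one_plus_square_neq])
    qed
    then show "((\<lambda>u. 2 * arctan (k * u) / sqrt (1 + u\<^sup>2)) has_vector_derivative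
        (k * (2 / ((1 + (k * u)\<^sup>2) * sqrt (1 + u\<^sup>2))) - 2 * arctan (k * u) * (u / sqrt (1 + u\<^sup>2) ^ 3))) (at u within {0..s})"
      by (simp add: q_def has_real_derivative_iff_has_vector_derivative)
  qed
  then have "2 * arctan (k * s) / sqrt (1 + s\<^sup>2)
    = integral {0..s} (\<lambda>u. k * (2 / ((1 + (k * u)\<^sup>2) * sqrt (1 + u\<^sup>2))) - 2 * arctan (k * u) * (u / sqrt (1 + u\<^sup>2) ^ 3))"
    by (simp add: has_integral_iff)
  also have "\<dots> = k * ell k s - integral {0..s} (\<lambda>u. 2 * arctan (k * u) * (u / sqrt (1 + u\<^sup>2) ^ 3))"
    unfolding ell_def
    by (subst integral_diff[OF integrable_continuous_real[OF continuous_on_mult_left[OF continuous_on_ell_integrand1]]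
            integrable_continuous_real[OF cont]])
      (simp only: integral_mult_right)
  finally show ?thesis by (simp add: algebra_simps)
qed

lemma integral_tan_weight:
  assumes s: "0 \<le> s"
  shows "((\<lambda>u. u / sqrt (1 + u\<^sup>2) ^ 3) has_integral (1 - 1 / sqrt (1 + s\<^sup>2))) {0..s}"
proof -
  have "((\<lambda>u. u / sqrt (1 + u\<^sup>2) ^ 3) has_integral (- 1 / sqrt (1 + s\<^sup>2) - (- 1 / sqrt (1 + 0\<^sup>2)))) {0..s}"
  proof (rule fundamental_theorem_of_calculus[OF s])
    fix u assume "u \<in> {0..s}"
    define q where "q = sqrt (1 + u\<^sup>2)"
    have q: "0 < q" using one_plus_square_pos[of u] by (simp add: q_def)
    have d2: "((\<lambda>u. sqrt (1 + u\<^sup>2)) has_real_derivative (u / q)) (at u within {0..s})"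
        unfolding q_def using one_plus_square_pos[of u] by (auto intro!: derivative_eq_intros simp: field_simps)
    have q0: "sqrt (1 + u\<^sup>2) \<noteq> 0" using q by (simp add: q_def)
    have "((\<lambda>u. - 1 / sqrt (1 + u\<^sup>2)) has_real_derivative u / q ^ 3) (at u within {0..s})"
      by (rule DERIV_cong[OF DERIV_divide[OF DERIV_const d2 q0]])
        (use q in \<open>simp add: q_def[symmetric] power3_eq_cube\<close>)
    then show "((\<lambda>u. - 1 / sqrt (1 + u\<^sup>2)) has_vector_derivative u / sqrt (1 + u\<^sup>2) ^ 3) (at u within {0..s})"
      by (simp add: q_def has_real_derivative_iff_has_vector_derivative)
  qed
  then show ?thesis by simp
qed

text \<open>The addition theorem for the cotangent: \<open>tan (arctan a + arctan b) = (a + b) / (1 - a b) = 1 / c\<close>.\<close>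

lemma sum_arctan_eq_half_pi:
  assumes "0 < a" "0 < b" "0 < c" "a * b + b * c + a * c = 1"
  shows "arctan a + arctan b + arctan c = pi / 2"
proof -
  have ab: "a * b < 1" using assms by (smt (verit) mult_pos_pos)
  have "arctan a + arctan b = arctan ((a + b) / (1 - a * b))"
  proof (rule arctan_add_raw)
    have "arctan a + arctan b < pi / 2"
    proof -
      have "a < 1 / b" using ab assms by (simp add: field_simps)
      then have "arctan a < arctan (1 / b)" by (rule arctan_monotone)
      also have "\<dots> = pi / 2 - arctan b" using arctan_inverse[of b] assms by (simp add: inverse_eq_divide)
      finally show ?thesis by simp
    qed
    moreover have "0 < arctan a" "0 < arctan b" using assms by auto
    ultimately show "\<bar>arctan a + arctan b\<bar> < pi / 2" by simp
  qed
  also have "(a + b) / (1 - a * b) = 1 / c"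
  proof -
    have "(a + b) * c = 1 - a * b" using assms(4) by (simp add: algebra_simps)
    then show ?thesis using assms ab by (simp add: field_simps)
  qed
  also have "arctan (1 / c) = pi / 2 - arctan c" using arctan_inverse[of c] assms by (simp add: inverse_eq_divide)
  finally show ?thesis by simp
qed

text \<open>The boundary terms of the three integrations by parts have the common factor \<open>1 - 1 / sqrt (1 + s\<^sup>2)\<close>, and
  their angles add up to \<open>\<pi>\<close>. So they combine to \<open>\<pi>\<close> times the integral of the weight.\<close>

lemma tri_area_eq_integral:
  assumes k: "0 < k1" "0 < k2" "0 < k3" and s: "0 < s" and e: "s\<^sup>2 * (k1 * k2 + k2 * k3 + k1 * k3) = 1"
  shows "tri_area k1 k2 k3 s = integral {0..s} (\<lambda>u. (pi - 2 * (arctan (k1 * u) + arctan (k2 * u) + arctan (k3 * u))) * (u / sqrt (1 + u\<^sup>2) ^ 3))"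
proof -
  define w where "w = (\<lambda>u::real. u / sqrt (1 + u\<^sup>2) ^ 3)"
  have cw: "continuous_on {0..s} w" unfolding w_def
    by (intro continuous_intros) (auto simp: one_plus_square_neq)
  have i: "(\<lambda>u. 2 * arctan (k * u) * w u) integrable_on {0..s}" for k
    by (intro integrable_continuous_real continuous_intros cw)
  have p: "((\<lambda>u. pi * w u) has_integral pi * (1 - 1 / sqrt (1 + s\<^sup>2))) {0..s}"
    unfolding w_def using integral_tan_weight[of s] s by (intro has_integral_mult_right) simp
  have sum: "arctan (k1 * s) + arctan (k2 * s) + arctan (k3 * s) = pi / 2"
    using k s e by (intro sum_arctan_eq_half_pi) (auto simp: power2_eq_square algebra_simps)
  have "integral {0..s} (\<lambda>u. (pi - 2 * (arctan (k1 * u) + arctan (k2 * u) + arctan (k3 * u))) * w u)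
    = integral {0..s} (\<lambda>u. pi * w u - (2 * arctan (k1 * u) * w u + 2 * arctan (k2 * u) * w u + 2 * arctan (k3 * u) * w u))"
    by (simp add: algebra_simps)
  also have "\<dots> = pi * (1 - 1 / sqrt (1 + s\<^sup>2)) - (integral {0..s} (\<lambda>u. 2 * arctan (k1 * u) * w u)
      + integral {0..s} (\<lambda>u. 2 * arctan (k2 * u) * w u) + integral {0..s} (\<lambda>u. 2 * arctan (k3 * u) * w u))"
    using p i by (simp add: has_integral_iff integral_diff integral_add integrable_add)
  also have "pi * (1 - 1 / sqrt (1 + s\<^sup>2)) - (integral {0..s} (\<lambda>u. 2 * arctan (k1 * u) * w u)
      + integral {0..s} (\<lambda>u. 2 * arctan (k2 * u) * w u) + integral {0..s} (\<lambda>u. 2 * arctan (k3 * u) * w u)) = tri_area k1 k2 k3 s"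
  proof -
    have pi: "pi = 2 * arctan (k1 * s) + 2 * arctan (k2 * s) + 2 * arctan (k3 * s)" using sum by simp
    have "pi * x = 2 * arctan (k1 * s) * x + 2 * arctan (k2 * s) * x + 2 * arctan (k3 * s) * x" for x
      unfolding pi by (simp add: algebra_simps)
    then show ?thesis
      unfolding tri_area_def sector_area_by_parts[OF less_imp_le[OF s]] w_def by simp
  qed
  finally show ?thesis by (simp add: w_def)
qed

text \<open>The integrand of the larger configuration is nonnegative up to its own upper limit \<open>s'\<close>, because there
  the three angles add up to exactly \<open>\<pi>/2\<close>. Hence extending the domain from \<open>s\<close> to \<open>s'\<close> does not
  decrease the integral.\<close>

lemma tri_area_mono:
  assumes k: "0 < k1" "0 < k2" "0 < k3" and s: "0 < s" and e: "s\<^sup>2 * (k1 * k2 + k2 * k3 + k1 * k3) = 1"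
    and k': "0 < k1'" "0 < k2'" "0 < k3'" and s': "0 < s'" and e': "s'\<^sup>2 * (k1' * k2' + k2' * k3' + k1' * k3') = 1"
    and le: "k1' \<le> k1" "k2' \<le> k2" "k3' \<le> k3" and ss: "s \<le> s'"
  shows "tri_area k1 k2 k3 s \<le> tri_area k1' k2' k3' s'"
proof -
  define w where "w = (\<lambda>u::real. u / sqrt (1 + u\<^sup>2) ^ 3)"
  have cw: "continuous_on A w" for A unfolding w_def
    by (intro continuous_intros) (auto simp: one_plus_square_neq)
  have w0: "0 \<le> w u" if "0 \<le> u" for u using that by (simp add: w_def)
  define F where "F = (\<lambda>k1 k2 k3 u. (pi - 2 * (arctan (k1 * u) + arctan (k2 * u) + arctan (k3 * u))) * w u)"
  have int: "F k1 k2 k3 integrable_on {a..b}" for k1 k2 k3 a b unfolding F_def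
    by (intro integrable_continuous_real continuous_intros cw)
  have "tri_area k1 k2 k3 s = integral {0..s} (F k1 k2 k3)"
    unfolding F_def w_def by (rule tri_area_eq_integral[OF k s e])
  also have "\<dots> \<le> integral {0..s} (F k1' k2' k3')"
  proof (intro integral_le int)
    fix u assume u: "u \<in> {0..s}"
    have "arctan (k1' * u) \<le> arctan (k1 * u)" "arctan (k2' * u) \<le> arctan (k2 * u)" "arctan (k3' * u) \<le> arctan (k3 * u)"
      using u le by (auto intro!: arctan_monotone' mult_right_mono)
    then show "F k1 k2 k3 u \<le> F k1' k2' k3' u" unfolding F_def using u w0[of u] by (intro mult_right_mono) auto
  qed
  also have "\<dots> \<le> integral {0..s'} (F k1' k2' k3')"
  proof (intro integral_subset_le int ballI)
    fix u assume u: "u \<in> {0..s'}"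
    have "arctan (k1' * u) \<le> arctan (k1' * s')" "arctan (k2' * u) \<le> arctan (k2' * s')" "arctan (k3' * u) \<le> arctan (k3' * s')"
      using u k' by (auto intro!: arctan_monotone' mult_left_mono)
    moreover have "arctan (k1' * s') + arctan (k2' * s') + arctan (k3' * s') = pi / 2"
      using k' s' e' by (intro sum_arctan_eq_half_pi) (auto simp: power2_eq_square algebra_simps)
    ultimately show "0 \<le> F k1' k2' k3' u" unfolding F_def using u w0[of u] by (intro mult_nonneg_nonneg) auto
  qed (use ss in auto)
  also have "\<dots> = tri_area k1' k2' k3' s'"
    unfolding F_def w_def by (rule tri_area_eq_integral[OF k' s' e', symmetric])
  finally show ?thesis .
qed

section \<open>Arc length independent of the parametrization\<close>

text \<open>If the arc has a smooth parametrization \<open>Z\<close> with a differentiable left inverse \<open>\<Theta>\<close>, then every competing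
  \<open>C\<^sup>1\<close> parametrization \<open>\<gamma>\<close> factors as \<open>Z \<circ> \<sigma>\<close> with the injective differentiable function
  \<open>\<sigma> = \<Theta> \<circ> \<gamma>\<close>, and the lengths agree by the substitution \<open>\<sigma>\<close>. So the length defined by a definite
  description exists and is computed by \<open>Z\<close>.\<close>

lemma harc_length_param:
  fixes Z :: "real \<Rightarrow> complex" and \<Theta> :: "complex \<Rightarrow> real"
  assumes ab: "a < b"
    and Z: "\<And>t. t \<in> {a..b} \<Longrightarrow> (Z has_vector_derivative Z' t) (at t)"
    and Z'_cont: "continuous_on {a..b} Z'" and Z'_neq: "\<And>t. t \<in> {a..b} \<Longrightarrow> Z' t \<noteq> 0"
    and Zh: "\<And>t. t \<in> {a..b} \<Longrightarrow> Z t \<in> hplane"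
    and \<Theta>: "\<And>t. t \<in> {a..b} \<Longrightarrow> \<Theta> (Z t) = t"
    and \<Theta>_diff: "\<And>t. t \<in> {a..b} \<Longrightarrow> \<Theta> differentiable (at (Z t))"
  shows "harc_length (Z ` {a..b}) = integral {a..b} (\<lambda>t. 2 * norm (Z' t) / (1 - (norm (Z t))\<^sup>2))"
proof -
  define f where "f = (\<lambda>t. 2 * norm (Z' t) / (1 - (norm (Z t))\<^sup>2))"
  have Z_cont: "continuous_on {a..b} Z"
    by (meson Z continuous_at_imp_continuous_on has_vector_derivative_continuous)
  have Zn: "(norm (Z t))\<^sup>2 < 1" if "t \<in> {a..b}" for t using Zh[OF that] by (simp add: hplane_iff)
  have f_cont: "continuous_on {a..b} f" unfolding f_def
    using Zn by (intro continuous_intros Z_cont Z'_cont) force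
  have f0: "0 \<le> f t" if "t \<in> {a..b}" for t using Zn[OF that] by (simp add: f_def)
  have f_abs: "f absolutely_integrable_on {a..b}"
    using f0 by (intro nonnegative_absolutely_integrable_1 integrable_continuous_real f_cont)
  have length: "hlength \<gamma> = integral {a..b} f"
    if \<gamma>: "arc \<gamma>" "\<gamma> C1_differentiable_on {0..1}" "path_image \<gamma> = Z ` {a..b}" for \<gamma>
  proof -
    obtain \<gamma>' where \<gamma>': "\<And>t. t \<in> {0..1} \<Longrightarrow> (\<gamma> has_vector_derivative \<gamma>' t) (at t)"
      using \<gamma>(2) unfolding C1_differentiable_on_def by blast
    define \<sigma> where "\<sigma> = (\<lambda>t. \<Theta> (\<gamma> t))"
    have \<sigma>: "\<sigma> t \<in> {a..b}" "\<gamma> t = Z (\<sigma> t)" if "t \<in> {0..1}" for t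
    proof -
      have "\<gamma> t \<in> Z ` {a..b}" using that \<gamma>(3) by (auto simp: path_image_def)
      then obtain u where "u \<in> {a..b}" "\<gamma> t = Z u" by blast
      then show "\<sigma> t \<in> {a..b}" "\<gamma> t = Z (\<sigma> t)" using \<Theta> by (simp_all add: \<sigma>_def)
    qed
    have "\<exists>d. (\<sigma> has_real_derivative d) (at t)" if t: "t \<in> {0..1}" for t
    proof -
      obtain D where D: "(\<Theta> has_derivative D) (at (\<gamma> t))"
        using \<Theta>_diff[OF \<sigma>(1)[OF t]] \<sigma>(2)[OF t] by (auto simp: differentiable_def)
      have "(\<sigma> has_vector_derivative D (\<gamma>' t)) (at t)"
        using vector_derivative_diff_chain_within[OF \<gamma>'[OF t] has_derivative_at_withinI[OF D]]
        by (simp add: \<sigma>_def o_def)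
      then show ?thesis by (auto simp: has_real_derivative_iff_has_vector_derivative)
    qed
    then obtain \<sigma>' where \<sigma>': "\<And>t. t \<in> {0..1} \<Longrightarrow> (\<sigma> has_real_derivative \<sigma>' t) (at t)" by metis
    have inj: "inj_on \<sigma> {0..1}"
      using \<gamma>(1) \<sigma>(2) unfolding arc_def inj_on_def by metis
    have img: "\<sigma> ` {0..1} = {a..b}"
    proof
      show "\<sigma> ` {0..1} \<subseteq> {a..b}" using \<sigma>(1) by blast
      show "{a..b} \<subseteq> \<sigma> ` {0..1}"
      proof
        fix u assume u: "u \<in> {a..b}"
        then have "Z u \<in> path_image \<gamma>" using \<gamma>(3) by blast
        then obtain t where "t \<in> {0..1}" "Z u = \<gamma> t" by (auto simp: path_image_def)
        then show "u \<in> \<sigma> ` {0..1}" using \<Theta>[OF u] by (intro image_eqI[of _ _ t]) (auto simp: \<sigma>_def)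
      qed
    qed
    have "integral {0..1} (\<lambda>t. \<bar>\<sigma>' t\<bar> * f (\<sigma> t)) = integral {a..b} f"
      using has_absolute_integral_change_of_variables_1'[OF _ has_field_derivative_at_within[OF \<sigma>'] inj, of f "integral {a..b} f"]
      by (simp add: img f_abs)
    moreover have "hlength \<gamma> = integral {0..1} (\<lambda>t. \<bar>\<sigma>' t\<bar> * f (\<sigma> t))"
      unfolding hlength_def
    proof (rule integral_spike[of "{0, 1}"])
      fix t :: real assume "t \<in> {0..1} - {0, 1}"
      then have t: "t \<in> {0<..<1}" "t \<in> {0..1}" by auto
      have "(\<sigma> has_vector_derivative \<sigma>' t) (at t)"
        using \<sigma>'[OF t(2)] by (simp add: has_real_derivative_iff_has_vector_derivative)
      from vector_diff_chain_at[OF this Z[OF \<sigma>(1)[OF t(2)]]]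
      have "((Z \<circ> \<sigma>) has_vector_derivative \<sigma>' t *\<^sub>R Z' (\<sigma> t)) (at t)" .
      then have "(\<gamma> has_vector_derivative \<sigma>' t *\<^sub>R Z' (\<sigma> t)) (at t)"
        by (rule has_vector_derivative_transform_within_open[of _ _ _ "{0<..<1}"]) (use t \<sigma>(2) in auto)
      then have "vector_derivative \<gamma> (at t) = \<sigma>' t *\<^sub>R Z' (\<sigma> t)" by (rule vector_derivative_at)
      then show "\<bar>\<sigma>' t\<bar> * f (\<sigma> t) = 2 * norm (vector_derivative \<gamma> (at t)) / (1 - (norm (\<gamma> t))\<^sup>2)"
        using \<sigma>(2)[OF t(2)] by (simp add: f_def)
    qed simp
    ultimately show ?thesis by simp
  qed
  define \<gamma>0 where "\<gamma>0 = (\<lambda>t. Z (a + (b - a) * t))"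
  have aff: "a + (b - a) * t \<in> {a..b}" if "t \<in> {0..1}" for t
  proof -
    have "(b - a) * t \<le> b - a" using that ab mult_left_mono[of t 1 "b - a"] by simp
    moreover have "0 \<le> (b - a) * t" using that ab by simp
    ultimately show ?thesis unfolding atLeastAtMost_iff by (intro conjI) linarith+
  qed
  have d0: "(\<gamma>0 has_vector_derivative (b - a) *\<^sub>R Z' (a + (b - a) * t)) (at t)" if "t \<in> {0..1}" for t
  proof -
    have "((\<lambda>t. a + (b - a) * t) has_vector_derivative (b - a)) (at t)"
      by (auto intro!: derivative_eq_intros simp flip: has_real_derivative_iff_has_vector_derivative)
    from vector_diff_chain_at[OF this Z[OF aff[OF that]]] show ?thesis by (simp add: \<gamma>0_def o_def)
  qed
  have c1: "\<gamma>0 C1_differentiable_on {0..1}"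
    unfolding C1_differentiable_on_def
    using d0 aff by (intro exI[of _ "\<lambda>t. (b - a) *\<^sub>R Z' (a + (b - a) * t)"] conjI ballI)
      (auto intro!: continuous_intros continuous_on_compose2[OF Z'_cont])
  have inj0: "inj_on \<gamma>0 {0..1}"
  proof (rule inj_onI)
    fix x y assume xy: "x \<in> {0..1}" "y \<in> {0..1}" "\<gamma>0 x = \<gamma>0 y"
    then have "a + (b - a) * x = a + (b - a) * y"
      using \<Theta>[OF aff[OF xy(1)]] \<Theta>[OF aff[OF xy(2)]] unfolding \<gamma>0_def by metis
    then show "x = y" using ab by simp
  qed
  have arc0: "arc \<gamma>0"
    using inj0 c1 C1_differentiable_imp_continuous_on by (auto simp: arc_def path_def)
  have pi0: "path_image \<gamma>0 = Z ` {a..b}"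
  proof -
    have "(\<lambda>t. a + (b - a) * t) ` {0..1} = {a..b}"
    proof (intro equalityI subsetI)
      fix u assume "u \<in> {a..b}"
      then show "u \<in> (\<lambda>t. a + (b - a) * t) ` {0..1}"
        using ab by (intro image_eqI[of _ _ "(u - a) / (b - a)"]) (auto simp: field_simps)
    qed (use aff in auto)
    then show ?thesis unfolding path_image_def \<gamma>0_def by (metis image_image)
  qed
  have nz0: "vector_derivative \<gamma>0 (at t) \<noteq> 0" if "t \<in> {0..1}" for t
    using vector_derivative_at[OF d0[OF that]] Z'_neq[OF aff[OF that]] ab by simp
  show ?thesis unfolding harc_length_def f_def[symmetric]
  proof (rule the_equality)
    show "\<exists>\<gamma>. arc \<gamma> \<and> \<gamma> C1_differentiable_on {0..1} \<and> (\<forall>t\<in>{0..1}. vector_derivative \<gamma> (at t) \<noteq> 0) \<and>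
         path_image \<gamma> = Z ` {a..b} \<and> integral {a..b} f = hlength \<gamma>"
      using arc0 c1 nz0 pi0 length[OF arc0 c1 pi0] by metis
  qed (use length in blast)
qed

text \<open>With \<open>G = k - \<rho> + \<rho> E\<close> the half angle \<open>x = tan (\<theta> / 2) = G t\<close> turns the integrand into
  \<open>2 dt / (1 + (k\<^sup>2 - 1) t\<^sup>2)\<close>, and \<open>t = u / (sqrt (1 + u\<^sup>2) + sqrt (1 + k\<^sup>2 u\<^sup>2))\<close> turns this into
  half the integrand of \<open>ell\<close>. Both steps are done at once by \<open>\<theta> = 2 arctan (w u)\<close>. The end points match by the half
  angle formula for the arctangent.\<close>

lemma half_angle_substitution:
  fixes k \<rho> E C s :: real
  assumes k: "0 < k" and s: "0 < s" and C: "C = sqrt (1 + s\<^sup>2)" and E: "E = sqrt (1 + (k * s)\<^sup>2)"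
    and \<rho>: "\<rho> = 1 / (k * (1 + C))"
  shows "integral {- arctan (k * s)..arctan (k * s)} (\<lambda>\<theta>. 1 / (k - \<rho> + \<rho> * E * cos \<theta>)) = ell k s"
proof -
  define G where "G = k - \<rho> + \<rho> * E"
  have Cp: "1 < C" "C\<^sup>2 = 1 + s\<^sup>2" unfolding C using s by auto
  have Ep: "1 < E" "E\<^sup>2 = 1 + (k * s)\<^sup>2" unfolding E using s k by auto
  have \<rho>p: "0 < \<rho>" "\<rho> * k * (1 + C) = 1" unfolding \<rho> using k Cp by auto
  have "G = k + \<rho> * (E - 1)" unfolding G_def by algebra
  then have Gp: "0 < G" using k \<rho>p(1) Ep(1) by (simp add: add_pos_pos)
  \<comment> \<open>by the relation \<open>1 - (\<rho> k s)\<^sup>2 = 2 \<rho> k\<close>, which comes from \<open>C\<^sup>2 = 1 + s\<^sup>2\<close>\<close>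
  have Gk: "G * (k - \<rho> - \<rho> * E) = k\<^sup>2 - 1"
  proof -
    have "G * (k - \<rho> - \<rho> * E) = k\<^sup>2 - 2 * \<rho> * k + \<rho>\<^sup>2 - \<rho>\<^sup>2 * E\<^sup>2" unfolding G_def by algebra
    also have "\<dots> = k\<^sup>2 - 2 * \<rho> * k - \<rho>\<^sup>2 * k\<^sup>2 * s\<^sup>2" unfolding Ep by algebra
    also have "\<dots> = k\<^sup>2 - (\<rho> * k) * (2 + \<rho> * k * (C\<^sup>2 - 1))" unfolding Cp(2) by algebra
    also have "2 + \<rho> * k * (C\<^sup>2 - 1) = 1 + C" using \<rho>p(2) by algebra
    finally show ?thesis using \<rho>p(2) by simp
  qed
  have Gs: "G * s / (C + E) = k * s / (1 + E)"
  proof -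
    have "G * (k * (1 + C)) = k\<^sup>2 * (1 + C) + E - 1" unfolding G_def using \<rho>p(2) by algebra
    then have "(k * (1 + C)) * (G * (1 + E)) = (k\<^sup>2 * (1 + C) + E - 1) * (1 + E)" by algebra
    also have "\<dots> = (k * (1 + C)) * (k * (C + E))" using Cp(2) Ep(2) by algebra
    finally have "G * (1 + E) = k * (C + E)" using k Cp by simp
    then show ?thesis using Cp Ep by (simp add: frac_eq_eq mult_ac)
  qed
  define w where "w = (\<lambda>u. G * (u / (sqrt (1 + u\<^sup>2) + sqrt (1 + (k * u)\<^sup>2))))"
  define f where "f = (\<lambda>\<theta>. 1 / (k - \<rho> + \<rho> * E * cos \<theta>))"
  have key: "k - \<rho> + \<rho> * E * cos (2 * arctan x) = (G + (k - \<rho> - \<rho> * E) * x\<^sup>2) / (1 + x\<^sup>2)" for x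
  proof -
    have q: "1 + x\<^sup>2 \<noteq> 0" by (rule one_plus_square_neq)
    have "cos (2 * arctan x) = 2 * (cos (arctan x))\<^sup>2 - 1" by (rule cos_double_cos)
    also have "(cos (arctan x))\<^sup>2 = 1 / (1 + x\<^sup>2)" using one_plus_square_pos[of x] by (simp add: cos_arctan power_divide)
    finally have c: "cos (2 * arctan x) = (1 - x\<^sup>2) / (1 + x\<^sup>2)" using q by (simp add: field_simps)
    show ?thesis unfolding c G_def using q by (simp add: field_simps)
  qed
  have w_deriv: "(w has_real_derivative G * (1 / (a * b * (a + b)))) (at u within A)"
    and w_sq: "G + (k - \<rho> - \<rho> * E) * (w u)\<^sup>2 = G * (2 * b / (a + b))"
    if "a = sqrt (1 + u\<^sup>2)" "b = sqrt (1 + (k * u)\<^sup>2)" for a b u A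
  proof -
    have ab: "0 < a" "0 < b" "a\<^sup>2 = 1 + u\<^sup>2" "b\<^sup>2 = 1 + (k * u)\<^sup>2"
      using that one_plus_square_pos[of u] one_plus_square_pos[of "k * u"] by auto
    have da: "((\<lambda>u. sqrt (1 + u\<^sup>2)) has_real_derivative u / a) (at u within A)"
      using one_plus_square_pos[of u] unfolding that by (auto intro!: derivative_eq_intros simp: field_simps)
    have db: "((\<lambda>u. sqrt (1 + (k * u)\<^sup>2)) has_real_derivative k\<^sup>2 * u / b) (at u within A)"
      using one_plus_square_pos[of "k * u"] unfolding that
      by (auto intro!: derivative_eq_intros simp: field_simps power2_eq_square)
    have "a + b \<noteq> 0" using ab by simp
    then have "((\<lambda>u. u / (sqrt (1 + u\<^sup>2) + sqrt (1 + (k * u)\<^sup>2))) has_real_derivative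
       (1 * (a + b) - u * (u / a + k\<^sup>2 * u / b)) / ((a + b) * (a + b))) (at u within A)"
      using DERIV_divide[OF DERIV_ident DERIV_add[OF da db]] unfolding that by simp
    moreover have "(1 * (a + b) - u * (u / a + k\<^sup>2 * u / b)) / ((a + b) * (a + b)) = 1 / (a * b * (a + b))"
    proof -
      have "1 * (a + b) - u * (u / a + k\<^sup>2 * u / b) = (a\<^sup>2 - u\<^sup>2) / a + (b\<^sup>2 - k\<^sup>2 * u\<^sup>2) / b"
        using ab(1,2) by (simp add: field_simps power2_eq_square)
      also have "\<dots> = 1 / a + 1 / b" unfolding ab by (simp add: power_mult_distrib)
      also have "\<dots> = (a + b) / (a * b)" using ab(1,2) by (simp add: field_simps)
      finally show ?thesis using ab(1,2) by simp
    qed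
    ultimately have "((\<lambda>u. u / (sqrt (1 + u\<^sup>2) + sqrt (1 + (k * u)\<^sup>2))) has_real_derivative 1 / (a * b * (a + b))) (at u within A)"
      by (simp only:)
    then show "(w has_real_derivative G * (1 / (a * b * (a + b)))) (at u within A)"
      unfolding w_def by (rule DERIV_cmult)
    have "G + (k - \<rho> - \<rho> * E) * (w u)\<^sup>2 = G * (1 + (G * (k - \<rho> - \<rho> * E)) * (u / (a + b))\<^sup>2)"
      unfolding w_def that[symmetric] by algebra
    also have "1 + (G * (k - \<rho> - \<rho> * E)) * (u / (a + b))\<^sup>2 = ((a + b)\<^sup>2 + (k\<^sup>2 - 1) * u\<^sup>2) / (a + b)\<^sup>2"
      unfolding Gk using ab(1,2) by (simp add: power_divide add_divide_distrib)
    also have "(a + b)\<^sup>2 + (k\<^sup>2 - 1) * u\<^sup>2 = 2 * b * (a + b)" using ab(3,4) by algebra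
    also have "2 * b * (a + b) / (a + b)\<^sup>2 = 2 * b / (a + b)" using ab(1,2) by (simp add: power2_eq_square)
    finally show "G + (k - \<rho> - \<rho> * E) * (w u)\<^sup>2 = G * (2 * b / (a + b))" .
  qed
  have fpos: "0 < k - \<rho> + \<rho> * E * cos \<theta>" if "\<theta> \<in> {- arctan (k * s)..arctan (k * s)}" for \<theta>
  proof -
    have "cos (arctan (k * s)) \<le> cos \<bar>\<theta>\<bar>"
      using that arctan_ubound[of "k * s"] by (intro cos_monotone_0_pi_le) auto
    then have "1 / E \<le> cos \<theta>" by (simp add: cos_arctan E)
    then have "\<rho> * E * (1 / E) \<le> \<rho> * E * cos \<theta>" using \<rho>p Ep by (intro mult_left_mono) auto
    then have "\<rho> \<le> \<rho> * E * cos \<theta>" using Ep by simp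
    then show ?thesis using k by linarith
  qed
  have f_cont: "continuous_on {- arctan (k * s)..arctan (k * s)} f"
    unfolding f_def using fpos by (intro continuous_intros) force
  have ws: "2 * arctan (w s) = arctan (k * s)" "2 * arctan (w 0) = 0"
  proof -
    have "w s = k * s / (1 + sqrt (1 + (k * s)\<^sup>2))" unfolding w_def using Gs by (simp flip: C E)
    then show "2 * arctan (w s) = arctan (k * s)" using arctan_half[of "k * s"] by simp
  qed (simp add: w_def)
  have w_mono: "w x \<le> w y" if "x \<le> y" for x y
  proof (rule DERIV_nonneg_imp_nondecreasing[OF that])
    fix u
    show "\<exists>d. (w has_real_derivative d) (at u) \<and> 0 \<le> d"
    proof (intro exI conjI)
      show "(w has_real_derivative G * (1 / (sqrt (1 + u\<^sup>2) * sqrt (1 + (k * u)\<^sup>2) * (sqrt (1 + u\<^sup>2) + sqrt (1 + (k * u)\<^sup>2))))) (at u)"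
        by (rule w_deriv[OF refl refl])
    qed (use Gp in \<open>auto intro!: mult_nonneg_nonneg divide_nonneg_nonneg add_nonneg_nonneg\<close>)
  qed
  have sub: "((\<lambda>u. (1 / ((1 + (k * u)\<^sup>2) * sqrt (1 + u\<^sup>2)))) has_integral integral {2 * arctan (w 0)..2 * arctan (w s)} f) {0..s}"
  proof -
    have "((\<lambda>u. (2 * (G * (1 / (sqrt (1 + u\<^sup>2) * sqrt (1 + (k * u)\<^sup>2) * (sqrt (1 + u\<^sup>2) + sqrt (1 + (k * u)\<^sup>2)))) / (1 + (w u)\<^sup>2))) *\<^sub>R f (2 * arctan (w u)))
       has_integral integral {2 * arctan (w 0)..2 * arctan (w s)} f) {0..s}"
    proof (rule has_integral_substitution[where c = "- arctan (k * s)" and d = "arctan (k * s)"])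
      show "2 * arctan (w 0) \<le> 2 * arctan (w s)" using w_mono[of 0 s] s by (simp add: arctan_monotone')
      show "(\<lambda>u. 2 * arctan (w u)) ` {0..s} \<subseteq> {- arctan (k * s)..arctan (k * s)}"
      proof
        fix y assume "y \<in> (\<lambda>u. 2 * arctan (w u)) ` {0..s}"
        then obtain u where u: "u \<in> {0..s}" "y = 2 * arctan (w u)" by blast
        have "2 * arctan (w 0) \<le> y" "y \<le> 2 * arctan (w s)" using u w_mono by (auto intro!: arctan_monotone')
        moreover have "0 \<le> arctan (k * s)" using k s by simp
        ultimately show "y \<in> {- arctan (k * s)..arctan (k * s)}" unfolding ws by simp
      qed
      fix u assume "u \<in> {0..s}"
      show "((\<lambda>u. 2 * arctan (w u)) has_real_derivative
          2 * (G * (1 / (sqrt (1 + u\<^sup>2) * sqrt (1 + (k * u)\<^sup>2) * (sqrt (1 + u\<^sup>2) + sqrt (1 + (k * u)\<^sup>2)))) / (1 + (w u)\<^sup>2)))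
          (at u within {0..s})"
        by (auto intro!: derivative_eq_intros w_deriv[OF refl refl] simp: divide_inverse)
    qed (use s f_cont in auto)
    moreover have "(2 * (G * (1 / (a * b * (a + b))) / (1 + (w u)\<^sup>2))) *\<^sub>R f (2 * arctan (w u)) = 1 / ((1 + (k * u)\<^sup>2) * a)"
      if ab: "a = sqrt (1 + u\<^sup>2)" "b = sqrt (1 + (k * u)\<^sup>2)" for a b u
    proof -
      have p: "0 < a" "0 < b" "b\<^sup>2 = 1 + (k * u)\<^sup>2"
        using ab one_plus_square_pos[of u] one_plus_square_pos[of "k * u"] by auto
      have "f (2 * arctan (w u)) = 1 / ((G * (2 * b / (a + b))) / (1 + (w u)\<^sup>2))"
        unfolding f_def key w_sq[OF ab] ..
      also have "(2 * (G * (1 / (a * b * (a + b))) / (1 + (w u)\<^sup>2))) *\<^sub>R \<dots> = 1 / (b\<^sup>2 * a)"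
      proof -
        have "(2 * (G * (1 / (a * b * q)) / P)) *\<^sub>R (1 / ((G * (2 * b / q)) / P)) = 1 / (b\<^sup>2 * a)"
          if "0 < q" "0 < P" for q P :: real
          using that p(1,2) Gp by (simp add: field_simps power2_eq_square)
        then show ?thesis using p one_plus_square_pos[of "w u"] by simp
      qed
      finally show ?thesis unfolding p(3) .
    qed
    ultimately show ?thesis by simp
  qed
  have "ell k s = 2 * integral {0..arctan (k * s)} f"
  proof -
    have "((\<lambda>u. 2 * (1 / ((1 + (k * u)\<^sup>2) * sqrt (1 + u\<^sup>2)))) has_integral 2 * integral {0..arctan (k * s)} f) {0..s}"
      using has_integral_mult_right[OF sub, of 2] unfolding ws .
    then show ?thesis unfolding ell_def by (simp add: has_integral_iff)
  qed
  moreover have "integral {- arctan (k * s)..arctan (k * s)} f = integral {- arctan (k * s)..0} f + integral {0..arctan (k * s)} f"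
    using k s by (intro Henstock_Kurzweil_Integration.integral_combine[symmetric] integrable_continuous_real f_cont) auto
  moreover have "integral {- arctan (k * s)..0} f = integral {0..arctan (k * s)} f"
    using Henstock_Kurzweil_Integration.integral_reflect_real[of "arctan (k * s)" 0 f] by (simp add: f_def)
  ultimately show ?thesis unfolding f_def by simp
qed

section \<open>The sub-arc of one generalized circle\<close>

text \<open>A curve in normal position is the Euclidean circle of radius \<open>\<rho> = 1 / (k (1 + cosh r))\<close> with centre \<open>\<rho> b\<close>.
  It is parametrized by the angle at its Euclidean centre, measured from the point closest to \<open>0\<close>.\<close>

definition arc_pt :: "real \<Rightarrow> real \<Rightarrow> complex \<Rightarrow> real \<Rightarrow> complex" where
  "arc_pt k r b \<theta> = of_real (1 / (k * (1 + cosh r))) * (of_real (norm b) - cis (- \<theta>)) * (b / of_real (norm b))"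

lemma has_vector_derivative_cis: "((\<lambda>\<theta>. cis (- \<theta>)) has_vector_derivative - \<i> * cis (- \<theta>)) (at \<theta> within A)"
proof -
  have "((\<lambda>\<theta>. Complex (cos (- \<theta>)) (sin (- \<theta>))) has_vector_derivative - \<i> * cis (- \<theta>)) (at \<theta> within A)"
    unfolding has_vector_derivative_complex_iff
    by (auto intro!: derivative_eq_intros)
  then show ?thesis by (simp add: cis.ctr)
qed

text \<open>One generalized disk perpendicular to the dual circle of radius \<open>r\<close> about \<open>0\<close>. The condition on \<open>b\<close> is
  the normalization of a cap with \<open>p = k cosh r\<close>.\<close>

locale dual_arc =
  fixes k r :: real and b :: complex
  assumes k: "0 < k" and r: "0 < r" and b: "(norm b)\<^sup>2 = 1 + (k * sinh r)\<^sup>2"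
begin

abbreviation "E \<equiv> norm b"
abbreviation "K \<equiv> k * sinh r"
abbreviation "R \<equiv> dual_rad r"
definition "\<rho> = 1 / (k * (1 + cosh r))"
abbreviation "Z \<equiv> arc_pt k r b"
abbreviation "dens \<theta> \<equiv> k - \<rho> + \<rho> * E * cos \<theta>"
definition "\<theta>0 = arctan K"

text \<open>The Euclidean data of the circle: \<open>\<rho> K = R\<close> says that \<open>K\<close> is the cotangent of the half angle under which it is seen
  from \<open>0\<close>, and \<open>R\<^sup>2 = \<rho>\<^sup>2 (E\<^sup>2 - 1)\<close> that it is orthogonal to the circle of radius \<open>R\<close>.\<close>

lemma basics: "0 < K" "1 < E" "0 < \<rho>" "\<rho> * (k * (1 + cosh r)) = 1" "\<rho> * K = R" "R\<^sup>2 = \<rho>\<^sup>2 * (E\<^sup>2 - 1)"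
  "1 - R\<^sup>2 = 2 * \<rho> * k" "\<rho>\<^sup>2 * (E\<^sup>2 - 1) = \<rho> * (k * cosh r - k)"
proof -
  note R = dual_rad[OF r]
  have s: "0 < sinh r" using r by simp
  show K: "0 < K" using k s by simp
  then have "0 < K\<^sup>2" by (rule zero_less_power)
  then have "1\<^sup>2 < E\<^sup>2" unfolding b power_one by linarith
  then show "1 < E" by (rule power2_less_imp_less) simp
  have c: "0 < 1 + cosh r" by (simp add: add_pos_pos)
  then show p: "0 < \<rho>" "\<rho> * (k * (1 + cosh r)) = 1" using k by (auto simp: \<rho>_def)
  have "\<rho> * K = \<rho> * k * ((1 + cosh r) * R)" unfolding R(3) by simp
  also have "\<dots> = (\<rho> * (k * (1 + cosh r))) * R" by (simp only: mult_ac)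
  finally show pK: "\<rho> * K = R" using p by simp
  show R2: "R\<^sup>2 = \<rho>\<^sup>2 * (E\<^sup>2 - 1)" unfolding b pK[symmetric] by (simp add: power_mult_distrib)
  have "(1 + cosh r) * (1 - R\<^sup>2) = 2" using R(4) by (simp add: algebra_simps)
  also have "\<dots> = 2 * (\<rho> * (k * (1 + cosh r)))" using p(2) by simp
  also have "\<dots> = (1 + cosh r) * (2 * \<rho> * k)" by (simp only: mult_ac)
  finally show "1 - R\<^sup>2 = 2 * \<rho> * k" using c by simp
  have "\<rho> * (k * cosh r - k) = (\<rho> * k) * ((1 + cosh r) * R\<^sup>2)" unfolding R(4) by (simp add: algebra_simps)
  also have "\<dots> = (\<rho> * (k * (1 + cosh r))) * R\<^sup>2" by (simp only: mult_ac)
  finally show "\<rho>\<^sup>2 * (E\<^sup>2 - 1) = \<rho> * (k * cosh r - k)" using p R2 by simp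
qed

lemma b0: "b \<noteq> 0" using basics(2) by auto

lemma \<theta>0: "0 < \<theta>0" "\<theta>0 < pi / 2" "cos \<theta>0 = 1 / E"
proof -
  show "0 < \<theta>0" "\<theta>0 < pi / 2" using basics(1) arctan_ubound[of K] by (simp_all add: \<theta>0_def)
  have "sqrt (E\<^sup>2) = sqrt (1 + K\<^sup>2)" using b by simp
  then have "E = sqrt (1 + K\<^sup>2)" by simp
  then show "cos \<theta>0 = 1 / E" by (simp add: \<theta>0_def cos_arctan)
qed

lemma cos_ge_iff: "\<bar>\<theta>\<bar> \<le> pi \<Longrightarrow> 1 / E \<le> cos \<theta> \<longleftrightarrow> \<bar>\<theta>\<bar> \<le> \<theta>0"
  "\<bar>\<theta>\<bar> \<le> pi \<Longrightarrow> 1 / E < cos \<theta> \<longleftrightarrow> \<bar>\<theta>\<bar> < \<theta>0"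
  using cos_mono_le_eq[of "\<theta>0" "\<bar>\<theta>\<bar>"] cos_mono_less_eq[of "\<theta>0" "\<bar>\<theta>\<bar>"] \<theta>0 by auto

lemma Z_def': "Z \<theta> = of_real \<rho> * (of_real E - cis (- \<theta>)) * (b / of_real E)"
  by (simp add: arc_pt_def \<rho>_def)

lemma norm_dir: "norm (b / of_real E) = 1" using b0 by (simp add: norm_divide)

lemma norm_Z: "(norm (Z \<theta>))\<^sup>2 = \<rho>\<^sup>2 * (E\<^sup>2 + 1 - 2 * E * cos \<theta>)"
proof -
  have "(norm (Z \<theta>))\<^sup>2 = \<rho>\<^sup>2 * (norm (of_real E - cis (- \<theta>)))\<^sup>2"
    unfolding Z_def' norm_mult norm_dir by (simp add: power_mult_distrib)
  also have "(norm (of_real x - cis (- \<theta>)))\<^sup>2 = x\<^sup>2 + ((cos \<theta>)\<^sup>2 + (sin \<theta>)\<^sup>2) - 2 * x * cos \<theta>" for x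
    unfolding cmod_power2 by (simp add: power2_eq_square algebra_simps)
  finally show ?thesis by simp
qed

text \<open>The hyperbolic line element \<open>2 \<rho> d\<theta> / (1 - \<bar>Z\<bar>\<^sup>2)\<close> of the arc is therefore \<open>d\<theta> / dens \<theta>\<close>.\<close>

lemma one_minus_norm_Z: "1 - (norm (Z \<theta>))\<^sup>2 = 2 * \<rho> * dens \<theta>"
  unfolding norm_Z using basics(6,7) by algebra

lemma inner_b_Z: "b \<bullet> Z \<theta> = \<rho> * E * (E - cos \<theta>)"
proof -
  have "Z \<theta> = (\<rho> / E) *\<^sub>R ((of_real E - cis (- \<theta>)) * b)"
    unfolding Z_def' by (simp add: scaleR_conv_of_real)
  then have "b \<bullet> Z \<theta> = \<rho> / E * (b \<bullet> ((of_real E - cis (- \<theta>)) * b))"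
    by (simp only: inner_scaleR_right)
  also have "b \<bullet> ((of_real x - cis (- \<theta>)) * b) = (x - cos \<theta>) * E\<^sup>2" for x
    unfolding cmod_power2 by (simp add: inner_complex_def power2_eq_square algebra_simps)
  finally show ?thesis using b0 by (simp add: power2_eq_square)
qed

lemma norm_Z_le_iff:
  assumes "\<bar>\<theta>\<bar> \<le> pi" shows "norm (Z \<theta>) \<le> R \<longleftrightarrow> \<bar>\<theta>\<bar> \<le> \<theta>0" "norm (Z \<theta>) < R \<longleftrightarrow> \<bar>\<theta>\<bar> < \<theta>0"
proof -
  have E: "0 < E" using basics(2) by linarith
  have R: "0 < R" using dual_rad[OF r] by simp
  have "norm (Z \<theta>) \<le> R \<longleftrightarrow> (norm (Z \<theta>))\<^sup>2 \<le> R\<^sup>2" using R by (simp add: abs_le_square_iff[symmetric])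
  also have "\<dots> \<longleftrightarrow> E\<^sup>2 + 1 - 2 * E * cos \<theta> \<le> E\<^sup>2 - 1" unfolding norm_Z basics(6) using basics(3) by simp
  also have "\<dots> \<longleftrightarrow> 1 / E \<le> cos \<theta>" using E by (simp add: field_simps)
  finally show "norm (Z \<theta>) \<le> R \<longleftrightarrow> \<bar>\<theta>\<bar> \<le> \<theta>0" using cos_ge_iff(1)[OF assms] by simp
  have "norm (Z \<theta>) < R \<longleftrightarrow> (norm (Z \<theta>))\<^sup>2 < R\<^sup>2"
    using R abs_le_square_iff[of R "norm (Z \<theta>)"] by (metis abs_norm_cancel abs_of_pos not_le)
  also have "\<dots> \<longleftrightarrow> E\<^sup>2 + 1 - 2 * E * cos \<theta> < E\<^sup>2 - 1" unfolding norm_Z basics(6) using basics(3) by simp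
  also have "\<dots> \<longleftrightarrow> 1 / E < cos \<theta>" using E by (simp add: field_simps)
  finally show "norm (Z \<theta>) < R \<longleftrightarrow> \<bar>\<theta>\<bar> < \<theta>0" using cos_ge_iff(2)[OF assms] by simp
qed

lemma rim_iff: "w \<in> cap_rim k (k * cosh r) b \<longleftrightarrow> w \<in> hplane \<and> norm (w - of_real \<rho> * b) = \<rho>"
proof -
  have "\<rho> * ((k * cosh r + k) * (norm w)\<^sup>2 - 2 * (b \<bullet> w) + (k * cosh r - k))
     = (norm (w - of_real \<rho> * b))\<^sup>2 - \<rho>\<^sup>2"
  proof -
    have "\<rho> * ((k * cosh r + k) * (norm w)\<^sup>2 - 2 * (b \<bullet> w) + (k * cosh r - k)) =
       (\<rho> * (k * (1 + cosh r))) * (norm w)\<^sup>2 - 2 * \<rho> * (b \<bullet> w) + \<rho> * (k * cosh r - k)"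
      by (simp add: algebra_simps)
    also have "\<dots> = (norm w)\<^sup>2 - 2 * \<rho> * (b \<bullet> w) + \<rho>\<^sup>2 * E\<^sup>2 - \<rho>\<^sup>2"
      unfolding basics(4) basics(8)[symmetric] by (simp add: algebra_simps)
    also have "(norm w)\<^sup>2 - 2 * \<rho> * (b \<bullet> w) + \<rho>\<^sup>2 * E\<^sup>2 = (norm (w - of_real \<rho> * b))\<^sup>2"
      unfolding cmod_power2 by (simp add: inner_complex_def power2_eq_square algebra_simps)
    finally show ?thesis .
  qed
  moreover have "(norm (w - of_real \<rho> * b))\<^sup>2 - \<rho>\<^sup>2 = 0 \<longleftrightarrow> norm (w - of_real \<rho> * b) = \<rho>"
    using basics(3) by simp
  ultimately show ?thesis unfolding cap_rim_iff using basics(3) by (metis less_irrefl mult_eq_0_iff)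
qed

lemma circle_point:
  assumes "norm (w - of_real \<rho> * b) = \<rho>"
  obtains \<theta> where "\<bar>\<theta>\<bar> \<le> pi" "w = Z \<theta>"
proof -
  define \<zeta> where "\<zeta> = of_real E - w / (of_real \<rho> * (b / of_real E))"
  have \<rho>0: "complex_of_real \<rho> \<noteq> 0" using basics(3) by simp
  have E0: "complex_of_real E \<noteq> 0" using basics(2) by auto
  have w: "w = of_real \<rho> * (of_real E - \<zeta>) * (b / of_real E)"
    unfolding \<zeta>_def using b0 \<rho>0 E0 by simp
  have "w - of_real \<rho> * b = - (of_real \<rho> * \<zeta> * (b / of_real E))"
    unfolding w using E0 by (simp add: field_simps)
  then have "norm (of_real \<rho> * \<zeta> * (b / of_real E)) = \<rho>" using assms by simp
  then have "norm \<zeta> = 1" unfolding norm_mult norm_dir using basics(3) by simp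
  moreover from this have "\<zeta> \<noteq> 0" by auto
  ultimately have "\<zeta> = cis (Arg \<zeta>)" using cis_Arg[of \<zeta>] by (simp add: sgn_eq)
  then have "w = Z (- Arg \<zeta>)" unfolding Z_def' using w by simp
  moreover have "\<bar>- Arg \<zeta>\<bar> \<le> pi" using Arg_bounded[of \<zeta>] by auto
  ultimately show thesis using that by blast
qed

lemma Z_on_circle: "norm (Z \<theta> - of_real \<rho> * b) = \<rho>"
proof -
  have E0: "complex_of_real E \<noteq> 0" using basics(2) by auto
  have "Z \<theta> - of_real \<rho> * b = - (of_real \<rho> * cis (- \<theta>) * (b / of_real E))"
    unfolding Z_def' using E0 by (simp add: field_simps)
  then have "norm (Z \<theta> - of_real \<rho> * b) = norm (of_real \<rho> * cis (- \<theta>) * (b / of_real E))" by (metis norm_minus_cancel)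
  then show ?thesis unfolding norm_mult norm_dir using basics(3) by simp
qed

lemma Z_in_hplane: "\<bar>\<theta>\<bar> \<le> \<theta>0 \<Longrightarrow> Z \<theta> \<in> hplane"
  using norm_Z_le_iff(1)[of \<theta>] \<theta>0 dual_rad[OF r] by (simp add: hplane_def)

lemma rim_inside_dual_eq: "cap_rim k (k * cosh r) b \<inter> cball 0 R = Z ` {- \<theta>0..\<theta>0}"
proof (intro equalityI subsetI)
  fix w assume w: "w \<in> cap_rim k (k * cosh r) b \<inter> cball 0 R"
  then obtain \<theta> where \<theta>: "\<bar>\<theta>\<bar> \<le> pi" "w = Z \<theta>" using circle_point rim_iff by blast
  then have "\<bar>\<theta>\<bar> \<le> \<theta>0" using w norm_Z_le_iff(1) by simp
  then show "w \<in> Z ` {- \<theta>0..\<theta>0}" using \<theta> by (auto simp: abs_le_iff)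
next
  fix w assume "w \<in> Z ` {- \<theta>0..\<theta>0}"
  then obtain \<theta> where "\<theta> \<in> {- \<theta>0..\<theta>0}" "w = Z \<theta>" by blast
  then have \<theta>: "\<bar>\<theta>\<bar> \<le> \<theta>0" "w = Z \<theta>" by auto
  then show "w \<in> cap_rim k (k * cosh r) b \<inter> cball 0 R"
    using Z_in_hplane Z_on_circle rim_iff norm_Z_le_iff(1)[of \<theta>] \<theta>0 by simp
qed

definition "Z' \<theta> = of_real \<rho> * (\<i> * cis (- \<theta>)) * (b / of_real E)"

lemma Z_deriv: "(Z has_vector_derivative Z' \<theta>) (at \<theta> within A)"
proof -
  have "((\<lambda>\<theta>. of_real \<rho> * (of_real E - cis (- \<theta>)) * (b / of_real E)) has_vector_derivative
     of_real \<rho> * (0 - (- \<i> * cis (- \<theta>))) * (b / of_real E)) (at \<theta> within A)"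
    by (intro derivative_intros has_vector_derivative_cis has_vector_derivative_mult_left has_vector_derivative_mult_right)
  then show ?thesis unfolding Z_def'[abs_def] Z'_def by simp
qed

lemma norm_Z': "norm (Z' \<theta>) = \<rho>"
  unfolding Z'_def norm_mult norm_dir using basics(3) by simp

text \<open>The angle as a function on a neighbourhood of the arc; it serves as the left inverse of the parametrization.\<close>

definition "ang w = - Im (Ln (of_real E - w / (of_real \<rho> * (b / of_real E))))"

lemma chart_Z: "of_real E - Z \<theta> / (of_real \<rho> * (b / of_real E)) = cis (- \<theta>)"
proof -
  have "complex_of_real \<rho> \<noteq> 0" "complex_of_real E \<noteq> 0" using basics(2,3) by auto
  then show ?thesis unfolding Z_def' using b0 by simp
qed

lemma ang_Z:
  assumes "\<bar>\<theta>\<bar> \<le> \<theta>0"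
  shows "ang (Z \<theta>) = \<theta>"
proof -
  have "Ln (cis (- \<theta>)) = \<i> * of_real (- \<theta>)"
    unfolding cis_conv_exp using assms \<theta>0 by (intro Ln_exp) auto
  then show ?thesis unfolding ang_def chart_Z by simp
qed

lemma ang_differentiable:
  assumes "\<bar>\<theta>\<bar> \<le> \<theta>0"
  shows "ang differentiable (at (Z \<theta>))"
proof -
  have "0 < cos \<theta>" using assms \<theta>0 by (intro cos_gt_zero_pi) auto
  then have n: "cis (- \<theta>) \<notin> \<real>\<^sub>\<le>\<^sub>0" by (auto simp: complex_nonpos_Reals_iff)
  have nz: "of_real \<rho> * (b / of_real E) \<noteq> 0" using b0 basics(3) by simp
  have "((\<lambda>w. of_real E - w / (of_real \<rho> * (b / of_real E))) has_field_derivative - 1 / (of_real \<rho> * (b / of_real E))) (at (Z \<theta>))"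
    using b0 basics(3) by (auto intro!: derivative_eq_intros)
  from DERIV_chain2[OF has_field_derivative_Ln[of "of_real E - Z \<theta> / (of_real \<rho> * (b / of_real E))"] this]
  have "(\<lambda>w. Ln (of_real E - w / (of_real \<rho> * (b / of_real E)))) field_differentiable (at (Z \<theta>))"
    using n unfolding chart_Z field_differentiable_def by blast
  then have "(\<lambda>w. Ln (of_real E - w / (of_real \<rho> * (b / of_real E)))) differentiable (at (Z \<theta>))"
    by (rule field_differentiable_imp_differentiable)
  then show ?thesis unfolding ang_def[abs_def] differentiable_def
    using bounded_linear.has_derivative[OF bounded_linear_Im] has_derivative_minus by metis
qed
end

lemma mob_deriv:
  assumes "c \<in> hplane" "norm e = 1" "w \<in> hplane"
  shows "(mob e c has_field_derivative e * of_real (1 - (norm c)\<^sup>2) / (1 + cnj c * e * w)\<^sup>2) (at w)"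
proof -
  have "norm w \<le> 1" using assms(3) by (simp add: hplane_def)
  note D = mob_denom[OF assms(1,2) this]
  have "((\<lambda>w. (e * w + c) / (1 + cnj c * e * w)) has_field_derivative
     (e * (1 + cnj c * e * w) - (e * w + c) * (cnj c * e)) / ((1 + cnj c * e * w) * (1 + cnj c * e * w))) (at w)"
    using D by (auto intro!: derivative_eq_intros)
  moreover have "e * (1 + cnj c * e * w) - (e * w + c) * (cnj c * e) = e * of_real (1 - (norm c)\<^sup>2)"
    unfolding of_real_diff complex_norm_square by (simp add: algebra_simps)
  ultimately show ?thesis unfolding mob_def[abs_def] power2_eq_square by simp
qed

text \<open>The infinitesimal form of the invariance of the hyperbolic metric; the lengths and the areas of images under
  \<open>mob\<close> are both computed from it.\<close>

lemma mob_conformal_factor: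
  assumes "c \<in> hplane" "norm e = 1" "w \<in> hplane"
  shows "norm (e * of_real (1 - (norm c)\<^sup>2) / (1 + cnj c * e * w)\<^sup>2) / (1 - (norm (mob e c w))\<^sup>2) = 1 / (1 - (norm w)\<^sup>2)"
proof -
  have w: "norm w \<le> 1" using assms(3) by (simp add: hplane_def)
  note D = mob_denom[OF assms(1,2) w]
  have c: "0 < 1 - (norm c)\<^sup>2" "0 < 1 - (norm w)\<^sup>2" using assms by (auto simp: hplane_iff)
  have "norm (e * of_real (1 - (norm c)\<^sup>2) / (1 + cnj c * e * w)\<^sup>2) = (1 - (norm c)\<^sup>2) / (norm (1 + cnj c * e * w))\<^sup>2"
    using c assms(2) by (simp only: norm_mult norm_divide norm_power norm_of_real mult_1 abs_of_pos)
  then show ?thesis unfolding mob_norm[OF assms(1,2) w] using c D by simp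
qed

lemma mob_inv_differentiable:
  assumes "c \<in> hplane" "norm e = 1" "w \<in> hplane"
  shows "mob_inv e c differentiable (at w)"
  unfolding mob_inv_def
  using mob_deriv[OF mob_inv_params(1)[OF assms(1,2)] mob_inv_params(2)[OF assms(2)] assms(3)]
  by (meson field_differentiable_def field_differentiable_imp_differentiable)

context dual_arc begin

lemma integral_dens: "integral {- \<theta>0..\<theta>0} (\<lambda>\<theta>. 1 / dens \<theta>) = ell k (sinh r)"
  unfolding \<theta>0_def
proof (rule half_angle_substitution[where C = "cosh r"])
  show "cosh r = sqrt (1 + (sinh r)\<^sup>2)" using cosh_square_eq[of r] cosh_real_nonneg[of r] by (metis add.commute real_sqrt_abs abs_of_nonneg)
  show "E = sqrt (1 + (k * sinh r)\<^sup>2)" using b by (metis norm_ge_zero real_sqrt_abs abs_of_nonneg)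
qed (use k r in \<open>simp_all add: \<rho>_def\<close>)

lemma harc_length_mob_arc:
  assumes c: "c \<in> hplane" and e: "norm e = 1"
  shows "harc_length (mob e c ` (cap_rim k (k * cosh r) b \<inter> cball 0 R)) = ell k (sinh r)"
proof -
  define \<mu>' where "\<mu>' = (\<lambda>w. e * of_real (1 - (norm c)\<^sup>2) / (1 + cnj c * e * w)\<^sup>2)"
  have Zh: "Z \<theta> \<in> hplane" if "\<theta> \<in> {- \<theta>0..\<theta>0}" for \<theta> using that Z_in_hplane by (auto simp: abs_le_iff)
  have Z1: "norm (Z \<theta>) \<le> 1" if "\<theta> \<in> {- \<theta>0..\<theta>0}" for \<theta> using Zh[OF that] by (simp add: hplane_def)
  have Z_cont: "continuous_on A Z" for A
    by (meson Z_deriv continuous_at_imp_continuous_on has_vector_derivative_continuous)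
  have "harc_length ((\<lambda>\<theta>. mob e c (Z \<theta>)) ` {- \<theta>0..\<theta>0}) =
     integral {- \<theta>0..\<theta>0} (\<lambda>\<theta>. 2 * norm (Z' \<theta> * \<mu>' (Z \<theta>)) / (1 - (norm (mob e c (Z \<theta>)))\<^sup>2))"
  proof (rule harc_length_param[where \<Theta> = "\<lambda>w. ang (mob_inv e c w)"])
    show "- \<theta>0 < \<theta>0" using \<theta>0 by simp
    fix \<theta> assume \<theta>: "\<theta> \<in> {- \<theta>0..\<theta>0}"
    note Zh = Zh[OF \<theta>] and Z1 = Z1[OF \<theta>]
    show "((\<lambda>\<theta>. mob e c (Z \<theta>)) has_vector_derivative Z' \<theta> * \<mu>' (Z \<theta>)) (at \<theta>)"
      using field_vector_diff_chain_at[OF Z_deriv mob_deriv[OF c e Zh]] by (simp add: o_def \<mu>'_def)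
    show "Z' \<theta> * \<mu>' (Z \<theta>) \<noteq> 0"
    proof -
      have "Z' \<theta> \<noteq> 0" using norm_Z'[of \<theta>] basics(3) by auto
      moreover have "complex_of_real (1 - (norm c)\<^sup>2) \<noteq> 0" using c unfolding of_real_eq_0_iff by (simp add: hplane_iff)
      ultimately show ?thesis using e mob_denom[OF c e Z1] by (auto simp: \<mu>'_def simp del: of_real_diff)
    qed
    show "mob e c (Z \<theta>) \<in> hplane" by (rule mob_in_hplane[OF c e Zh])
    then have "norm (mob e c (Z \<theta>)) \<le> 1" by (simp add: hplane_def)
    show inv: "ang (mob_inv e c (mob e c (Z \<theta>))) = \<theta>"
      unfolding mob_inverse[OF c e Z1] using \<theta> by (intro ang_Z) auto
    have "ang \<circ> mob_inv e c differentiable (at (mob e c (Z \<theta>)))"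
      using \<theta> by (intro differentiable_chain_at mob_inv_differentiable[OF c e mob_in_hplane[OF c e Zh]])
        (simp add: mob_inverse[OF c e Z1] ang_differentiable abs_le_iff)
    then show "(\<lambda>w. ang (mob_inv e c w)) differentiable (at (mob e c (Z \<theta>)))" by (simp add: o_def)
  next
    show "continuous_on {- \<theta>0..\<theta>0} (\<lambda>\<theta>. Z' \<theta> * \<mu>' (Z \<theta>))"
      unfolding \<mu>'_def Z'_def using mob_denom[OF c e Z1]
      by (intro continuous_intros Z_cont) auto
  qed
  also have "\<dots> = integral {- \<theta>0..\<theta>0} (\<lambda>\<theta>. 1 / dens \<theta>)"
  proof (rule integral_cong)
    fix \<theta> assume "\<theta> \<in> {- \<theta>0..\<theta>0}"
    note Zh = Zh[OF this]
    have "2 * norm (Z' \<theta> * \<mu>' (Z \<theta>)) / (1 - (norm (mob e c (Z \<theta>)))\<^sup>2)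
      = 2 * norm (Z' \<theta>) * (norm (\<mu>' (Z \<theta>)) / (1 - (norm (mob e c (Z \<theta>)))\<^sup>2))" by (simp add: norm_mult)
    also have "\<dots> = 1 / dens \<theta>"
      unfolding \<mu>'_def mob_conformal_factor[OF c e Zh] norm_Z' one_minus_norm_Z using basics(3) by simp
    finally show "2 * norm (Z' \<theta> * \<mu>' (Z \<theta>)) / (1 - (norm (mob e c (Z \<theta>)))\<^sup>2) = 1 / dens \<theta>" .
  qed
  also have "\<dots> = ell k (sinh r)" by (rule integral_dens)
  finally show ?thesis unfolding rim_inside_dual_eq image_image .
qed
end

section \<open>The region enclosed by the three sub-arcs\<close>

lemma inner_of_real_mult: "b \<bullet> (of_real y * w) = y * (b \<bullet> (w::complex))"
  by (simp flip: scaleR_conv_of_real)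

lemma mob_norm_1:
  assumes "c \<in> hplane" "norm e = 1" "norm w = 1"
  shows "norm (mob e c w) = 1"
  using mob_norm[OF assms(1,2), of w] assms(3) by (simp add: power2_eq_1_iff) (smt (verit) norm_ge_zero)

lemma continuous_on_mob:
  assumes "c \<in> hplane" "norm e = 1"
  shows "continuous_on (cball 0 1) (mob e c)"
  unfolding mob_def using mob_denom[OF assms] by (intro continuous_intros) auto

lemma open_mob_image:
  assumes c: "c \<in> hplane" and e: "norm e = 1" and S: "open S" and Sh: "S \<subseteq> hplane"
  shows "open (mob e c ` S)"
proof -
  have "mob e c ` S = hplane \<inter> mob_inv e c -` S"
  proof (intro equalityI subsetI)
    fix z assume "z \<in> mob e c ` S"
    then obtain w where "w \<in> S" "z = mob e c w" by blast
    moreover from this have "norm w \<le> 1" "w \<in> hplane" using Sh by (auto simp: hplane_def)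
    ultimately show "z \<in> hplane \<inter> mob_inv e c -` S" using mob_inverse[OF c e] mob_in_hplane[OF c e] by auto
  next
    fix z assume z: "z \<in> hplane \<inter> mob_inv e c -` S"
    then have "norm z \<le> 1" by (simp add: hplane_def)
    then show "z \<in> mob e c ` S" using z mob_mob_inv[OF c e] by (intro image_eqI[of _ _ "mob_inv e c z"]) auto
  qed
  moreover have "continuous_on hplane (mob_inv e c)"
    unfolding mob_inv_def
    by (rule continuous_on_subset[OF continuous_on_mob[OF mob_inv_params(1)[OF c e] mob_inv_params(2)[OF e]]]) (auto simp: hplane_def)
  ultimately show "open (mob e c ` S)"
    using open_hplane S by (simp add: continuous_open_preimage)
qed

text \<open>No point outside of the image of a closed starlike region is enclosed: follow the image of the ray from \<open>0\<close>
  outwards to the unit circle and leave the disk. Components of the complement cannot simply be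
  carried over, since the transformation is a bijection of the disk only.\<close>

lemma inside_mob_image:
  fixes S K :: "complex set"
  assumes c: "c \<in> hplane" and e: "norm e = 1"
    and S: "open S" and comp: "compact (S \<union> K)" and disj: "S \<inter> K = {}" and sub: "S \<union> K \<subseteq> hplane"
    and z0: "0 \<in> S" and star: "\<And>w y. w \<in> S \<union> K \<Longrightarrow> 0 \<le> y \<Longrightarrow> y \<le> 1 \<Longrightarrow> of_real y * w \<in> S \<union> K"
  shows "inside (mob e c ` K) = mob e c ` S"
proof -
  define U where "U = - (mob e c ` (S \<union> K))"
  define far where "far = - ball (0::complex) 1"
  have inj: "inj_on (mob e c) hplane" using bij_mob[OF c e] by (simp add: bij_betw_def)
  have Sh: "S \<subseteq> hplane" and Kh: "K \<subseteq> hplane" using sub by auto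
  have img: "mob e c ` (S \<union> K) \<subseteq> hplane" using mob_in_hplane[OF c e] sub by blast
  have dj: "mob e c ` S \<inter> mob e c ` K = {}"
    using inj_on_image_Int[OF inj Sh Kh] disj by simp
  have parts: "mob e c ` S \<union> U = - (mob e c ` K)" using dj by (auto simp: U_def)
  have farU: "far \<subseteq> U" using img by (auto simp: far_def U_def hplane_def)
  have far_conn: "connected far" unfolding far_def
    by (intro connected_complement_bounded_convex) auto
  have far_unb: "\<not> bounded far" unfolding far_def by (intro cobounded_imp_unbounded) simp
  have ray: "\<exists>L. connected L \<and> far \<subseteq> L \<and> x \<in> L \<and> L \<subseteq> U" if x: "x \<in> U" for x
  proof (cases "x \<in> far")
    case True then show ?thesis using far_conn farU by blast
  next
    case False
    then have "x \<in> hplane" by (simp add: far_def hplane_def)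
    then obtain w where w: "w \<in> hplane" "x = mob e c w" using hplane_mob_image[OF c e] by blast
    have wn: "w \<notin> S \<union> K" using x w by (auto simp: U_def)
    then have w0: "w \<noteq> 0" using z0 by auto
    have w1: "norm w < 1" using w(1) by (simp add: hplane_def)
    define L where "L = (\<lambda>y. mob e c (of_real y * w)) ` {1..1 / norm w}"
    have le: "norm (of_real y * w) \<le> 1" if "y \<in> {1..1 / norm w}" for y
      using that w0 by (simp add: norm_mult field_simps)
    have "connected L" unfolding L_def
    proof (rule connected_continuous_image)
      show "continuous_on {1..1 / norm w} (\<lambda>y. mob e c (of_real y * w))"
        using le by (intro continuous_on_compose2[OF continuous_on_mob[OF c e]] continuous_intros) auto
    qed simp
    moreover have "mob e c (of_real (1 / norm w) * w) \<in> L \<inter> far"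
    proof
      show "mob e c (of_real (1 / norm w) * w) \<in> L" unfolding L_def using w0 w1 by (intro imageI) (simp add: field_simps)
      have "norm (of_real (1 / norm w) * w) = 1" unfolding norm_mult norm_of_real using w0 by simp
      then show "mob e c (of_real (1 / norm w) * w) \<in> far" using mob_norm_1[OF c e] by (simp add: far_def)
    qed
    ultimately have "connected (L \<union> far)" using far_conn by (intro connected_Un) auto
    moreover have "x \<in> L" unfolding L_def using w w0 w1 by (intro image_eqI[of _ _ 1]) (auto simp: field_simps)
    moreover have "L \<subseteq> U"
    proof
      fix u assume "u \<in> L"
      then obtain y where y: "y \<in> {1..1 / norm w}" "u = mob e c (of_real y * w)" by (auto simp: L_def)
      have yw: "of_real y * w \<notin> S \<union> K"
      proof
        assume "of_real y * w \<in> S \<union> K"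
        then have "of_real (1 / y) * (of_real y * w) \<in> S \<union> K" by (rule star) (use y in auto)
        then show False using wn y by simp
      qed
      show "u \<in> U"
      proof (cases "norm (of_real y * w) = 1")
        case True
        then have "norm u = 1" using mob_norm_1[OF c e] y by simp
        then show ?thesis using img by (auto simp: U_def hplane_def)
      next
        case False
        then have "of_real y * w \<in> hplane" using le[OF y(1)] by (simp add: hplane_def)
        then show ?thesis unfolding U_def y(2)
            using inj_on_image_mem_iff[OF inj _ sub, of "of_real y * w"] yw by (metis ComplI)
      qed
    qed
    ultimately show ?thesis using farU by (intro exI[of _ "L \<union> far"]) auto
  qed
  \<comment> \<open>all the curves contain the exterior of the unit disk, which is connected in the plane\<close>
  have "connected U"
  proof -
    define F where "F = {L. connected L \<and> far \<subseteq> L \<and> L \<subseteq> U}"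
    have "(2::complex) \<in> \<Inter> F" by (auto simp: F_def far_def)
    then have "connected (\<Union> F)" by (intro connected_Union) (auto simp: F_def)
    moreover have "\<Union> F = U" using ray by (auto simp: F_def) blast
    ultimately show ?thesis by simp
  qed
  moreover have "\<not> bounded U" using far_unb farU bounded_subset by blast
  ultimately have "inside (mob e c ` K) \<subseteq> mob e c ` S" using parts by (rule inside_subset)
  moreover have "mob e c ` S \<subseteq> inside (mob e c ` K)"
  proof
    fix x assume x: "x \<in> mob e c ` S"
    have contm: "continuous_on hplane (mob e c)"
      by (rule continuous_on_subset[OF continuous_on_mob[OF c e]]) (auto simp: hplane_def)
    have oS: "open (mob e c ` S)" by (rule open_mob_image[OF c e S Sh])
    have "compact (mob e c ` (S \<union> K))"
      by (rule compact_continuous_image[OF continuous_on_subset[OF contm sub] comp])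
    then have oU: "open U" unfolding U_def using compact_imp_closed by blast
    define C where "C = connected_component_set (- (mob e c ` K)) x"
    have xK: "x \<notin> mob e c ` K" using x dj by blast
    have xC: "x \<in> C" using xK by (simp add: C_def connected_component_refl)
    have "C \<subseteq> mob e c ` S \<union> U" unfolding C_def parts using connected_component_subset by blast
    moreover have "connected C" unfolding C_def by simp
    moreover have "mob e c ` S \<inter> U = {}" by (auto simp: U_def)
    ultimately have "C \<inter> U = {}" using connectedD[OF _ oS oU, of C] x xC by blast
    then have "C \<subseteq> mob e c ` S" using \<open>C \<subseteq> mob e c ` S \<union> U\<close> by blast
    moreover have "mob e c ` S \<subseteq> ball 0 1" using img unfolding hplane_def by blast
    then have "bounded (mob e c ` S)" using bounded_ball bounded_subset by blast
    ultimately have "bounded C" using bounded_subset by blast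
    then show "x \<in> inside (mob e c ` K)" using xK unfolding inside_def C_def by blast
  qed
  ultimately show ?thesis by blast
qed

context dual_arc begin

definition "form w = (k * cosh r + k) * (norm w)\<^sup>2 - 2 * (b \<bullet> w) + (k * cosh r - k)"

text \<open>Positive exactly in the directions that meet the disk; \<open>excess w = 0\<close> describes the two rays from \<open>0\<close>
  through the end points of the arc.\<close>

definition "excess w = b \<bullet> w - K * norm w"

definition "sector = {w. 0 < excess w \<and> norm w < R \<and> 0 < form w}"

lemma a_pos: "0 < k * (1 + cosh r)" using k by (simp add: add_pos_pos)

lemma R_pos: "0 < R" "R < 1" using dual_rad[OF r] by auto

lemma form_eq: "form w = k * (1 + cosh r) * ((norm w)\<^sup>2 + R\<^sup>2) - 2 * (b \<bullet> w)"
proof -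
  have "k * cosh r - k = k * ((1 + cosh r) * R\<^sup>2)" unfolding dual_rad(4)[OF r] by (simp add: algebra_simps)
  then have "form w = (k * cosh r + k) * (norm w)\<^sup>2 - 2 * (b \<bullet> w) + k * ((1 + cosh r) * R\<^sup>2)"
    unfolding form_def by (simp only:)
  then show ?thesis by (simp add: algebra_simps)
qed

lemma form_excess: "form w = k * (1 + cosh r) * (norm w - R)\<^sup>2 - 2 * excess w"
proof -
  have "K = k * (1 + cosh r) * R" using dual_rad(3)[OF r] by simp
  then show ?thesis unfolding form_eq excess_def by (simp add: power2_eq_square algebra_simps)
qed

lemma form_scale:
  "form (of_real y * w) = y * form w + k * (1 + cosh r) * (1 - y) * (R\<^sup>2 - y * (norm w)\<^sup>2)"
proof -
  note inner_of_real_mult[of b y w]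
  moreover have "(norm (of_real y * w))\<^sup>2 = y\<^sup>2 * (norm w)\<^sup>2" by (simp add: norm_mult power_mult_distrib)
  ultimately show ?thesis unfolding form_eq by (simp add: power2_eq_square algebra_simps)
qed

lemma excess_scale: "0 \<le> y \<Longrightarrow> excess (of_real y * w) = y * excess w"
  unfolding excess_def inner_of_real_mult by (simp add: norm_mult algebra_simps)

lemma rim_iff_form: "w \<in> cap_rim k (k * cosh r) b \<longleftrightarrow> w \<in> hplane \<and> form w = 0"
  by (simp add: cap_rim_iff form_def)

lemma rim_inside_dual_form: "cap_rim k (k * cosh r) b \<inter> cball 0 R = {w. norm w \<le> R \<and> form w = 0}"
  using R_pos by (auto simp: rim_iff_form hplane_def)

lemma form_Z: "form (Z \<theta>) = 0"
proof -
  have "\<rho> * form (Z \<theta>) = (\<rho> * (k * (1 + cosh r))) * ((norm (Z \<theta>))\<^sup>2 + R\<^sup>2) - 2 * \<rho> * (b \<bullet> Z \<theta>)"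
    unfolding form_eq by (simp add: algebra_simps)
  also have "\<dots> = 0" unfolding basics(4) norm_Z inner_b_Z basics(6) by algebra
  finally show ?thesis using basics(3) by simp
qed

lemma form_star:
  assumes "0 \<le> y" "y \<le> 1" "norm w \<le> R" "0 \<le> form w"
  shows "0 \<le> form (of_real y * w)"
proof -
  have "(norm w)\<^sup>2 \<le> R\<^sup>2" using assms(3) by (intro power_mono) auto
  then have "y * (norm w)\<^sup>2 \<le> 1 * R\<^sup>2" using assms by (intro mult_mono) auto
  then show ?thesis unfolding form_scale using assms k by (intro add_nonneg_nonneg mult_nonneg_nonneg) auto
qed

lemma form_star_strict:
  assumes "0 < y" "y < 1" "norm w < R" "0 \<le> form w"
  shows "0 < form (of_real y * w)"
proof -
  have "(norm w)\<^sup>2 < R\<^sup>2" using assms(3) by (intro power_strict_mono) auto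
  moreover have "y * (norm w)\<^sup>2 \<le> 1 * (norm w)\<^sup>2" using assms by (intro mult_right_mono) auto
  ultimately have "0 < R\<^sup>2 - y * (norm w)\<^sup>2" by linarith
  then show ?thesis unfolding form_scale using assms k by (intro add_nonneg_pos mult_nonneg_nonneg mult_pos_pos) (auto simp: add_pos_pos)
qed

text \<open>On the ray through a point of the sector the defining form is positive at the point and negative on the dual
  circle, so the ray meets the arc in between.\<close>

lemma sector_eq: "sector = (\<lambda>(y, \<theta>). of_real y * Z \<theta>) ` ({0<..<1} \<times> {- \<theta>0<..<\<theta>0})"
proof (intro equalityI subsetI)
  fix w assume "w \<in> sector"
  then have w: "0 < excess w" "norm w < R" "0 < form w" by (auto simp: sector_def)
  have w0: "w \<noteq> 0" using w(1) by (auto simp: excess_def)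
  define f where "f = (\<lambda>t. form (of_real t * w))"
  have "continuous_on {1..R / norm w} f" unfolding f_def form_def by (intro continuous_intros)
  moreover have "f (R / norm w) \<le> 0"
  proof -
    have n: "norm (of_real (R / norm w) * w) = R" unfolding norm_mult norm_of_real using w0 R_pos by simp
    have "0 < R / norm w * excess w" using w0 R_pos w by simp
    moreover have "excess (of_real (R / norm w) * w) = R / norm w * excess w"
      using R_pos by (intro excess_scale) simp
    ultimately show ?thesis unfolding f_def form_excess n by simp
  qed
  moreover have "0 \<le> f 1" using w by (simp add: f_def)
  moreover have "1 \<le> R / norm w" using w w0 by (simp add: field_simps)
  ultimately obtain t where t: "1 \<le> t" "t \<le> R / norm w" "f t = 0"
    using IVT2'[of f "R / norm w" 0 1] by auto
  have "t \<noteq> 1" using t w by (auto simp: f_def)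
  then have t1: "1 < t" using t by simp
  have tn: "norm (of_real t * w) < R"
  proof -
    have "norm (of_real t * w) \<noteq> R"
    proof
      assume n: "norm (of_real t * w) = R"
      have "form (of_real t * w) = - 2 * (t * excess w)" unfolding form_excess n using t1 by (simp add: excess_scale)
      then show False using t w t1 by (simp add: f_def)
    qed
    moreover have "norm (of_real t * w) \<le> R" using t w0 t1 by (simp add: norm_mult field_simps)
    ultimately show ?thesis by simp
  qed
  have "of_real t * w \<in> cap_rim k (k * cosh r) b"
    using t tn R_pos by (simp add: rim_iff_form f_def hplane_def)
  then obtain \<theta> where \<theta>: "\<bar>\<theta>\<bar> \<le> pi" "of_real t * w = Z \<theta>" using circle_point rim_iff by blast
  have "\<bar>\<theta>\<bar> < \<theta>0" using tn norm_Z_le_iff(2)[OF \<theta>(1)] \<theta>(2) by simp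
  moreover have "w = of_real (1 / t) * Z \<theta>" using t1 unfolding \<theta>(2)[symmetric] by simp
  ultimately show "w \<in> (\<lambda>(y, \<theta>). of_real y * Z \<theta>) ` ({0<..<1} \<times> {- \<theta>0<..<\<theta>0})"
    using t1 by (intro image_eqI[of _ _ "(1 / t, \<theta>)"]) auto
next
  fix w assume "w \<in> (\<lambda>(y, \<theta>). of_real y * Z \<theta>) ` ({0<..<1} \<times> {- \<theta>0<..<\<theta>0})"
  then obtain q where q: "w = (\<lambda>(y, \<theta>). of_real y * Z \<theta>) q" "q \<in> {0<..<1} \<times> {- \<theta>0<..<\<theta>0}"
    by (rule imageE)
  obtain y \<theta> where "q = (y, \<theta>)" by (cases q)
  then have y: "0 < y" "y < 1" "\<bar>\<theta>\<bar> < \<theta>0" "w = of_real y * Z \<theta>" using q by auto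
  have n: "norm (Z \<theta>) < R" using y \<theta>0 norm_Z_le_iff(2)[of \<theta>] by simp
  have "2 * excess (Z \<theta>) = k * (1 + cosh r) * (norm (Z \<theta>) - R)\<^sup>2" using form_excess[of "Z \<theta>"] form_Z[of \<theta>] by simp
  then have "0 < excess (Z \<theta>)" using n a_pos by (smt (verit) mult_pos_pos zero_less_power2)
  then have "0 < excess w" using y by (simp add: excess_scale)
  moreover have "norm w < R"
  proof -
    have "norm w \<le> 1 * norm (Z \<theta>)" unfolding y(4) norm_mult using y by (intro mult_right_mono) auto
    then show ?thesis using n by simp
  qed
  moreover have "0 < form w" unfolding y(4) using y n form_Z[of \<theta>] by (intro form_star_strict) auto
  ultimately show "w \<in> sector" by (simp add: sector_def)
qed

text \<open>On a ray the defining form is a quadratic polynomial whose two roots have product \<open>R\<^sup>2 / \<bar>z\<bar>\<^sup>2\<close>; hence the ray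
  meets the arc inside the dual circle only once.\<close>

lemma sector_coord_inj: "inj_on (\<lambda>(y, \<theta>). of_real y * Z \<theta>) ({0<..<1} \<times> {- \<theta>0<..<\<theta>0})"
proof (rule inj_onI, clarify)
  fix y \<theta> y' \<theta>'
  assume a: "y \<in> {0<..<1::real}" "\<theta> \<in> {- \<theta>0<..<\<theta>0}" "y' \<in> {0<..<1::real}" "\<theta>' \<in> {- \<theta>0<..<\<theta>0}"
    and eq: "of_real y * Z \<theta> = of_real y' * Z \<theta>'"
  define t where "t = y / y'"
  have t: "0 < t" using a by (simp add: t_def)
  have Z': "Z \<theta>' = of_real t * Z \<theta>" using eq a unfolding t_def by (simp add: field_simps)
  have n: "norm (Z \<theta>) < R" "norm (Z \<theta>') < R" using a \<theta>0 norm_Z_le_iff(2)[of \<theta>] norm_Z_le_iff(2)[of \<theta>'] by auto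
  have "norm (Z \<theta>) * norm (Z \<theta>') < R * R" using n by (intro mult_strict_mono') auto
  then have "t * (norm (Z \<theta>))\<^sup>2 < R\<^sup>2" unfolding Z' using t by (simp add: norm_mult power2_eq_square mult_ac)
  moreover have "k * (1 + cosh r) * (1 - t) * (R\<^sup>2 - t * (norm (Z \<theta>))\<^sup>2) = 0"
    using form_scale[of t "Z \<theta>"] form_Z[of \<theta>] form_Z[of \<theta>'] Z' by simp
  ultimately have t1: "t = 1" using a_pos by auto
  then have "Z \<theta> = Z \<theta>'" using Z' by simp
  moreover have "\<bar>\<theta>\<bar> \<le> \<theta>0" "\<bar>\<theta>'\<bar> \<le> \<theta>0" using a by auto
  ultimately have "\<theta> = \<theta>'" using ang_Z by metis
  then show "y = y' \<and> \<theta> = \<theta>'" using t1 a by (simp add: t_def field_simps)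
qed
end

text \<open>The position found in \<open>triangle_normal_form\<close>. The curvatures determine the configuration, so the three
  vectors are definitions and not parameters.\<close>

locale dual_triangle =
  fixes k1 k2 k3 r :: real
  assumes k1: "0 < k1" and k2: "0 < k2" and k3: "0 < k3" and r: "0 < r"
    and e2: "(k1 * sinh r) * (k2 * sinh r) + (k2 * sinh r) * (k3 * sinh r) + (k1 * sinh r) * (k3 * sinh r) = 1"
begin

abbreviation "K1 \<equiv> k1 * sinh r"
abbreviation "K2 \<equiv> k2 * sinh r"
abbreviation "K3 \<equiv> k3 * sinh r"
definition "b1 = Complex K1 (- 1)"
definition "b2 = Complex K2 1"
definition "b3 = Complex (K3 - 2 / (K1 + K2)) ((K2 - K1) / (K1 + K2))"

lemma K_pos: "0 < K1" "0 < K2" "0 < K3" using k1 k2 k3 r by auto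

sublocale arc1: dual_arc k1 r b1
  by unfold_locales (use k1 r in \<open>auto simp: b1_def cmod_power2\<close>)

sublocale arc2: dual_arc k2 r b2
  by unfold_locales (use k2 r in \<open>auto simp: b2_def cmod_power2\<close>)

sublocale arc3: dual_arc k3 r b3
proof unfold_locales
  define t where "t = 1 / (K1 + K2)"
  have t: "t * (K1 + K2) = 1" using K_pos by (simp add: t_def)
  have "(norm b3)\<^sup>2 = (K3 - 2 * t)\<^sup>2 + ((K2 - K1) * t)\<^sup>2" by (simp add: b3_def cmod_power2 t_def)
  also have "\<dots> = 1 + K3\<^sup>2" using t e2 by algebra
  finally show "(norm b3)\<^sup>2 = 1 + K3\<^sup>2" .
qed (use k3 r in auto)

text \<open>In the stereographic coordinate \<open>Im w / (\<bar>w\<bar> - Re w)\<close> of the direction the two end points of the third arc are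
  the roots \<open>-K1\<close> and \<open>K2\<close> of a quadratic polynomial, and the first and second arc are the half lines
  outside of these roots. This identity is the homogeneous form of that statement; it shows that the three
  arcs cover all directions without overlap.\<close>

lemma excess_product: "(norm w - Re w) * arc3.excess w = arc1.excess w * arc2.excess w / (K1 + K2)"
proof -
  define t where "t = 1 / (K1 + K2)"
  have t: "t * (K1 + K2) = 1" using K_pos by (simp add: t_def)
  have n: "(norm w)\<^sup>2 = (Re w)\<^sup>2 + (Im w)\<^sup>2" by (rule cmod_power2)
  have 3: "arc3.excess w = (K3 - 2 * t) * Re w + ((K2 - K1) * t) * Im w - K3 * norm w"
    unfolding arc3.excess_def by (simp add: b3_def inner_complex_def t_def)
  have 1: "arc1.excess w = K1 * Re w - Im w - K1 * norm w" and 2: "arc2.excess w = K2 * Re w + Im w - K2 * norm w"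
    unfolding arc1.excess_def arc2.excess_def by (simp_all add: b1_def b2_def inner_complex_def)
  have "(norm w - Re w) * arc3.excess w = arc1.excess w * arc2.excess w * t"
    unfolding 1 2 3 using t n e2 by algebra
  then show ?thesis by (simp add: t_def)
qed

lemma excess_sum: "arc1.excess w + arc2.excess w = - ((K1 + K2) * (norm w - Re w))"
  unfolding arc1.excess_def arc2.excess_def by (simp add: b1_def b2_def inner_complex_def algebra_simps)

lemma real_axis:
  assumes "norm w = Re w" shows "arc1.excess w = 0" "arc2.excess w = 0" "arc3.excess w \<le> 0"
proof -
  have "Im w = 0" using assms cmod_power2[of w] by simp
  moreover have "0 \<le> Re w" using assms norm_ge_zero[of w] by simp
  ultimately show "arc1.excess w = 0" "arc2.excess w = 0" "arc3.excess w \<le> 0"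
    unfolding arc1.excess_def arc2.excess_def arc3.excess_def using assms K_pos
    by (simp_all add: b1_def b2_def b3_def inner_complex_def algebra_simps)
qed

lemma excess_cover: "0 \<le> arc1.excess w \<or> 0 \<le> arc2.excess w \<or> 0 \<le> arc3.excess w"
proof (rule ccontr)
  assume "\<not> ?thesis"
  then have n: "arc1.excess w < 0" "arc2.excess w < 0" "arc3.excess w < 0" by auto
  then have "norm w \<noteq> Re w" using real_axis by force
  then have "0 < norm w - Re w" using complex_Re_le_cmod[of w] by linarith
  then have "(norm w - Re w) * arc3.excess w < 0" using n by (simp add: mult_pos_neg)
  moreover have "0 < arc1.excess w * arc2.excess w / (K1 + K2)" using n K_pos by (simp add: mult_neg_neg)
  ultimately show False using excess_product[of w] by simp
qed

lemma excess_disjoint: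
  "0 \<le> arc1.excess w \<Longrightarrow> arc2.excess w \<le> 0 \<and> arc3.excess w \<le> 0"
  "0 \<le> arc2.excess w \<Longrightarrow> arc1.excess w \<le> 0 \<and> arc3.excess w \<le> 0"
  "0 \<le> arc3.excess w \<Longrightarrow> arc1.excess w \<le> 0 \<and> arc2.excess w \<le> 0"
proof -
  have P: "0 \<le> norm w - Re w" using complex_Re_le_cmod[of w] by linarith
  have "0 \<le> (K1 + K2) * (norm w - Re w)" using P K_pos by (intro mult_nonneg_nonneg) linarith+
  then have sum: "arc1.excess w + arc2.excess w \<le> 0" unfolding excess_sum by linarith
  have third: "arc3.excess w \<le> 0" if "arc1.excess w * arc2.excess w \<le> 0"
  proof (cases "norm w = Re w")
    case True then show ?thesis using real_axis by simp
  next
    case False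
    have "arc1.excess w * arc2.excess w / (K1 + K2) \<le> 0" using that K_pos by (simp add: divide_nonpos_pos)
    then have "(norm w - Re w) * arc3.excess w \<le> 0" using excess_product[of w] by simp
    then show ?thesis using P False by (simp add: mult_le_0_iff)
  qed
  show "0 \<le> arc1.excess w \<Longrightarrow> arc2.excess w \<le> 0 \<and> arc3.excess w \<le> 0"
    using sum third by (simp add: mult_nonneg_nonpos)
  show "0 \<le> arc2.excess w \<Longrightarrow> arc1.excess w \<le> 0 \<and> arc3.excess w \<le> 0"
    using sum third by (simp add: mult_nonpos_nonneg)
  show "0 \<le> arc3.excess w \<Longrightarrow> arc1.excess w \<le> 0 \<and> arc2.excess w \<le> 0"
  proof (cases "norm w = Re w")
    case True then show ?thesis using real_axis by simp
  next
    case False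
    assume "0 \<le> arc3.excess w"
    then have "0 \<le> arc1.excess w * arc2.excess w / (K1 + K2)" using excess_product[of w] P by (metis mult_nonneg_nonneg)
    then have "0 \<le> arc1.excess w * arc2.excess w" using K_pos by (simp add: zero_le_divide_iff)
    moreover have "arc1.excess w + arc2.excess w < 0" using excess_sum[of w] P False K_pos by (simp add: mult_pos_pos)
    ultimately show ?thesis by (auto simp: zero_le_mult_iff)
  qed
qed

definition "region = {w. norm w < dual_rad r \<and> 0 < arc1.form w \<and> 0 < arc2.form w \<and> 0 < arc3.form w}"

definition "rims = {w. norm w \<le> dual_rad r \<and> arc1.form w = 0} \<union> {w. norm w \<le> dual_rad r \<and> arc2.form w = 0}
   \<union> {w. norm w \<le> dual_rad r \<and> arc3.form w = 0}"

text \<open>Covering of all directions shows that the dual circle itself lies in the closed disks, and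
  disjointness shows that an arc does not enter another disk.\<close>

lemma region_closure: "region \<union> rims = {w. norm w \<le> dual_rad r \<and> 0 \<le> arc1.form w \<and> 0 \<le> arc2.form w \<and> 0 \<le> arc3.form w}"
proof (intro equalityI subsetI)
  fix w assume w: "w \<in> {w. norm w \<le> dual_rad r \<and> 0 \<le> arc1.form w \<and> 0 \<le> arc2.form w \<and> 0 \<le> arc3.form w}"
  have "norm w \<noteq> dual_rad r \<or> w \<in> rims"
  proof (rule disjCI)
    assume "\<not> w \<in> rims"
    show "norm w \<noteq> dual_rad r"
    proof
      assume n: "norm w = dual_rad r"
      have "arc1.form w = - 2 * arc1.excess w" "arc2.form w = - 2 * arc2.excess w" "arc3.form w = - 2 * arc3.excess w"
        unfolding arc1.form_excess arc2.form_excess arc3.form_excess n by simp_all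
      then have "arc1.form w = 0 \<or> arc2.form w = 0 \<or> arc3.form w = 0" using w excess_cover[of w] by auto
      then show False using \<open>\<not> w \<in> rims\<close> n by (auto simp: rims_def)
    qed
  qed
  then show "w \<in> region \<union> rims" using w by (auto simp: region_def rims_def)
next
  fix w assume w: "w \<in> region \<union> rims"
  have sq: "0 \<le> k1 * (1 + cosh r) * (norm w - dual_rad r)\<^sup>2" "0 \<le> k2 * (1 + cosh r) * (norm w - dual_rad r)\<^sup>2"
     "0 \<le> k3 * (1 + cosh r) * (norm w - dual_rad r)\<^sup>2"
    using arc1.a_pos arc2.a_pos arc3.a_pos by (auto intro!: mult_nonneg_nonneg)
  from w consider "w \<in> region" | "norm w \<le> dual_rad r" "arc1.form w = 0" | "norm w \<le> dual_rad r" "arc2.form w = 0" | "norm w \<le> dual_rad r" "arc3.form w = 0"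
    by (auto simp: rims_def)
  then show "w \<in> {w. norm w \<le> dual_rad r \<and> 0 \<le> arc1.form w \<and> 0 \<le> arc2.form w \<and> 0 \<le> arc3.form w}"
  proof cases
    case 1 then show ?thesis by (auto simp: region_def)
  next
    case 2
    then have "0 \<le> arc1.excess w" using sq arc1.form_excess[of w] by linarith
    then have "arc2.excess w \<le> 0" "arc3.excess w \<le> 0" using excess_disjoint by auto
    then show ?thesis using 2 sq arc2.form_excess[of w] arc3.form_excess[of w] by auto
  next
    case 3
    then have "0 \<le> arc2.excess w" using sq arc2.form_excess[of w] by linarith
    then have "arc1.excess w \<le> 0" "arc3.excess w \<le> 0" using excess_disjoint by auto
    then show ?thesis using 3 sq arc1.form_excess[of w] arc3.form_excess[of w] by auto
  next
    case 4
    then have "0 \<le> arc3.excess w" using sq arc3.form_excess[of w] by linarith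
    then have "arc1.excess w \<le> 0" "arc2.excess w \<le> 0" using excess_disjoint by auto
    then show ?thesis using 4 sq arc1.form_excess[of w] arc2.form_excess[of w] by auto
  qed
qed

lemma continuous_on_form: "continuous_on A arc1.form" "continuous_on A arc2.form" "continuous_on A arc3.form"
  unfolding arc1.form_def arc2.form_def arc3.form_def by (intro continuous_intros)+

lemma inside_mob_rims:
  assumes c: "c \<in> hplane" and e: "norm e = 1"
  shows "inside (mob e c ` rims) = mob e c ` region"
proof (rule inside_mob_image[OF c e])
  show "open region" unfolding region_def
    by (intro open_Collect_conj open_Collect_less continuous_intros continuous_on_form)
  have "closed (region \<union> rims)" unfolding region_closure
    by (intro closed_Collect_conj closed_Collect_le continuous_intros continuous_on_form)
  moreover have "bounded (region \<union> rims)" unfolding region_closure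
    by (rule bounded_subset[of "cball 0 (dual_rad r)"]) auto
  ultimately show "compact (region \<union> rims)" by (simp add: compact_eq_bounded_closed)
  show "region \<inter> rims = {}" by (auto simp: region_def rims_def)
  show "region \<union> rims \<subseteq> hplane" unfolding region_closure using arc1.R_pos by (auto simp: hplane_def)
  show "0 \<in> region" using arc1.R_pos arc1.a_pos arc2.a_pos arc3.a_pos
    by (simp add: region_def arc1.form_eq arc2.form_eq arc3.form_eq)
  fix w y assume w: "w \<in> region \<union> rims" and y: "0 \<le> y" "y \<le> (1::real)"
  have "y * norm w \<le> 1 * dual_rad r" using w y unfolding region_closure by (intro mult_mono) auto
  then show "of_real y * w \<in> region \<union> rims"
    using w y unfolding region_closure
    by (auto intro!: arc1.form_star arc2.form_star arc3.form_star simp: norm_mult)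
qed
end

section \<open>The area of the region\<close>

text \<open>Determinants belong to \<open>real^2\<close>, iterated integrals to \<open>real \<times> real\<close>, and the area to
  \<open>complex\<close>. The identifications between these spaces preserve Lebesgue measure because they map bases to bases.\<close>

lemma lborel_distr_basis_iso:
  fixes f :: "'a::euclidean_space \<Rightarrow> 'b::euclidean_space"
  assumes f: "linear f" and g: "bij_betw g (Basis :: 'b set) (Basis :: 'a set)"
    and fg: "\<And>x j. j \<in> Basis \<Longrightarrow> f x \<bullet> j = x \<bullet> g j"
  shows "distr lborel borel f = lborel"
proof (rule lborel_eqI[symmetric])
  have meas[measurable]: "f \<in> borel_measurable borel"
    using f by (intro borel_measurable_continuous_onI linear_continuous_on linear_conv_bounded_linear[THEN iffD1])
  fix l u :: 'b assume le: "\<And>b. b \<in> Basis \<Longrightarrow> l \<bullet> b \<le> u \<bullet> b"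
  define T where "T = (\<lambda>v::'b. \<Sum>j\<in>Basis. (v \<bullet> j) *\<^sub>R g j)"
  have gB: "g j \<in> Basis" if "j \<in> Basis" for j using g that by (auto simp: bij_betw_def)
  have T: "T v \<bullet> g j = v \<bullet> j" if j: "j \<in> Basis" for v j
  proof -
    have "T v \<bullet> g j = (\<Sum>i\<in>Basis. (v \<bullet> i) * (g i \<bullet> g j))" by (simp add: T_def inner_sum_left)
    also have "\<dots> = (\<Sum>i\<in>Basis. if i = j then v \<bullet> i else 0)"
    proof (rule sum.cong[OF refl])
      fix i :: 'b assume i: "i \<in> Basis"
      have "g i = g j \<longleftrightarrow> i = j" using g i j by (auto simp: bij_betw_def inj_on_def)
      then show "(v \<bullet> i) * (g i \<bullet> g j) = (if i = j then v \<bullet> i else 0)"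
        using inner_Basis[OF gB[OF i] gB[OF j]] by simp
    qed
    also have "\<dots> = v \<bullet> j" using j by simp
    finally show ?thesis .
  qed
  have "f -` box l u = box (T l) (T u)"
  proof -
    have "f x \<in> box l u \<longleftrightarrow> x \<in> box (T l) (T u)" for x
    proof -
      have "f x \<in> box l u \<longleftrightarrow> (\<forall>j\<in>Basis. T l \<bullet> g j < x \<bullet> g j \<and> x \<bullet> g j < T u \<bullet> g j)"
        by (simp add: mem_box fg T)
      also have "\<dots> \<longleftrightarrow> (\<forall>i\<in>g ` Basis. T l \<bullet> i < x \<bullet> i \<and> x \<bullet> i < T u \<bullet> i)" by simp
      also have "g ` Basis = Basis" using g by (simp add: bij_betw_def)
      finally show ?thesis by (simp add: mem_box)
    qed
    then show ?thesis by auto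
  qed
  moreover have "emeasure lborel (box (T l) (T u)) = (\<Prod>i\<in>Basis. (T u - T l) \<bullet> i)"
  proof (rule emeasure_lborel_box)
    fix i :: 'a assume "i \<in> Basis"
    then obtain j where "j \<in> Basis" "i = g j" using g by (auto simp: bij_betw_def)
    then show "T l \<bullet> i \<le> T u \<bullet> i" using T le by simp
  qed
  moreover have "(\<Prod>i\<in>Basis. (T u - T l) \<bullet> i) = (\<Prod>j\<in>Basis. (T u - T l) \<bullet> g j)"
    using prod.reindex_bij_betw[OF g, of "\<lambda>i. (T u - T l) \<bullet> i"] by simp
  moreover have "\<dots> = (\<Prod>j\<in>Basis. (u - l) \<bullet> j)" by (intro prod.cong) (simp_all add: inner_diff_left T)
  ultimately show "emeasure (distr lborel borel f) (box l u) = (\<Prod>b\<in>Basis. (u - l) \<bullet> b)"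
    by (simp add: emeasure_distr)
qed simp

lemma has_integral_distr_lborel_iff:
  fixes \<phi> :: "'a::euclidean_space \<Rightarrow> 'b::euclidean_space" and f :: "'b \<Rightarrow> real"
  assumes \<phi>: "\<phi> \<in> borel_measurable borel" and d: "distr lborel borel \<phi> = lborel"
    and f: "f \<in> borel_measurable borel" and f0: "\<And>x. 0 \<le> f x"
  shows "((\<lambda>x. f (\<phi> x)) has_integral I) UNIV \<longleftrightarrow> (f has_integral I) UNIV"
proof -
  have m: "(\<lambda>x. f (\<phi> x)) \<in> borel_measurable borel" using measurable_compose[OF \<phi> f] .
  have n: "(\<integral>\<^sup>+x. f (\<phi> x) \<partial>lborel) = (\<integral>\<^sup>+x. f x \<partial>lborel)"
  proof -
    have "(\<integral>\<^sup>+x. f x \<partial>distr lborel borel \<phi>) = (\<integral>\<^sup>+x. f (\<phi> x) \<partial>lborel)"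
      by (rule nn_integral_distr) (use \<phi> f in auto)
    then show ?thesis unfolding d by simp
  qed
  have iff: "(h has_integral I) UNIV \<longleftrightarrow> (\<integral>\<^sup>+x. h x \<partial>lborel) = ennreal I \<and> 0 \<le> I"
    if "h \<in> borel_measurable borel" "\<And>x. 0 \<le> h x" for h :: "'c::euclidean_space \<Rightarrow> real"
    using nn_integral_has_integral_lborel[OF that] nn_integral_has_integral[OF that] has_integral_nonneg[of h I UNIV] that(2) by blast
  show ?thesis unfolding iff[OF m f0] iff[OF f f0] n ..
qed

lemma has_integral_UNIV_indicator:
  fixes f :: "'a::euclidean_space \<Rightarrow> real"
  shows "(f has_integral I) A \<longleftrightarrow> ((\<lambda>x. indicator A x * f x) has_integral I) UNIV"
proof -
  have "(\<lambda>x. indicator A x * f x) = (\<lambda>x. if x \<in> A then f x else 0)" by (auto simp: indicator_def)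
  then show ?thesis by (simp add: has_integral_restrict_UNIV)
qed

definition vec2_pair :: "real^2 \<Rightarrow> real \<times> real" where "vec2_pair v = (v $ 1, v $ 2)"
definition vec2_complex :: "real^2 \<Rightarrow> complex" where "vec2_complex v = Complex (v $ 1) (v $ 2)"

lemma linear_vec2: "linear vec2_pair" "linear vec2_complex"
  by (auto intro!: linearI simp: vec2_pair_def vec2_complex_def complex_eq_iff)

lemma continuous_on_vec2: "continuous_on A vec2_pair" "continuous_on A vec2_complex"
  using linear_vec2 by (auto intro!: linear_continuous_on linear_conv_bounded_linear[THEN iffD1])

lemma measurable_vec2: "vec2_pair \<in> borel_measurable borel" "vec2_complex \<in> borel_measurable borel"
  by (intro borel_measurable_continuous_onI continuous_on_vec2)+

lemma Basis_real2: "(Basis :: (real^2) set) = {axis 1 1, axis 2 1}"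
  by (auto simp: Basis_vec_def UNIV_2)

lemma axis_2_neq: "axis 1 1 \<noteq> (axis 2 1 :: real^2)"
  by (simp add: axis_eq_axis)

lemma lborel_vec2_pair: "distr lborel borel vec2_pair = lborel"
proof (rule lborel_distr_basis_iso[OF linear_vec2(1)])
  show "bij_betw (\<lambda>j. if j = (1::real, 0::real) then axis 1 1 else axis 2 1) Basis (Basis :: (real^2) set)"
    using axis_2_neq unfolding Basis_real2 Basis_prod_def bij_betw_def by (auto simp: inj_on_def)
qed (auto simp: Basis_prod_def vec2_pair_def inner_axis)

lemma lborel_vec2_complex: "distr lborel borel vec2_complex = lborel"
proof (rule lborel_distr_basis_iso[OF linear_vec2(2)])
  show "bij_betw (\<lambda>j. if j = (1::complex) then axis 1 1 else axis 2 1) Basis (Basis :: (real^2) set)"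
    using axis_2_neq unfolding Basis_real2 Basis_complex_def bij_betw_def by (auto simp: inj_on_def)
qed (auto simp: Basis_complex_def vec2_complex_def inner_axis inner_complex_def)

text \<open>The Jacobian of a map to the complex plane with partial derivatives \<open>Ga\<close>, \<open>Gb\<close> is \<open>Im (cnj Ga * Gb)\<close>.\<close>

lemma complex_change_of_variables:
  fixes G :: "real \<times> real \<Rightarrow> complex" and f :: "complex \<Rightarrow> real"
  assumes Q: "Q \<in> sets borel" and GQ: "G ` Q \<in> sets borel"
    and G: "\<And>p. p \<in> Q \<Longrightarrow> (G has_derivative (\<lambda>h. fst h *\<^sub>R Ga p + snd h *\<^sub>R Gb p)) (at p)"
    and inj: "inj_on G Q" and f: "f \<in> borel_measurable borel" and f0: "\<And>z. 0 \<le> f z"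
    and J: "\<And>p. p \<in> Q \<Longrightarrow> J p = \<bar>Im (cnj (Ga p) * Gb p)\<bar> * f (G p)"
    and Jm: "continuous_on Q J"
    and int: "(J has_integral I) Q"
  shows "(f has_integral I) (G ` Q)"
proof -
  define S where "S = vec2_pair -` Q"
  define cv where "cv = (\<lambda>z. vector [Re z, Im z] :: real^2)"
  have cv: "cv (vec2_complex v) = v" "vec2_complex (cv z) = z" for v z
    by (simp_all add: cv_def vec2_complex_def vec_eq_iff forall_2)
  have cv_lin: "linear cv" by (auto intro!: linearI simp: cv_def vec_eq_iff forall_2)
  define g where "g = cv \<circ> G \<circ> vec2_pair"
  define g' where "g' = (\<lambda>v h. cv (fst (vec2_pair h) *\<^sub>R Ga (vec2_pair v) + snd (vec2_pair h) *\<^sub>R Gb (vec2_pair v)))"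
  have Sb: "S \<in> sets borel" using measurable_sets[OF measurable_vec2(1) Q] by (simp add: S_def)
  then have Sl: "S \<in> sets lebesgue" by (simp add: sets_completionI_sets)
  have der: "(g has_derivative g' v) (at v within S)" if "v \<in> S" for v
  proof -
    have "(vec2_pair has_derivative vec2_pair) (at v within S)"
      using linear_vec2(1) by (rule linear_imp_has_derivative)
    moreover have "(G has_derivative (\<lambda>h. fst h *\<^sub>R Ga (vec2_pair v) + snd h *\<^sub>R Gb (vec2_pair v))) (at (vec2_pair v) within vec2_pair ` S)"
      using G[of "vec2_pair v"] that by (auto simp: S_def intro: has_derivative_at_withinI)
    ultimately have "((G \<circ> vec2_pair) has_derivative (\<lambda>h. fst h *\<^sub>R Ga (vec2_pair v) + snd h *\<^sub>R Gb (vec2_pair v)) \<circ> vec2_pair) (at v within S)"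
      by (rule diff_chain_within)
    moreover have "(cv has_derivative cv) (at ((G \<circ> vec2_pair) v) within (G \<circ> vec2_pair) ` S)"
      using cv_lin by (rule linear_imp_has_derivative)
    ultimately show ?thesis using diff_chain_within unfolding g_def g'_def comp_assoc
      by (fastforce simp: o_def)
  qed
  have injg: "inj_on g S"
  proof (rule inj_onI)
    fix x y assume xy: "x \<in> S" "y \<in> S" "g x = g y"
    then have "G (vec2_pair x) = G (vec2_pair y)" unfolding g_def comp_apply using cv(2) by metis
    then have "vec2_pair x = vec2_pair y" using inj xy by (auto simp: S_def inj_on_def)
    then show "x = y" by (simp add: vec2_pair_def vec_eq_iff forall_2)
  qed
  have det: "\<bar>det (matrix (g' v))\<bar> = \<bar>Im (cnj (Ga (vec2_pair v)) * Gb (vec2_pair v))\<bar>" for v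
    unfolding det_2 by (simp add: matrix_def g'_def cv_def vec2_pair_def axis_def algebra_simps)
  define F where "F = (\<lambda>v. f (vec2_complex v))"
  have "((\<lambda>p. indicator Q p * J p) has_integral I) UNIV"
    by (rule has_integral_UNIV_indicator[THEN iffD1, OF int])
  moreover have "(\<lambda>p. indicator Q p * J p) \<in> borel_measurable borel"
    using borel_measurable_continuous_on_indicator[OF Q Jm] by simp
  moreover have J0: "0 \<le> indicator Q p * J p" for p using J f0 by (auto simp: indicator_def)
  ultimately have "((\<lambda>v. indicator Q (vec2_pair v) * J (vec2_pair v)) has_integral I) UNIV"
    using has_integral_distr_lborel_iff[OF measurable_vec2(1) lborel_vec2_pair, of "\<lambda>p. indicator Q p * J p" I] by simp
  moreover have "indicator Q (vec2_pair v) = (indicator S v :: real)" for v by (simp add: S_def indicator_def)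
  ultimately have "((\<lambda>v. indicator S v * J (vec2_pair v)) has_integral I) UNIV" by simp
  then have "((\<lambda>v. J (vec2_pair v)) has_integral I) S" by (rule has_integral_UNIV_indicator[THEN iffD2])
  then have JF: "((\<lambda>v. \<bar>det (matrix (g' v))\<bar> * F (g v)) has_integral I) S"
    by (rule has_integral_cong[THEN iffD1, rotated]) (simp add: det J S_def F_def g_def cv)
  have "(\<lambda>v. \<bar>det (matrix (g' v))\<bar> * F (g v)) absolutely_integrable_on S"
    using JF f0 by (intro nonnegative_absolutely_integrable_1) (auto simp: F_def)
  then have "(\<lambda>v. \<bar>det (matrix (g' v))\<bar> *\<^sub>R (vec (F (g v)) :: real^1)) absolutely_integrable_on S \<and>
      integral S (\<lambda>v. \<bar>det (matrix (g' v))\<bar> *\<^sub>R (vec (F (g v)) :: real^1)) = vec I"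
    using JF by (simp add: absolutely_integrable_on_1_iff integral_on_1_eq has_integral_iff)
  then have "(\<lambda>v. vec (F v) :: real^1) absolutely_integrable_on (g ` S) \<and> integral (g ` S) (\<lambda>v. vec (F v) :: real^1) = vec I"
    using has_absolute_integral_change_of_variables[OF Sl der injg, of "\<lambda>v. vec (F v) :: real^1" "vec I"] by blast
  then have "F absolutely_integrable_on (g ` S) \<and> integral (g ` S) F = I"
    by (simp add: absolutely_integrable_on_1_iff integral_on_1_eq)
  then have FI: "(F has_integral I) (g ` S)" by (simp add: has_integral_iff set_lebesgue_integral_eq_integral(1))
  have gS: "indicator (g ` S) v = (indicator (G ` Q) (vec2_complex v) :: real)" for v
  proof -
    have "vec2_pair ` S = Q"
    proof -
      have "p \<in> vec2_pair ` S" if "p \<in> Q" for p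
        using that by (intro image_eqI[of _ _ "vector [fst p, snd p]"]) (auto simp: S_def vec2_pair_def)
      then show ?thesis by (auto simp: S_def)
    qed
    then have "g ` S = cv ` (G ` Q)" unfolding g_def by (metis image_comp)
    moreover have "v \<in> cv ` A \<longleftrightarrow> vec2_complex v \<in> A" for A using cv by (metis image_iff)
    ultimately show ?thesis by (simp add: indicator_def)
  qed
  have "((\<lambda>v. indicator (G ` Q) (vec2_complex v) * f (vec2_complex v)) has_integral I) UNIV"
    using has_integral_UNIV_indicator[THEN iffD1, OF FI] unfolding gS F_def .
  moreover have "(\<lambda>z. indicator (G ` Q) z * f z) \<in> borel_measurable borel" using GQ f by measurable
  ultimately have "((\<lambda>z. indicator (G ` Q) z * f z) has_integral I) UNIV"
    using has_integral_distr_lborel_iff[OF measurable_vec2(2) lborel_vec2_complex, of "\<lambda>z. indicator (G ` Q) z * f z" I] f0 by simp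
  then show ?thesis by (rule has_integral_UNIV_indicator[THEN iffD2])
qed

lemma Im_complex_of_real_mult: "Im (of_real a * w) = a * Im w" by simp

lemma harea_eq:
  assumes A: "open A" and I: "((\<lambda>z. 4 / (1 - (norm z)\<^sup>2)\<^sup>2) has_integral I) A"
  shows "harea A = I"
proof -
  define f where "f = (\<lambda>z::complex. 4 / (1 - (norm z)\<^sup>2)\<^sup>2)"
  have "f absolutely_integrable_on A"
    using I unfolding f_def[symmetric] by (intro nonnegative_absolutely_integrable_1) (auto simp: f_def)
  moreover have "f \<in> borel_measurable borel" unfolding f_def by measurable
  then have "(\<lambda>x. indicator A x *\<^sub>R f x) \<in> borel_measurable lborel"
    using A by (intro borel_measurable_scaleR borel_measurable_indicator) auto
  ultimately have "set_integrable lborel A f"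
    unfolding set_integrable_def using integrable_completion by blast
  then have "harea A = integral A f"
    unfolding harea_def f_def using set_borel_integral_eq_integral(2) by blast
  then show ?thesis using I unfolding f_def by (simp add: has_integral_iff)
qed

context dual_arc begin

definition "polar = (\<lambda>(y, \<theta>). of_real y * Z \<theta>)"

lemma polar_deriv:
  "(polar has_derivative (\<lambda>h. fst h *\<^sub>R Z (snd p) + snd h *\<^sub>R (fst p *\<^sub>R Z' (snd p)))) (at p)"
proof -
  have "(snd has_derivative snd) (at p)" by (intro derivative_intros)
  moreover have "(Z has_derivative (\<lambda>h. h *\<^sub>R Z' (snd p))) (at (snd p))"
    using Z_deriv[of "snd p"] by (simp add: has_vector_derivative_def)
  ultimately have "((\<lambda>p. Z (snd p)) has_derivative (\<lambda>h. snd h *\<^sub>R Z' (snd p))) (at p)"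
    using diff_chain_at[of snd snd p Z] by (simp add: o_def)
  then have "((\<lambda>p. fst p *\<^sub>R Z (snd p)) has_derivative (\<lambda>h. fst p *\<^sub>R (snd h *\<^sub>R Z' (snd p)) + fst h *\<^sub>R Z (snd p))) (at p)"
    by (intro has_derivative_scaleR) (auto intro!: derivative_intros)
  then show ?thesis unfolding polar_def by (simp add: case_prod_unfold scaleR_conv_of_real algebra_simps)
qed

text \<open>This is \<open>\<bar>Z\<bar>\<^sup>2\<close> times the derivative of the argument of \<open>Z\<close>, the Euclidean Jacobian of the coordinates \<open>polar\<close> on the arc.\<close>

lemma cross_Z: "Im (cnj (Z \<theta>) * Z' \<theta>) = \<rho>\<^sup>2 * (E * cos \<theta> - 1)"
proof -
  have d: "cnj (b / of_real E) * (b / of_real E) = 1" using unit_cnj(1)[OF norm_dir] .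
  have "cnj (Z \<theta>) * Z' \<theta> = (cnj (b / of_real E) * (b / of_real E)) * (of_real (\<rho>\<^sup>2) * ((of_real E - cnj (cis (- \<theta>))) * (\<i> * cis (- \<theta>))))"
    unfolding Z_def' Z'_def by (simp add: power2_eq_square)
  also have "\<dots> = of_real (\<rho>\<^sup>2) * ((of_real E - cnj (cis (- \<theta>))) * (\<i> * cis (- \<theta>)))" unfolding d by simp
  also have "Im \<dots> = \<rho>\<^sup>2 * Im ((of_real E - cnj (cis (- \<theta>))) * (\<i> * cis (- \<theta>)))"
    by (rule Im_complex_of_real_mult)
  also have "Im ((of_real E - cnj (cis (- \<theta>))) * (\<i> * cis (- \<theta>))) = E * cos \<theta> - cos \<theta> * cos \<theta> - sin \<theta> * sin \<theta>"
    by (simp add: algebra_simps)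
  also have "\<dots> = E * cos \<theta> - 1" using sin_cos_squared_add3[of \<theta>] by linarith
  finally show ?thesis .
qed

lemma dens_pos: "\<theta> \<in> {- \<theta>0..\<theta>0} \<Longrightarrow> 0 < dens \<theta>"
proof -
  assume "\<theta> \<in> {- \<theta>0..\<theta>0}"
  then have "0 < 1 - (norm (Z \<theta>))\<^sup>2" using Z_in_hplane[of \<theta>] by (auto simp: hplane_iff)
  then have "0 < 2 * \<rho> * dens \<theta>" unfolding one_minus_norm_Z .
  then show ?thesis by (rule zero_less_mult_pos) (use basics(3) in simp)
qed

lemma continuous_on_Z: "continuous_on A Z"
  by (meson Z_deriv continuous_at_imp_continuous_on has_vector_derivative_continuous)

text \<open>The inner integral along the ray has the antiderivative \<open>2 y\<^sup>2 D / (1 - y\<^sup>2 \<bar>Z\<bar>\<^sup>2)\<close> and gives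
  \<open>1 - k / dens \<theta>\<close>. The constant \<open>1\<close> contributes the angle of the arc and the other term its total curvature:
  this is the Gauss-Bonnet formula for the sector.\<close>

lemma has_integral_sector_density:
  "((\<lambda>(y, \<theta>). y * (\<rho>\<^sup>2 * (E * cos \<theta> - 1)) * (4 / (1 - (y * norm (Z \<theta>))\<^sup>2)\<^sup>2))
     has_integral (2 * arctan K - k * ell k (sinh r))) ({0<..<1} \<times> {- \<theta>0<..<\<theta>0})"
proof -
  define J where "J = (\<lambda>(y::real, \<theta>). y * (\<rho>\<^sup>2 * (E * cos \<theta> - 1)) * (4 / (1 - (y * norm (Z \<theta>))\<^sup>2)\<^sup>2))"
  have less: "(y * norm (Z \<theta>))\<^sup>2 < 1" if "y \<in> {0..1}" "\<theta> \<in> {- \<theta>0..\<theta>0}" for y \<theta>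
  proof -
    have "norm (Z \<theta>) < 1" using that Z_in_hplane[of \<theta>] by (auto simp: hplane_def abs_le_iff)
    moreover have "y * norm (Z \<theta>) \<le> 1 * norm (Z \<theta>)" using that by (intro mult_right_mono) auto
    ultimately have "y * norm (Z \<theta>) < 1" by simp
    moreover have "0 \<le> y * norm (Z \<theta>)" using that by simp
    ultimately show ?thesis by (simp add: power_less_one_iff)
  qed
  have cont: "continuous_on (cbox (0, - \<theta>0) (1, \<theta>0)) J"
    unfolding J_def case_prod_unfold
    by (intro continuous_intros continuous_on_compose2[OF continuous_on_Z[of UNIV]])
      (use less in \<open>force simp: cbox_Pair_eq\<close>)+
  have inner: "integral (cbox 0 1) (\<lambda>y. J (y, \<theta>)) = 1 - k * (1 / dens \<theta>)" if \<theta>: "\<theta> \<in> {- \<theta>0..\<theta>0}" for \<theta>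
  proof -
    define n D where "n = norm (Z \<theta>)" and "D = \<rho>\<^sup>2 * (E * cos \<theta> - 1)"
    have "((\<lambda>y. J (y, \<theta>)) has_integral (2 * 1\<^sup>2 * D / (1 - (1 * n)\<^sup>2) - 2 * 0\<^sup>2 * D / (1 - (0 * n)\<^sup>2))) {0..1}"
    proof (rule fundamental_theorem_of_calculus)
      fix y :: real assume y: "y \<in> {0..1}"
      define q where "q = 1 - (y * n)\<^sup>2"
      have q: "0 < q" using less[OF y \<theta>] by (simp add: q_def n_def)
      have d1: "((\<lambda>y. 2 * y\<^sup>2 * D) has_real_derivative 4 * y * D) (at y within {0..1})"
        by (auto intro!: derivative_eq_intros)
      have d2: "((\<lambda>y. 1 - (y * n)\<^sup>2) has_real_derivative - (2 * y * n\<^sup>2)) (at y within {0..1})"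
        by (auto intro!: derivative_eq_intros simp: power2_eq_square)
      have q0: "1 - (y * n)\<^sup>2 \<noteq> 0" using q by (simp add: q_def)
      have "(4 * y * D * (1 - (y * n)\<^sup>2) - 2 * y\<^sup>2 * D * (- (2 * y * n\<^sup>2))) / ((1 - (y * n)\<^sup>2) * (1 - (y * n)\<^sup>2)) = J (y, \<theta>)"
      proof -
        have "4 * y * D * (1 - (y * n)\<^sup>2) - 2 * y\<^sup>2 * D * (- (2 * y * n\<^sup>2)) = y * D * 4" by algebra
        then show ?thesis by (simp add: J_def D_def n_def power2_eq_square)
      qed
      from DERIV_cong[OF DERIV_divide[OF d1 d2 q0] this]
      show "((\<lambda>y. 2 * y\<^sup>2 * D / (1 - (y * n)\<^sup>2)) has_vector_derivative J (y, \<theta>)) (at y within {0..1})"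
        by (simp add: has_real_derivative_iff_has_vector_derivative)
    qed simp
    then have "integral (cbox 0 1) (\<lambda>y. J (y, \<theta>)) = 2 * D / (1 - n\<^sup>2)" by (simp add: has_integral_iff)
    also have "\<dots> = (dens \<theta> - k) / dens \<theta>"
    proof -
      have "2 * D / (1 - n\<^sup>2) = (2 * \<rho> * (\<rho> * (E * cos \<theta> - 1))) / (2 * \<rho> * dens \<theta>)"
        unfolding n_def one_minus_norm_Z D_def by (simp add: power2_eq_square)
      also have "\<dots> = (\<rho> * (E * cos \<theta> - 1)) / dens \<theta>"
        using basics(3) by (intro mult_divide_mult_cancel_left) simp
      also have "\<rho> * (E * cos \<theta> - 1) = dens \<theta> - k" by (simp add: algebra_simps)
      finally show ?thesis .
    qed
    also have "\<dots> = 1 - k * (1 / dens \<theta>)"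
    proof -
      have "(q - k) / q = 1 - k * (1 / q)" if "0 < q" for q :: real using that by (simp add: diff_divide_distrib)
      from this[OF dens_pos[OF \<theta>]] show ?thesis .
    qed
    finally show ?thesis .
  qed
  have "integral (cbox (0, - \<theta>0) (1, \<theta>0)) J = integral (cbox (- \<theta>0) \<theta>0) (\<lambda>\<theta>. integral (cbox 0 1) (\<lambda>y. J (y, \<theta>)))"
  proof -
    have "integral (cbox (0, - \<theta>0) (1, \<theta>0)) J = integral (cbox 0 1) (\<lambda>y. integral (cbox (- \<theta>0) \<theta>0) (\<lambda>\<theta>. J (y, \<theta>)))"
      by (rule integral_prod_continuous[OF cont])
    also have "\<dots> = integral (cbox (- \<theta>0) \<theta>0) (\<lambda>\<theta>. integral (cbox 0 1) (\<lambda>y. J (y, \<theta>)))"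
      using cont by (intro integral_swap_continuous) (simp add: case_prod_unfold)
    finally show ?thesis .
  qed
  also have "\<dots> = integral {- \<theta>0..\<theta>0} (\<lambda>\<theta>. 1 - k * (1 / dens \<theta>))"
    unfolding cbox_interval[of "- \<theta>0"] by (intro integral_cong inner)
  also have "\<dots> = 2 * \<theta>0 - k * integral {- \<theta>0..\<theta>0} (\<lambda>\<theta>. 1 / dens \<theta>)"
  proof -
    have i: "(\<lambda>\<theta>. 1 / dens \<theta>) integrable_on {- \<theta>0..\<theta>0}"
      using dens_pos by (intro integrable_continuous_real continuous_intros) force
    show ?thesis using \<theta>0(1)
      by (subst integral_diff[OF integrable_const_ivl integrable_on_mult_right[OF i]]) (simp only: integral_mult_right, simp)
  qed
  also have "\<dots> = 2 * arctan K - k * ell k (sinh r)" unfolding integral_dens by (simp add: \<theta>0_def)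
  finally have "integral (cbox (0, - \<theta>0) (1, \<theta>0)) J = 2 * arctan K - k * ell k (sinh r)" .
  then have "(J has_integral (2 * arctan K - k * ell k (sinh r))) (cbox (0, - \<theta>0) (1, \<theta>0))"
    using integrable_continuous[OF cont] by (simp add: has_integral_iff)
  then have "(J has_integral (2 * arctan K - k * ell k (sinh r))) (box (0, - \<theta>0) (1, \<theta>0))"
    by (simp add: has_integral_open_interval)
  moreover have "box (0, - \<theta>0) (1, \<theta>0) = {0<..<1::real} \<times> {- \<theta>0<..<\<theta>0}"
    by (auto simp: mem_box Basis_prod_def)
  ultimately show ?thesis unfolding J_def by simp
qed

lemma open_sector: "open sector"
  unfolding sector_def excess_def form_def
  by (intro open_Collect_conj open_Collect_less continuous_intros)

lemma sector_subset_hplane: "sector \<subseteq> hplane"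
  using R_pos by (auto simp: sector_def hplane_def)

text \<open>Polar coordinates along the rays, followed by the isometry. The conformal factor of the isometry cancels against the change of the
  hyperbolic density.\<close>

lemma area_mob_sector:
  assumes c: "c \<in> hplane" and e: "norm e = 1"
  shows "((\<lambda>z. 4 / (1 - (norm z)\<^sup>2)\<^sup>2) has_integral (2 * arctan K - k * ell k (sinh r))) (mob e c ` sector)"
proof -
  define Q where "Q = {0<..<1::real} \<times> {- \<theta>0<..<\<theta>0}"
  define \<mu>' where "\<mu>' = (\<lambda>w. e * of_real (1 - (norm c)\<^sup>2) / (1 + cnj c * e * w)\<^sup>2)"
  define J where "J = (\<lambda>(y, \<theta>). y * (\<rho>\<^sup>2 * (E * cos \<theta> - 1)) * (4 / (1 - (y * norm (Z \<theta>))\<^sup>2)\<^sup>2))"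
  have pQ: "polar ` Q = sector" unfolding polar_def Q_def sector_eq ..
  have oS: "open (mob e c ` sector)" by (rule open_mob_image[OF c e open_sector sector_subset_hplane])
  have img: "mob e c ` sector = (mob e c \<circ> polar) ` Q" unfolding pQ[symmetric] by (simp add: image_comp)
  have ph: "polar p \<in> hplane" if "p \<in> Q" for p using that pQ sector_subset_hplane by blast
  show ?thesis unfolding img
  proof (rule complex_change_of_variables[where J = J and
        Ga = "\<lambda>p. \<mu>' (polar p) * Z (snd p)" and Gb = "\<lambda>p. \<mu>' (polar p) * (fst p *\<^sub>R Z' (snd p))"])
    show "Q \<in> sets borel" unfolding Q_def by (intro borel_open open_Times) auto
    show "(mob e c \<circ> polar) ` Q \<in> sets borel" unfolding img[symmetric] using oS by simp
    show "(J has_integral 2 * arctan K - k * ell k (sinh r)) Q"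
      using has_integral_sector_density unfolding J_def Q_def .
    show "(\<lambda>z::complex. 4 / (1 - (norm z)\<^sup>2)\<^sup>2) \<in> borel_measurable borel" by measurable
    show "inj_on (mob e c \<circ> polar) Q"
    proof (rule comp_inj_on)
      show "inj_on polar Q" unfolding polar_def Q_def by (rule sector_coord_inj)
      show "inj_on (mob e c) (polar ` Q)"
        unfolding pQ using bij_mob[OF c e] sector_subset_hplane by (auto simp: bij_betw_def intro: inj_on_subset)
    qed
    fix p assume p: "p \<in> Q"
    have "(mob e c has_derivative (\<lambda>h. \<mu>' (polar p) * h)) (at (polar p))"
      using mob_deriv[OF c e ph[OF p]] unfolding has_field_derivative_def \<mu>'_def .
    from diff_chain_at[OF polar_deriv this]
    show "(mob e c \<circ> polar has_derivative
          (\<lambda>h. fst h *\<^sub>R (\<mu>' (polar p) * Z (snd p)) + snd h *\<^sub>R (\<mu>' (polar p) * (fst p *\<^sub>R Z' (snd p))))) (at p)"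
      by (rule has_derivative_eq_rhs) (auto simp: fun_eq_iff scaleR_conv_of_real algebra_simps)
    obtain y \<theta> where y: "p = (y, \<theta>)" "0 < y" "y < 1" "\<bar>\<theta>\<bar> < \<theta>0" using p by (cases p) (auto simp: Q_def abs_less_iff)
    have pn: "norm (polar p) = y * norm (Z \<theta>)" using y by (simp add: polar_def norm_mult)
    have nn: "0 \<le> \<rho>\<^sup>2 * (E * cos \<theta> - 1)"
    proof -
      have "1 / E \<le> cos \<theta>" using cos_ge_iff(1)[of \<theta>] y \<theta>0 by auto
      then have "1 \<le> E * cos \<theta>" using basics(2) pos_divide_le_eq[of E 1 "cos \<theta>"] b0 by (simp add: mult.commute)
      then show ?thesis by (intro mult_nonneg_nonneg) auto
    qed
    have "Im (cnj (\<mu>' (polar p) * Z \<theta>) * (\<mu>' (polar p) * (y *\<^sub>R Z' \<theta>))) = (norm (\<mu>' (polar p)))\<^sup>2 * (y * Im (cnj (Z \<theta>) * Z' \<theta>))"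
    proof -
      have "cnj (\<mu>' (polar p) * Z \<theta>) * (\<mu>' (polar p) * (y *\<^sub>R Z' \<theta>)) = of_real ((norm (\<mu>' (polar p)))\<^sup>2 * y) * (cnj (Z \<theta>) * Z' \<theta>)"
        unfolding of_real_mult complex_norm_square by (simp add: scaleR_conv_of_real)
      then show ?thesis by (simp only: Im_complex_of_real_mult mult.assoc)
    qed
    then have det: "\<bar>Im (cnj (\<mu>' (polar p) * Z (snd p)) * (\<mu>' (polar p) * (fst p *\<^sub>R Z' (snd p))))\<bar>
       = (norm (\<mu>' (polar p)))\<^sup>2 * (y * (\<rho>\<^sup>2 * (E * cos \<theta> - 1)))"
    proof -
      assume eq: "Im (cnj (\<mu>' (polar p) * Z \<theta>) * (\<mu>' (polar p) * (y *\<^sub>R Z' \<theta>))) = (norm (\<mu>' (polar p)))\<^sup>2 * (y * Im (cnj (Z \<theta>) * Z' \<theta>))"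
      have p': "fst p = y" "snd p = \<theta>" using y(1) by simp_all
      show ?thesis unfolding p' eq cross_Z
        by (rule abs_of_nonneg, rule mult_nonneg_nonneg[OF zero_le_power2 mult_nonneg_nonneg[OF less_imp_le[OF y(2)] nn]])
    qed
    have conf: "(norm (\<mu>' (polar p)))\<^sup>2 / (1 - (norm (mob e c (polar p)))\<^sup>2)\<^sup>2 = 1 / (1 - (norm (polar p))\<^sup>2)\<^sup>2"
      using arg_cong[OF mob_conformal_factor[OF c e ph[OF p]], of "\<lambda>x. x\<^sup>2"]
      unfolding \<mu>'_def power_divide power_one .
    have "J p = (y * (\<rho>\<^sup>2 * (E * cos \<theta> - 1))) * 4 * (1 / (1 - (norm (polar p))\<^sup>2)\<^sup>2)"
      unfolding J_def pn using y by simp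
    also have "\<dots> = \<bar>Im (cnj (\<mu>' (polar p) * Z (snd p)) * (\<mu>' (polar p) * (fst p *\<^sub>R Z' (snd p))))\<bar>
        * (4 / (1 - (norm ((mob e c \<circ> polar) p))\<^sup>2)\<^sup>2)"
      unfolding det conf[symmetric] by simp
    finally show "J p = \<bar>Im (cnj (\<mu>' (polar p) * Z (snd p)) * (\<mu>' (polar p) * (fst p *\<^sub>R Z' (snd p))))\<bar>
        * (4 / (1 - (norm ((mob e c \<circ> polar) p))\<^sup>2)\<^sup>2)" .
  next
    have "(y * norm (Z \<theta>))\<^sup>2 \<noteq> 1" if "(y, \<theta>) \<in> Q" for y \<theta>
    proof -
      have "norm (polar (y, \<theta>)) = y * norm (Z \<theta>)" using that by (auto simp: polar_def norm_mult Q_def)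
      then show ?thesis using ph[OF that] unfolding hplane_iff by simp
    qed
    then show "continuous_on Q J" unfolding J_def case_prod_unfold
      by (intro continuous_intros continuous_on_compose2[OF continuous_on_Z[of UNIV]]) auto
  qed simp
qed

text \<open>The squared equation \<open>(b \<bullet> w)\<^sup>2 = K\<^sup>2 \<bar>w\<bar>\<^sup>2\<close> is a product of two linear equations because
  \<open>\<bar>b\<bar>\<^sup>2 = 1 + K\<^sup>2\<close>.\<close>

lemma negligible_excess_zero: "negligible {w. excess w = 0}"
proof -
  define b' where "b' = \<i> * b"
  have "{w. excess w = 0} \<subseteq> {w. (b - K *\<^sub>R b') \<bullet> w = 0} \<union> {w. (b + K *\<^sub>R b') \<bullet> w = 0}"
  proof
    fix w assume "w \<in> {w. excess w = 0}"
    then have "(b \<bullet> w)\<^sup>2 = K\<^sup>2 * (norm w)\<^sup>2" by (simp add: excess_def power_mult_distrib)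
    moreover have "(b \<bullet> w)\<^sup>2 + (b' \<bullet> w)\<^sup>2 = (1 + K\<^sup>2) * (norm w)\<^sup>2"
      unfolding b[symmetric] b'_def cmod_power2 inner_complex_def by (simp add: power2_eq_square algebra_simps)
    ultimately have "(b \<bullet> w)\<^sup>2 = K\<^sup>2 * (b' \<bullet> w)\<^sup>2" by algebra
    then have "(b \<bullet> w - K * (b' \<bullet> w)) * (b \<bullet> w + K * (b' \<bullet> w)) = 0" by algebra
    then show "w \<in> {w. (b - K *\<^sub>R b') \<bullet> w = 0} \<union> {w. (b + K *\<^sub>R b') \<bullet> w = 0}"
      by (auto simp: inner_diff_left inner_add_left)
  qed
  moreover have "b - K *\<^sub>R b' \<noteq> 0" "b + K *\<^sub>R b' \<noteq> 0"
  proof -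
    have *: "b - K *\<^sub>R b' = b * Complex 1 (- K)" "b + K *\<^sub>R b' = b * Complex 1 K"
      by (simp_all add: b'_def complex_eq_iff)
    have "Complex 1 (- K) \<noteq> 0" "Complex 1 K \<noteq> 0" by (simp_all add: complex_eq_iff)
    then show "b - K *\<^sub>R b' \<noteq> 0" "b + K *\<^sub>R b' \<noteq> 0" unfolding * using b0 by simp_all
  qed
  then have "negligible ({w. (b - K *\<^sub>R b') \<bullet> w = 0} \<union> {w. (b + K *\<^sub>R b') \<bullet> w = 0})"
    by (intro negligible_Un negligible_hyperplane) auto
  ultimately show ?thesis using negligible_subset by blast
qed
end

context dual_triangle begin

lemma area_mob_region:
  assumes c: "c \<in> hplane" and e: "norm e = 1"
  shows "harea (mob e c ` region) = tri_area k1 k2 k3 (sinh r)"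
proof (rule harea_eq)
  define f where "f = (\<lambda>z::complex. 4 / (1 - (norm z)\<^sup>2)\<^sup>2)"
  have rh: "region \<subseteq> hplane" using arc1.R_pos by (auto simp: region_def hplane_def)
  have "open region" unfolding region_def
    by (intro open_Collect_conj open_Collect_less continuous_intros continuous_on_form)
  then show "open (mob e c ` region)" using rh by (rule open_mob_image[OF c e])
  have inj: "inj_on (mob e c) hplane" using bij_mob[OF c e] by (simp add: bij_betw_def)
  have s: "arc1.sector \<subseteq> region" "arc2.sector \<subseteq> region" "arc3.sector \<subseteq> region"
  proof -
    have pos: "0 < arc1.form w" if "norm w < dual_rad r" "arc1.excess w \<le> 0" for w
      using that arc1.a_pos unfolding arc1.form_excess by (smt (verit) mult_pos_pos zero_less_power2)
    have pos2: "0 < arc2.form w" if "norm w < dual_rad r" "arc2.excess w \<le> 0" for w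
      using that arc2.a_pos unfolding arc2.form_excess by (smt (verit) mult_pos_pos zero_less_power2)
    have pos3: "0 < arc3.form w" if "norm w < dual_rad r" "arc3.excess w \<le> 0" for w
      using that arc3.a_pos unfolding arc3.form_excess by (smt (verit) mult_pos_pos zero_less_power2)
    show "arc1.sector \<subseteq> region" "arc2.sector \<subseteq> region" "arc3.sector \<subseteq> region"
      unfolding arc1.sector_def arc2.sector_def arc3.sector_def region_def
      using excess_disjoint pos pos2 pos3 by (auto simp: less_imp_le)
  qed
  have d: "arc1.sector \<inter> arc2.sector = {}" "(arc1.sector \<union> arc2.sector) \<inter> arc3.sector = {}"
  proof -
    have "w \<notin> arc2.sector \<and> w \<notin> arc3.sector" if "w \<in> arc1.sector" for w
      using that excess_disjoint(1)[of w] by (auto simp: arc1.sector_def arc2.sector_def arc3.sector_def)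
    moreover have "w \<notin> arc3.sector" if "w \<in> arc2.sector" for w
      using that excess_disjoint(2)[of w] by (auto simp: arc2.sector_def arc3.sector_def)
    ultimately show "arc1.sector \<inter> arc2.sector = {}" "(arc1.sector \<union> arc2.sector) \<inter> arc3.sector = {}"
      by blast+
  qed
  have md: "mob e c ` A \<inter> mob e c ` B = {}" if "A \<inter> B = {}" "A \<subseteq> region" "B \<subseteq> region" for A B
  proof -
    have "A \<subseteq> hplane" "B \<subseteq> hplane" using that rh by blast+
    from inj_on_image_Int[OF inj this] show ?thesis using that(1) by simp
  qed
  have "(f has_integral (2 * arctan K1 - k1 * ell k1 (sinh r)) + (2 * arctan K2 - k2 * ell k2 (sinh r)))
      (mob e c ` arc1.sector \<union> mob e c ` arc2.sector)"
    unfolding f_def using md[OF d(1) s(1,2)]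
    by (intro has_integral_Un arc1.area_mob_sector arc2.area_mob_sector c e) simp
  moreover have "(f has_integral (2 * arctan K3 - k3 * ell k3 (sinh r))) (mob e c ` arc3.sector)"
    unfolding f_def by (rule arc3.area_mob_sector[OF c e])
  moreover have "(mob e c ` arc1.sector \<union> mob e c ` arc2.sector) \<inter> mob e c ` arc3.sector = {}"
    using md[OF d(2) _ s(3)] s by (simp add: image_Un)
  then have "negligible ((mob e c ` arc1.sector \<union> mob e c ` arc2.sector) \<inter> mob e c ` arc3.sector)" by simp
  ultimately have "(f has_integral tri_area k1 k2 k3 (sinh r))
      ((mob e c ` arc1.sector \<union> mob e c ` arc2.sector) \<union> mob e c ` arc3.sector)"
    unfolding tri_area_def by (rule has_integral_Un)
  then have U: "(f has_integral tri_area k1 k2 k3 (sinh r)) (mob e c ` (arc1.sector \<union> arc2.sector \<union> arc3.sector))"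
    by (simp add: image_Un)
  define N where "N = region - (arc1.sector \<union> arc2.sector \<union> arc3.sector)"
  have "N \<subseteq> {w. arc1.excess w = 0} \<union> {w. arc2.excess w = 0} \<union> {w. arc3.excess w = 0}"
  proof
    fix w assume "w \<in> N"
    then show "w \<in> {w. arc1.excess w = 0} \<union> {w. arc2.excess w = 0} \<union> {w. arc3.excess w = 0}"
      using excess_cover[of w]
      by (auto simp: N_def arc1.sector_def arc2.sector_def arc3.sector_def region_def)
  qed
  then have nN: "negligible N"
    by (rule negligible_subset[rotated])
      (intro negligible_Un arc1.negligible_excess_zero arc2.negligible_excess_zero arc3.negligible_excess_zero)
  have "negligible (mob e c ` N)"
  proof (rule negligible_differentiable_image_negligible[OF _ nN])
    show "mob e c differentiable_on N"
      unfolding differentiable_on_def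
    proof
      fix w assume "w \<in> N"
      then have "w \<in> hplane" using rh by (auto simp: N_def)
      then have "mob e c field_differentiable (at w)"
        using mob_deriv[OF c e] unfolding field_differentiable_def by blast
      then show "mob e c differentiable (at w within N)"
        using field_differentiable_imp_differentiable differentiable_at_withinI by blast
    qed
  qed simp
  then have 1: "negligible {x \<in> mob e c ` region - mob e c ` (arc1.sector \<union> arc2.sector \<union> arc3.sector). f x \<noteq> 0}"
    by (rule negligible_subset) (unfold N_def, blast)
  have 2: "negligible {x \<in> mob e c ` (arc1.sector \<union> arc2.sector \<union> arc3.sector) - mob e c ` region. f x \<noteq> 0}"
    by (rule negligible_subset[OF negligible_empty]) (use s in blast)
  show "((\<lambda>z. 4 / (1 - (norm z)\<^sup>2)\<^sup>2) has_integral tri_area k1 k2 k3 (sinh r)) (mob e c ` region)"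
    using U has_integral_spike_set_eq[OF 1 2] unfolding f_def by blast
qed
end

section \<open>Comparing two packings\<close>

text \<open>The second elementary symmetric function, written such that no order of the vertices has to be chosen.\<close>

definition pair_sum :: "'v set \<Rightarrow> ('v \<Rightarrow> real) \<Rightarrow> real" where
  "pair_sum W k = ((\<Sum>x\<in>W. k x)\<^sup>2 - (\<Sum>x\<in>W. (k x)\<^sup>2)) / 2"

lemma pair_sum_3:
  assumes "u \<noteq> v" "v \<noteq> w" "u \<noteq> w"
  shows "pair_sum {u, v, w} k = k u * k v + k v * k w + k u * k w"
  using assms by (simp add: pair_sum_def power2_eq_square algebra_simps)

text \<open>All that the comparison of packings needs to know about the geometry of a face.\<close>

lemma triangle_packing_arcs:
  assumes tp: "triangle_packing W k D c r" and W: "card W = 3"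
  shows "0 < sinh r" "\<And>x. x \<in> W \<Longrightarrow> 0 < k x" "(sinh r)\<^sup>2 * pair_sum W k = 1"
    "\<And>x. x \<in> W \<Longrightarrow> harc_length (hbdry (D x) \<inter> hcball c r) = ell (k x) (sinh r)"
    "harea (inside (\<Union>x\<in>W. hbdry (D x) \<inter> hcball c r)) =
      (\<Sum>x\<in>W. 2 * arctan (k x * sinh r) - k x * ell (k x) (sinh r))"
proof -
  obtain u v w e b where uvw: "W = {u, v, w}" "u \<noteq> v" "v \<noteq> w" "u \<noteq> w"
    and e: "norm e = 1" and c: "c \<in> hplane" and r: "0 < r" and k: "\<And>x. x \<in> W \<Longrightarrow> 0 < k x"
    and rim: "\<And>x. x \<in> W \<Longrightarrow> hbdry (D x) = mob e c ` cap_rim (k x) (k x * cosh r) (b x)"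
    and b: "b u = Complex (k u * sinh r) (- 1)" "b v = Complex (k v * sinh r) 1"
    "b w = Complex (k w * sinh r - 2 / (k u * sinh r + k v * sinh r))
       ((k v * sinh r - k u * sinh r) / (k u * sinh r + k v * sinh r))"
    and e2: "(k u * sinh r) * (k v * sinh r) + (k v * sinh r) * (k w * sinh r) + (k u * sinh r) * (k w * sinh r) = 1"
    by (rule triangle_normal_form[OF tp W], rule that) (assumption | blast)+
  show s: "0 < sinh r" using r by simp
  show kp: "0 < k x" if "x \<in> W" for x by (rule k[OF that])
  show "(sinh r)\<^sup>2 * pair_sum W k = 1"
    using e2 unfolding uvw(1) pair_sum_3[OF uvw(2-4)] by (simp add: power2_eq_square algebra_simps)
  interpret dt: dual_triangle "k u" "k v" "k w" r
    by unfold_locales (use k r e2 uvw in auto)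
  have b': "b u = dt.b1" "b v = dt.b2" "b w = dt.b3" unfolding dt.b1_def dt.b2_def dt.b3_def using b by simp_all
  have sub: "hbdry (D x) \<inter> hcball c r = mob e c ` (cap_rim (k x) (k x * cosh r) (b x) \<inter> cball 0 (dual_rad r))" if "x \<in> W" for x
  proof -
    have inj: "inj_on (mob e c) hplane" using bij_mob[OF c e] by (simp add: bij_betw_def)
    have "cap_rim (k x) (k x * cosh r) (b x) \<subseteq> hplane" by (auto simp: cap_rim_def)
    moreover have "cball 0 (dual_rad r) \<subseteq> hplane" using dual_rad(2)[OF r] by (auto simp: hplane_def)
    ultimately show ?thesis
      unfolding rim[OF that] hcball_eq_mob[OF c e r] by (rule inj_on_image_Int[OF inj, symmetric])
  qed
  show "harc_length (hbdry (D x) \<inter> hcball c r) = ell (k x) (sinh r)" if "x \<in> W" for x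
    using that dt.arc1.harc_length_mob_arc[OF c e] dt.arc2.harc_length_mob_arc[OF c e] dt.arc3.harc_length_mob_arc[OF c e]
    unfolding sub[OF that] b'[symmetric] uvw(1) by auto
  have "(\<Union>x\<in>W. hbdry (D x) \<inter> hcball c r) = mob e c ` (\<Union>x\<in>W. cap_rim (k x) (k x * cosh r) (b x) \<inter> cball 0 (dual_rad r))"
    using sub by auto
  also have "(\<Union>x\<in>W. cap_rim (k x) (k x * cosh r) (b x) \<inter> cball 0 (dual_rad r)) = dt.rims"
    unfolding uvw(1) dt.rims_def
    by (simp only: UN_insert UN_empty b' dt.arc1.rim_inside_dual_form dt.arc2.rim_inside_dual_form
        dt.arc3.rim_inside_dual_form Un_assoc Un_empty_right)
  finally have "harea (inside (\<Union>x\<in>W. hbdry (D x) \<inter> hcball c r)) = tri_area (k u) (k v) (k w) (sinh r)"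
    using dt.inside_mob_rims[OF c e] dt.area_mob_region[OF c e] by simp
  also have "\<dots> = (\<Sum>x\<in>W. 2 * arctan (k x * sinh r) - k x * ell (k x) (sinh r))"
    unfolding tri_area_def uvw(1) using uvw(2-4) by simp
  finally show "harea (inside (\<Union>x\<in>W. hbdry (D x) \<inter> hcball c r)) =
      (\<Sum>x\<in>W. 2 * arctan (k x * sinh r) - k x * ell (k x) (sinh r))" .
qed

lemma pair_sum_mono:
  assumes "card W = 3" "\<And>x. x \<in> W \<Longrightarrow> 0 < k' x" "\<And>x. x \<in> W \<Longrightarrow> k' x \<le> k x"
  shows "0 < pair_sum W k'" "pair_sum W k' \<le> pair_sum W k"
proof -
  obtain u v w where uvw: "W = {u, v, w}" "u \<noteq> v" "v \<noteq> w" "u \<noteq> w"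
    using assms(1) by (auto simp: card_3_iff)
  have p: "0 < k' u" "0 < k' v" "0 < k' w" and l: "k' u \<le> k u" "k' v \<le> k v" "k' w \<le> k w" using assms(2,3) uvw(1) by auto
  show "0 < pair_sum W k'" unfolding uvw(1) pair_sum_3[OF uvw(2-4)] using p by (intro add_pos_pos mult_pos_pos)
  have "k' u * k' v \<le> k u * k v" "k' v * k' w \<le> k v * k w" "k' u * k' w \<le> k u * k w"
    using p l by (auto intro!: mult_mono)
  then show "pair_sum W k' \<le> pair_sum W k" unfolding uvw(1) pair_sum_3[OF uvw(2-4)] by linarith
qed

lemma pair_sum_scale: "pair_sum W (\<lambda>x. l * k x) = (l::real)\<^sup>2 * pair_sum W k"
  unfolding pair_sum_def by (simp add: power_mult_distrib right_diff_distrib flip: sum_distrib_left)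

text \<open>The size of a face is a decreasing function of the curvatures and homogeneous of degree \<open>-1\<close>. The factor \<open>l\<close>
  serves the maximum principle; \<open>l = 1\<close> is plain monotonicity.\<close>

lemma sinh_radius_le:
  assumes W: "card W = 3" and k': "\<And>x. x \<in> W \<Longrightarrow> 0 < k' x" and le: "\<And>x. x \<in> W \<Longrightarrow> k' x \<le> l * k x" and l: "0 < l"
    and s: "0 < s" "s\<^sup>2 * pair_sum W k = 1" and s': "0 < s'" "s'\<^sup>2 * pair_sum W k' = 1"
  shows "s / l \<le> s'"
proof -
  have E: "0 < pair_sum W k'" "pair_sum W k' \<le> l\<^sup>2 * pair_sum W k"
    using pair_sum_mono[where W = W and k' = k' and k = "\<lambda>x. l * k x"] W k' le unfolding pair_sum_scale by auto
  have "(s / l)\<^sup>2 * pair_sum W k' \<le> (s / l)\<^sup>2 * (l\<^sup>2 * pair_sum W k)" using E by (intro mult_left_mono) auto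
  also have "\<dots> = s'\<^sup>2 * pair_sum W k'" using l s s' by (simp add: power_divide)
  finally have "(s / l)\<^sup>2 \<le> s'\<^sup>2" using E(1) by simp
  then show ?thesis by (rule power2_le_imp_le) (use s' in simp)
qed

lemma area_sum_mono:
  assumes W: "card W = 3" and k': "\<And>x. x \<in> W \<Longrightarrow> 0 < k' x" and le: "\<And>x. x \<in> W \<Longrightarrow> k' x \<le> k x"
    and s: "0 < s" "s\<^sup>2 * pair_sum W k = 1" and s': "0 < s'" "s'\<^sup>2 * pair_sum W k' = 1"
  shows "(\<Sum>x\<in>W. 2 * arctan (k x * s) - k x * ell (k x) s) \<le> (\<Sum>x\<in>W. 2 * arctan (k' x * s') - k' x * ell (k' x) s')"
proof -
  obtain u v w where uvw: "W = {u, v, w}" "u \<noteq> v" "v \<noteq> w" "u \<noteq> w"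
    using W by (auto simp: card_3_iff)
  have p: "0 < k' u" "0 < k' v" "0 < k' w" and l: "k' u \<le> k u" "k' v \<le> k v" "k' w \<le> k w" using k' le uvw(1) by auto
  have "s / 1 \<le> s'"
    by (rule sinh_radius_le[where W = W and k = k and k' = k']) (use W k' le s s' in auto)
  then have ss: "s \<le> s'" by simp
  have "tri_area (k u) (k v) (k w) s \<le> tri_area (k' u) (k' v) (k' w) s'"
    using s s' p l ss unfolding uvw(1) pair_sum_3[OF uvw(2-4)] by (intro tri_area_mono) auto
  then show ?thesis unfolding tri_area_def uvw(1) using uvw(2-4) by (simp add: algebra_simps)
qed

context
  fixes T :: "('v, 'e, 'f) triangulation" and g n :: nat and P :: "('v, 'f) packing"
  assumes tri: "triangulates T g n" and pack: "is_packing T P"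
begin

lemma triangulation_faces:
  assumes "f \<in> faces T"
  shows "face_verts T f \<subseteq> verts T \<and> card (face_verts T f) = 3 \<and> face_edges T f \<subseteq> edges T \<and>
    bij_betw (ends T) (face_edges T f) {W. W \<subseteq> face_verts T f \<and> card W = 2}"
  by (rule bspec[OF tri[unfolded triangulates_def, THEN conjunct2, THEN conjunct2, THEN conjunct2,
        THEN conjunct2, THEN conjunct1] assms])

lemma vertex_in_face: "v \<in> verts T \<Longrightarrow> \<exists>f\<in>faces T. v \<in> face_verts T f"
  by (rule bspec[OF tri[unfolded triangulates_def, THEN conjunct2, THEN conjunct2, THEN conjunct2,
        THEN conjunct2, THEN conjunct2, THEN conjunct1]])

lemma face_card: "f \<in> faces T \<Longrightarrow> card (face_verts T f) = 3" "f \<in> faces T \<Longrightarrow> face_verts T f \<subseteq> verts T"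
  using triangulation_faces by auto

lemma finite_parts: "finite (verts T)" "finite (faces T)"
  using tri[unfolded triangulates_def, THEN conjunct1]
    tri[unfolded triangulates_def, THEN conjunct2, THEN conjunct2, THEN conjunct1] by simp_all

lemma edge_face_vertex:
  assumes "f \<in> faces T" "j \<in> face_edges T f" "v \<in> ends T j"
  shows "v \<in> face_verts T f"
proof -
  have "bij_betw (ends T) (face_edges T f) {W. W \<subseteq> face_verts T f \<and> card W = 2}"
    using triangulation_faces[OF assms(1)] by blast
  then have "ends T j \<in> {W. W \<subseteq> face_verts T f \<and> card W = 2}" using assms(2) by (rule bij_betw_apply)
  then show ?thesis using assms(3) by auto
qed

lemma face_packing: "f \<in> faces T \<Longrightarrow> triangle_packing (face_verts T f) (curv P) (disk P f) (dual_center P f) (dual_radius P f)"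
  using pack unfolding is_packing_def by blast

lemma packing_sinh_radius:
  assumes "f \<in> faces T"
  shows "0 < sinh (dual_radius P f)" "(sinh (dual_radius P f))\<^sup>2 * pair_sum (face_verts T f) (curv P) = 1"
  by (rule triangle_packing_arcs(1)[OF face_packing[OF assms] face_card(1)[OF assms]],
      rule triangle_packing_arcs(3)[OF face_packing[OF assms] face_card(1)[OF assms]])

lemma packing_arc_len:
  assumes "f \<in> faces T" "v \<in> face_verts T f"
  shows "arc_len P f v = ell (curv P v) (sinh (dual_radius P f))"
  unfolding arc_len_def sub_arc_def
  by (rule triangle_packing_arcs(4)[OF face_packing[OF assms(1)] face_card(1)[OF assms(1)] assms(2)])

lemma packing_area:
  assumes "f \<in> faces T"
  shows "harea (Omega T P f) = (\<Sum>x\<in>face_verts T f. 2 * arctan (curv P x * sinh (dual_radius P f))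
      - curv P x * ell (curv P x) (sinh (dual_radius P f)))"
  unfolding Omega_def sub_arc_def
  by (rule triangle_packing_arcs(5)[OF face_packing[OF assms] face_card(1)[OF assms]])

lemma packing_curv_pos: "v \<in> verts T \<Longrightarrow> 0 < curv P v"
  using pack unfolding is_packing_def by blast
end

text \<open>At a vertex where the ratio of curvatures is a maximum \<open>l > 1\<close>, every face has a strictly larger total curvature in
  the second packing.\<close>

lemma curvature_maximum_principle:
  assumes tri: "triangulates T g n" and P: "is_packing T P" and P': "is_packing T P'"
    and bd: "\<And>v. v \<in> boundary_verts T \<Longrightarrow> curv P' v \<le> curv P v"
    and int: "\<And>v. v \<in> interior_verts T \<Longrightarrow> total_curv T P' v = total_curv T P v"
    and v: "v \<in> verts T"
  shows "curv P' v \<le> curv P v"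
proof -
  have fin: "finite (verts T)" by (rule finite_parts(1)[OF tri P])
  define q where "q = (\<lambda>v. curv P' v / curv P v)"
  define l where "l = Max (q ` verts T)"
  have ql: "q x \<le> l" if "x \<in> verts T" for x using that fin by (simp add: l_def)
  have "l \<in> q ` verts T" unfolding l_def using fin v by (intro Max_in) auto
  then obtain x where x: "x \<in> verts T" "q x = l" by blast
  note pos = packing_curv_pos[OF tri P] packing_curv_pos[OF tri P']
  have "l \<le> 1"
  proof (rule ccontr)
    assume "\<not> l \<le> 1"
    then have l: "1 < l" by simp
    then have "\<not> curv P' x \<le> curv P x" using x pos(1)[OF x(1)] by (auto simp: q_def)
    then have xi: "x \<in> interior_verts T" using bd x(1) by (auto simp: interior_verts_def)
    have lk: "curv P' y \<le> l * curv P y" if "y \<in> verts T" for y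
      using ql[OF that] pos(1)[OF that] by (simp add: q_def divide_le_eq)
    have eq: "curv P' x = l * curv P x" using x pos(1)[OF x(1)] by (auto simp: q_def)
    \<comment> \<open>lowering the curvatures at the other two vertices below \<open>l\<close> times the old ones only increases the dual circle\<close>
    have "curv P x * arc_len P f x < curv P' x * arc_len P' f x" if f: "f \<in> faces T" "x \<in> face_verts T f" for f
    proof -
      note fc = face_card[OF tri P f(1)]
      have "sinh (dual_radius P f) / l \<le> sinh (dual_radius P' f)"
        using fc l lk pos packing_sinh_radius[OF tri P f(1)] packing_sinh_radius[OF tri P' f(1)]
        by (intro sinh_radius_le[OF fc(1), of "curv P'" l "curv P"]) (auto dest: subsetD)
      then show ?thesis
        unfolding packing_arc_len[OF tri P f] packing_arc_len[OF tri P' f] eq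
        using pos(1)[OF x(1)] l packing_sinh_radius(1)[OF tri P f(1)] by (intro total_curvature_scaling)
    qed
    moreover have "finite {f \<in> faces T. x \<in> face_verts T f}" using finite_parts(2)[OF tri P] by simp
    moreover have "{f \<in> faces T. x \<in> face_verts T f} \<noteq> {}"
      using vertex_in_face[OF tri P x(1)] by blast
    ultimately have "total_curv T P x < total_curv T P' x" unfolding total_curv_def
      by (intro sum_strict_mono) auto
    then show False using int[OF xi] by simp
  qed
  then have "q v \<le> 1" using ql[OF v] by simp
  then show ?thesis using pos(1)[OF v] by (simp add: q_def divide_le_eq)
qed

lemma arc_chain_transfer:
  assumes "arc_chain T P' i j L'"
    and "\<And>f j v. f \<in> faces T \<Longrightarrow> j \<in> face_edges T f \<Longrightarrow> v \<in> ends T j \<Longrightarrow> arc_len P f v \<le> arc_len P' f v"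
  shows "\<exists>L. arc_chain T P i j L \<and> L \<le> L'"
  using assms(1)
proof (induction rule: arc_chain.induct)
  case empty
  show ?case by (intro exI conjI, rule arc_chain.empty[OF empty], rule order_refl)
next
  case (step j L' f j' v)
  obtain L where L: "arc_chain T P i j L" "L \<le> L'" using step.IH by (elim exE conjE)
  have "arc_chain T P i j' (L + arc_len P f v)"
    by (rule arc_chain.step[OF L(1) step.hyps(2-7)])
  moreover have "L + arc_len P f v \<le> L' + arc_len P' f v"
    by (rule add_mono[OF L(2) assms(2)[OF step.hyps(2,3,6)]])
  ultimately show ?case by (intro exI conjI)
qed

lemma arc_chain_exists:
  assumes "arc_chain T P i j L" shows "\<exists>L'. arc_chain T P' i j L'"
  using assms
proof (induction rule: arc_chain.induct)
  case empty
  show ?case by (rule exI, rule arc_chain.empty[OF empty])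
next
  case (step j L f j' v)
  obtain L' where L: "arc_chain T P' i j L'" using step.IH by (elim exE)
  show ?case by (rule exI, rule arc_chain.step[OF L step.hyps(2-7)])
qed

text \<open>If no chain joins \<open>i\<close> and \<open>j\<close>, both sides are the infimum of the empty set.\<close>

lemma tangent_dist_mono:
  assumes le: "\<And>f j v. f \<in> faces T \<Longrightarrow> j \<in> face_edges T f \<Longrightarrow> v \<in> ends T j \<Longrightarrow> arc_len P f v \<le> arc_len P' f v"
    and nonneg: "\<And>f j v. f \<in> faces T \<Longrightarrow> j \<in> face_edges T f \<Longrightarrow> v \<in> ends T j \<Longrightarrow> 0 \<le> arc_len P f v"
  shows "tangent_dist T P i j \<le> tangent_dist T P' i j"
proof (cases "{L. arc_chain T P' i j L} = {}")
  case True
  then have "\<not> arc_chain T P i j L" for L using arc_chain_exists[of T P i j L P'] by auto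
  then have "{L. arc_chain T P i j L} = {}" by simp
  then show ?thesis using True by (simp add: tangent_dist_def)
next
  case False
  have "0 \<le> L" if "arc_chain T P i j L" for L
    using that by induction (auto intro: add_nonneg_nonneg nonneg)
  then have "bdd_below {L. arc_chain T P i j L}" by (intro bdd_belowI[of _ 0]) auto
  then show ?thesis unfolding tangent_dist_def using arc_chain_transfer[OF _ le] False
    by (intro cInf_mono) auto
qed

theorem theorem1p6:
  fixes T :: "('v, 'e, 'f) triangulation"
    and g n :: nat
    and khat khat' That :: "'v \<Rightarrow> real"
    and P P' :: "('v, 'f) packing"
  assumes "n \<ge> 1"
    and "triangulates T g n"
    and "card (boundary_verts T) \<ge> 2"
    and "\<forall>f\<in>faces T. card (face_verts T f \<inter> boundary_verts T) \<le> 2"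
    and "\<forall>v\<in>boundary_verts T. 0 < khat v"
    and "\<forall>v\<in>boundary_verts T. 0 < khat' v"
    and "That \<in> admissible_curvatures T"
    and "realizes T P khat That"
    and "realizes T P' khat' That"
    and "\<forall>v\<in>boundary_verts T. curv P' v \<le> curv P v"
  shows "(\<forall>f\<in>faces T. harea (Omega T P' f) \<ge> harea (Omega T P f)) \<and>
    (\<forall>f\<in>faces T. \<forall>v\<in>face_verts T f. arc_len P' f v \<ge> arc_len P f v) \<and>
    (\<forall>i\<in>edges T. \<forall>j\<in>edges T. tangent_dist T P' i j \<ge> tangent_dist T P i j)"
proof -
  note tri = assms(2)
  have P: "is_packing T P" and P': "is_packing T P'" using assms(8,9) by (simp_all add: realizes_def)
  have le: "curv P' v \<le> curv P v" if "v \<in> verts T" for v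
    using curvature_maximum_principle[OF tri P P' _ _ that] assms(8-10) by (simp add: realizes_def)
  note pos' = packing_curv_pos[OF tri P']
  have area: "harea (Omega T P f) \<le> harea (Omega T P' f)" if f: "f \<in> faces T" for f
    unfolding packing_area[OF tri P f] packing_area[OF tri P' f]
    using face_card[OF tri P f] le pos' packing_sinh_radius[OF tri P f] packing_sinh_radius[OF tri P' f]
    by (intro area_sum_mono) (auto dest: subsetD)
  have len: "arc_len P f v \<le> arc_len P' f v" if f: "f \<in> faces T" and v: "v \<in> face_verts T f" for f v
  proof -
    note fc = face_card[OF tri P f]
    have "sinh (dual_radius P f) / 1 \<le> sinh (dual_radius P' f)"
      using fc le pos' packing_sinh_radius[OF tri P f] packing_sinh_radius[OF tri P' f]
      by (intro sinh_radius_le[OF fc(1), of "curv P'" 1 "curv P"]) (auto dest: subsetD)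
    then show ?thesis
      unfolding packing_arc_len[OF tri P f v] packing_arc_len[OF tri P' f v]
      using le pos' v fc(2) by (intro ell_mono) (auto simp: less_imp_le dest: subsetD)
  qed
  have "tangent_dist T P i j \<le> tangent_dist T P' i j" for i j
  proof (rule tangent_dist_mono)
    fix f j v assume fjv: "f \<in> faces T" "j \<in> face_edges T f" "v \<in> ends T j"
    have v: "v \<in> face_verts T f" by (rule edge_face_vertex[OF tri P fjv])
    show "arc_len P f v \<le> arc_len P' f v" by (rule len[OF fjv(1) v])
    show "0 \<le> arc_len P f v" unfolding packing_arc_len[OF tri P fjv(1) v] by (rule ell_nonneg)
  qed
  then show ?thesis using area len by blast
qed

end
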